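(* Let $\mathcal{M}$ and $\mathcal{N}$ be $F$-finite $F$-modules. For every $\phi \in \operatorname{Hom}_{\mathcal{F}} (\mathcal{N}, \mathcal{M})$ there exist generating morphisms $\gamma: M \rightarrow F(M)$ and $\beta: N \rightarrow F(N)$ (with $M$, $N$ finitely generated $R$-modules) for $\mathcal{M}$ and $\mathcal{N}$, respectively, and an $R$-linear map $g:N\to M$ with $\gamma\circ g=F(g)\circ\beta$ (i.e. a morphism from $\beta$ to $\gamma$ in the category $\mathcal{D}$), such that $\phi=\mathcal{H}(\Psi(g))$, i.e. such that $\phi$ is the map $$\mathcal{N}=\varinjlim\left(N\xrightarrow{\beta}F(N)\xrightarrow{F(\beta)}F^2(N)\to\cdots\right)\longrightarrow \varinjlim\left(M\xrightarrow{\gamma}F(M)\xrightarrow{F(\gamma)}F^2(M)\to\cdots\right)=\mathcal{M}$$ of direct limits induced by the maps $F^e(g):F^e(N)\to F^e(M)$, $e\ge 0$.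
   Context: $(R,m)$ is a complete regular local ring of prime characteristic $p$, and $f:R\to R$, $f(r)=r^p$, is the Frobenius map. $E=E_R(R/m)$ and $(-)^\vee=\operatorname{Hom}_R(-,E)$ is the Matlis dual. $F_*R$ denotes $R$ regarded as an $R$-module via $r\cdot s=r^p s$. The Frobenius functor $F$ is $F(M)=F_*R\otimes_R M$ with $R$-module structure $r(s\otimes m)=rs\otimes m$. An $F$-module is an $R$-module $\mathcal{M}$ with an $R$-linear isomorphism $\theta_{\mathcal{M}}:\mathcal{M}\to F(\mathcal{M})$. A morphism of $F$-modules $g:\mathcal{N}\to\mathcal{M}$ is an $R$-linear map with $\theta_{\mathcal{M}}\circ g=F(g)\circ\theta_{\mathcal{N}}$; the set of these is $\operatorname{Hom}_{\mathcal{F}}(\mathcal{N},\mathcal{M})$. If $M$ is a finitely generated $R$-module and $\beta:M\to F(M)$ is $R$-linear, then $\mathcal{M}=\varinjlim(M\xrightarrow{\beta}F(M)\xrightarrow{F(\beta)}F^2(M)\to\cdots)$ is an $F$-module, its structure isomorphism being the identification of $\mathcal{M}$ with $F(\mathcal{M})=\varinjlim(F(M)\xrightarrow{F(\beta)}F^2(M)\to\cdots)$. An $F$-module (isomorphic to one) of this form is called $F$-finite with generating morphism $\beta$; $\beta$ is not required to be injective. $\mathcal{D}$ is the category whose objects are $R$-linear maps $M\to F(M)$ with $M$ a finitely generated $R$-module, and whose morphisms from $a:M\to F(M)$ to $b:N\to F(N)$ are $R$-linear maps $\mu:M\to N$ with $b\circ\mu=F(\mu)\circ a$. $R[\Theta;f]$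 is the skew polynomial ring $\bigoplus_{i\ge0}R\Theta^i$ with $\Theta r=r^p\Theta$; $\mathcal{C}$ is the category of $R[\Theta;f]$-modules that are Artinian over $R$. The functor $\Delta:\mathcal{C}\to\mathcal{D}$ sends $L$ to $\alpha^\vee:L^\vee\to F(L)^\vee\cong F(L^\vee)$, where $\alpha:F(L)\to L$, $\alpha(r\otimes a)=r\Theta a$. The functor $\Psi:\mathcal{D}\to\mathcal{C}$ is the inverse construction (up to canonical isomorphism): $\Psi(b:B\to F(B))$ is $B^\vee$ with the $\Theta$-action determined by $b^\vee:F(B^\vee)\cong F(B)^\vee\to B^\vee$ via $\Theta a=b^\vee(1\otimes a)$; on morphisms both functors are given by Matlis duality. Lyubeznik's functor is $\mathcal{H}(L)=\varinjlim(L^\vee\xrightarrow{\alpha^\vee}F(L^\vee)\xrightarrow{F(\alpha^\vee)}F^2(L^\vee)\to\cdots)$, and for a morphism $h$ in $\mathcal{C}$, $\mathcal{H}(h)$ is the direct limit of the maps $F^e(h^\vee)$. *)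

theory Defs
  imports
    "HOL-Algebra.Algebra"
    "HOL-Library.Extended_Nat"
begin

section \<open>Complete regular local rings of prime characteristic\<close>

definition krull_dim :: "('a, 'k) ring_scheme \<Rightarrow> enat" where
  "krull_dim R =
     (SUP n \<in> {n. \<exists>P. (\<forall>i\<le>n. primeideal (P i) R) \<and> (\<forall>i<n. P i \<subset> P (Suc i))}. enat n)"

definition min_num_gens :: "('a, 'k) ring_scheme \<Rightarrow> 'a set \<Rightarrow> nat" where
  "min_num_gens R I = (LEAST n. \<exists>A \<subseteq> carrier R. finite A \<and> card A = n \<and> I = Idl\<^bsub>R\<^esub> A)"

definition noetherian_local_ring :: "('a, 'k) ring_scheme \<Rightarrow> 'a set \<Rightarrow> bool" where
  "noetherian_local_ring R \<mm> \<longleftrightarrow>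
     cring R \<and> noetherian_ring R \<and> maximalideal \<mm> R \<and> (\<forall>J. maximalideal J R \<longrightarrow> J = \<mm>)"

definition regular_local_ring :: "('a, 'k) ring_scheme \<Rightarrow> 'a set \<Rightarrow> bool" where
  "regular_local_ring R \<mm> \<longleftrightarrow>
     noetherian_local_ring R \<mm> \<and> enat (min_num_gens R \<mm>) = krull_dim R"

definition adically_complete :: "('a, 'k) ring_scheme \<Rightarrow> 'a set \<Rightarrow> bool" where
  "adically_complete R I \<longleftrightarrow>
     (\<Inter>n::nat. I [^]\<^bsub>ideals_set R\<^esub> n) = {\<zero>\<^bsub>R\<^esub>} \<and>
     (\<forall>x :: nat \<Rightarrow> 'a.
        range x \<subseteq> carrier R \<and>
        (\<forall>k::nat. \<exists>n. \<forall>i\<ge>n. \<forall>j\<ge>n. x i \<ominus>\<^bsub>R\<^esub> x j \<in> I [^]\<^bsub>ideals_set R\<^esub> k) \<longrightarrow>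
        (\<exists>y \<in> carrier R. \<forall>k::nat. \<exists>n. \<forall>i\<ge>n. x i \<ominus>\<^bsub>R\<^esub> y \<in> I [^]\<^bsub>ideals_set R\<^esub> k))"

text \<open>A local ring is nonzero, so for prime \<open>p\<close> the last condition says that
  the characteristic is exactly \<open>p\<close>.\<close>

definition complete_regular_local_ring_char :: "('a, 'k) ring_scheme \<Rightarrow> 'a set \<Rightarrow> nat \<Rightarrow> bool" where
  "complete_regular_local_ring_char R \<mm> p \<longleftrightarrow>
     regular_local_ring R \<mm> \<and> adically_complete R \<mm> \<and>
     Factorial_Ring.prime p \<and> [p] \<cdot>\<^bsub>R\<^esub> \<one>\<^bsub>R\<^esub> = \<zero>\<^bsub>R\<^esub>"


section \<open>Modules\<close>

text \<open>The record type of modules extends that of rings; the fields \<open>mult\<close> and \<open>one\<close>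
  of a module carry no information and are left unspecified below.\<close>

definition mod_hom ::
    "('a, 'k) ring_scheme \<Rightarrow> ('a, 'b) module \<Rightarrow> ('a, 'c) module \<Rightarrow> ('b \<Rightarrow> 'c) set" where
  "mod_hom R M N =
     {h \<in> carrier M \<rightarrow> carrier N.
        (\<forall>x \<in> carrier M. \<forall>y \<in> carrier M. h (x \<oplus>\<^bsub>M\<^esub> y) = h x \<oplus>\<^bsub>N\<^esub> h y) \<and>
        (\<forall>r \<in> carrier R. \<forall>x \<in> carrier M. h (r \<odot>\<^bsub>M\<^esub> x) = r \<odot>\<^bsub>N\<^esub> h x)}"

definition mod_iso ::
    "('a, 'k) ring_scheme \<Rightarrow> ('a, 'b) module \<Rightarrow> ('a, 'c) module \<Rightarrow> ('b \<Rightarrow> 'c) set" where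
  "mod_iso R M N = {h \<in> mod_hom R M N. bij_betw h (carrier M) (carrier N)}"

definition fin_gen_module :: "('a, 'k) ring_scheme \<Rightarrow> ('a, 'b) module \<Rightarrow> bool" where
  "fin_gen_module R M \<longleftrightarrow> module R M \<and>
     (\<exists>S \<subseteq> carrier M. finite S \<and>
        (\<forall>x \<in> carrier M. \<exists>c \<in> S \<rightarrow> carrier R. x = (\<Oplus>\<^bsub>M\<^esub>s\<in>S. c s \<odot>\<^bsub>M\<^esub> s)))"

definition copy_module :: "('b \<Rightarrow> 'c) \<Rightarrow> ('a, 'b) module \<Rightarrow> ('a, 'c) module" where
  "copy_module h M = (let h' = inv_into (carrier M) h in
     \<lparr>carrier = h ` carrier M, monoid.mult = undefined, one = undefined,
      ring.zero = h \<zero>\<^bsub>M\<^esub>, add = (\<lambda>x y. h (h' x \<oplus>\<^bsub>M\<^esub> h' y)),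
      smult = (\<lambda>r x. h (r \<odot>\<^bsub>M\<^esub> h' x))\<rparr>)"


section \<open>Tensor products\<close>

text \<open>\<open>A \<otimes>\<^sub>R B\<close> is the free abelian group on \<open>A \<times> B\<close> modulo \<^term>\<open>tensor_null R A B\<close>,
  and \<^term>\<open>tensor_map R A' B' f g\<close> is the map \<open>f \<otimes> g\<close> into \<open>A' \<otimes>\<^sub>R B'\<close>.\<close>

abbreviation tensor_free :: "('a, 'b) module \<Rightarrow> ('a, 'c) module \<Rightarrow> (('b \<times> 'c) \<Rightarrow>\<^sub>0 int) monoid" where
  "tensor_free A B \<equiv> free_Abelian_group (carrier A \<times> carrier B)"

definition tensor_null ::
    "('a, 'k) ring_scheme \<Rightarrow> ('a, 'b) module \<Rightarrow> ('a, 'c) module \<Rightarrow> (('b \<times> 'c) \<Rightarrow>\<^sub>0 int) set" where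
  "tensor_null R A B = generate (tensor_free A B)
     ({frag_of (x \<oplus>\<^bsub>A\<^esub> x', y) - frag_of (x, y) - frag_of (x', y) | x x' y.
         x \<in> carrier A \<and> x' \<in> carrier A \<and> y \<in> carrier B} \<union>
      {frag_of (x, y \<oplus>\<^bsub>B\<^esub> y') - frag_of (x, y) - frag_of (x, y') | x y y'.
         x \<in> carrier A \<and> y \<in> carrier B \<and> y' \<in> carrier B} \<union>
      {frag_of (r \<odot>\<^bsub>A\<^esub> x, y) - frag_of (x, r \<odot>\<^bsub>B\<^esub> y) | r x y.
         r \<in> carrier R \<and> x \<in> carrier A \<and> y \<in> carrier B})"

definition tensor_group ::
    "('a, 'k) ring_scheme \<Rightarrow> ('a, 'b) module \<Rightarrow> ('a, 'c) module \<Rightarrow> (('b \<times> 'c) \<Rightarrow>\<^sub>0 int) set monoid" where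
  "tensor_group R A B = tensor_free A B Mod tensor_null R A B"

definition tensor_map ::
    "('a, 'k) ring_scheme \<Rightarrow> ('a, 'd) module \<Rightarrow> ('a, 'e) module \<Rightarrow> ('b \<Rightarrow> 'd) \<Rightarrow> ('c \<Rightarrow> 'e) \<Rightarrow>
      (('b \<times> 'c) \<Rightarrow>\<^sub>0 int) set \<Rightarrow> (('d \<times> 'e) \<Rightarrow>\<^sub>0 int) set" where
  "tensor_map R A' B' f g C =
     tensor_null R A' B' <#>\<^bsub>tensor_free A' B'\<^esub>
       (frag_extend (\<lambda>(x, y). frag_of (f x, g y)) ` C)"


section \<open>The Frobenius functor\<close>

text \<open>\<open>F\<^sub>*R\<close>: the group \<open>R\<close> with \<open>r \<cdot> s = r\<^sup>p s\<close>.\<close>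

definition frob_push :: "('a, 'k) ring_scheme \<Rightarrow> nat \<Rightarrow> ('a, 'a) module" where
  "frob_push R p =
     \<lparr>carrier = carrier R, monoid.mult = undefined, one = undefined,
      ring.zero = \<zero>\<^bsub>R\<^esub>, add = (\<oplus>\<^bsub>R\<^esub>),
      smult = (\<lambda>r s. (r [^]\<^bsub>R\<^esub> p) \<otimes>\<^bsub>R\<^esub> s)\<rparr>"

text \<open>\<open>F(M) = F\<^sub>*R \<otimes>\<^sub>R M\<close> with \<open>r (s \<otimes> m) = rs \<otimes> m\<close>.\<close>

definition frob ::
    "('a, 'k) ring_scheme \<Rightarrow> nat \<Rightarrow> ('a, 'b) module \<Rightarrow> ('a, (('a \<times> 'b) \<Rightarrow>\<^sub>0 int) set) module" where
  "frob R p M = (let T = tensor_group R (frob_push R p) M in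
     \<lparr>carrier = carrier T, monoid.mult = undefined, one = undefined,
      ring.zero = \<one>\<^bsub>T\<^esub>, add = (\<otimes>\<^bsub>T\<^esub>),
      smult = (\<lambda>r. tensor_map R (frob_push R p) M (\<lambda>s. r \<otimes>\<^bsub>R\<^esub> s) (\<lambda>m. m))\<rparr>)"

text \<open>\<open>F(h) : F(M) \<rightarrow> F(N)\<close> for \<open>h : M \<rightarrow> N\<close>; only the codomain \<open>N\<close> is needed as an argument.\<close>

definition frob_map ::
    "('a, 'k) ring_scheme \<Rightarrow> nat \<Rightarrow> ('a, 'c) module \<Rightarrow> ('b \<Rightarrow> 'c) \<Rightarrow>
      (('a \<times> 'b) \<Rightarrow>\<^sub>0 int) set \<Rightarrow> (('a \<times> 'c) \<Rightarrow>\<^sub>0 int) set" where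
  "frob_map R p N h = tensor_map R (frob_push R p) N (\<lambda>s. s) h"


section \<open>Iterating the Frobenius functor\<close>

text \<open>\<^const>\<open>frob\<close> changes the type of module elements, whereas all \<open>F\<^sup>e(M)\<close> must have one
  type in order to form their direct limit. The type \<open>'a ftree\<close> is large enough for this: it
  accommodates every finitely generated \<open>R\<close>-module (lemma \<open>fin_gen_module_ftree\<close>), and with a
  module \<open>M\<close> carried by \<open>'a ftree\<close> also \<open>F(M)\<close> (lemma \<open>inj_frob_code\<close>). Thus letting finitely
  generated modules range over this type is no restriction up to isomorphism. The iterates of
  \<open>F\<close> are formed after transporting \<open>F(M)\<close> along an arbitrary fixed injection
  \<open>frob_code\<close> into \<open>'a ftree\<close>.\<close>

datatype 'a ftree = FTree "('a \<times> 'a ftree) list"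

lemma inj_nat_ftree: "\<exists>f :: nat \<Rightarrow> 'a ftree. inj f"
proof -
  have "inj (\<lambda>n::nat. FTree (replicate n (undefined :: 'a, FTree [])))"
    by (rule injI) (metis ftree.inject length_replicate)
  then show ?thesis by blast
qed

lemma inj_frag_ftree: "\<exists>f :: (('a \<times> 'a ftree) \<Rightarrow>\<^sub>0 int) \<Rightarrow> 'a ftree. inj f"
proof -
  obtain \<nu> :: "nat \<Rightarrow> 'a ftree" where \<nu>: "inj \<nu>"
    using inj_nat_ftree by blast
  define pt :: "('a \<times> 'a ftree) \<times> int \<Rightarrow> 'a \<times> 'a ftree" where
    "pt = (\<lambda>((a, t), k). (a, FTree [(undefined, t), (undefined, \<nu> (to_nat k))]))"
  have pt: "inj pt"
    by (auto simp: pt_def inj_def inj_eq[OF \<nu>])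
  define enum :: "(('a \<times> 'a ftree) \<Rightarrow>\<^sub>0 int) \<Rightarrow> (('a \<times> 'a ftree) \<times> int) list" where
    "enum c = map (\<lambda>x. (x, Poly_Mapping.lookup c x)) (SOME xs. set xs = Poly_Mapping.keys c)" for c
  have set_enum: "set (enum c) = (\<lambda>x. (x, Poly_Mapping.lookup c x)) ` Poly_Mapping.keys c" for c
  proof -
    have "set (SOME xs. set xs = Poly_Mapping.keys c) = Poly_Mapping.keys c"
      by (rule someI_ex) (simp add: finite_list)
    then show ?thesis by (simp add: enum_def)
  qed
  have "inj enum"
  proof (rule injI)
    fix c d assume "enum c = enum d"
    then have eq: "(\<lambda>x. (x, Poly_Mapping.lookup c x)) ` Poly_Mapping.keys c =
        (\<lambda>x. (x, Poly_Mapping.lookup d x)) ` Poly_Mapping.keys d"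
      using set_enum by metis
    show "c = d"
    proof (rule poly_mapping_eqI)
      fix x
      show "Poly_Mapping.lookup c x = Poly_Mapping.lookup d x"
        using eq by (smt (verit) image_iff in_keys_iff prod.inject)
    qed
  qed
  then have "inj (\<lambda>c. FTree (map pt (enum c)))"
    using pt by (auto simp: inj_def inj_map_eq_map[OF pt])
  then show ?thesis by blast
qed

definition frob_code ::
    "('a, 'k) ring_scheme \<Rightarrow> nat \<Rightarrow> ('a, 'a ftree) module \<Rightarrow> (('a \<times> 'a ftree) \<Rightarrow>\<^sub>0 int) set \<Rightarrow> 'a ftree" where
  "frob_code R p M = (SOME h. inj_on h (carrier (frob R p M)))"

lemma inj_frob_code: "inj_on (frob_code R p M) (carrier (frob R p M))"
proof -
  let ?T = "tensor_free (frob_push R p) M" and ?K = "tensor_null R (frob_push R p) M"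
  obtain f :: "(('a \<times> 'a ftree) \<Rightarrow>\<^sub>0 int) \<Rightarrow> 'a ftree" where f: "inj f"
    using inj_frag_ftree by blast
  have "\<exists>c. C = ?K #>\<^bsub>?T\<^esub> c" if "C \<in> carrier (frob R p M)" for C
    using that by (auto simp: frob_def tensor_group_def FactGroup_def RCOSETS_def)
  then obtain rep where rep: "\<And>C. C \<in> carrier (frob R p M) \<Longrightarrow> C = ?K #>\<^bsub>?T\<^esub> rep C"
    by metis
  have "inj_on (f \<circ> rep) (carrier (frob R p M))"
    by (rule inj_onI) (metis comp_apply f injD rep)
  then show ?thesis
    unfolding frob_code_def by (rule someI[where P = "\<lambda>h. inj_on h (carrier (frob R p M))"])
qed

lemma fin_gen_module_ftree:
  fixes M :: "('a, 'b) module"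
  assumes "fin_gen_module R M"
  shows "\<exists>h :: 'b \<Rightarrow> 'a ftree. inj_on h (carrier M) \<and>
    module R (copy_module h M) \<and> h \<in> mod_iso R M (copy_module h M)"
proof -
  interpret module R M
    using assms by (simp add: fin_gen_module_def)
  obtain S where S: "finite S"
    and gen: "\<forall>x \<in> carrier M. \<exists>c \<in> S \<rightarrow> carrier R. x = (\<Oplus>\<^bsub>M\<^esub>s\<in>S. c s \<odot>\<^bsub>M\<^esub> s)"
    and SM: "S \<subseteq> carrier M"
    using assms by (auto simp: fin_gen_module_def)
  obtain xs where xs: "set xs = S" using S finite_list by blast
  from gen obtain c where c: "\<And>x. x \<in> carrier M \<Longrightarrow> c x \<in> S \<rightarrow> carrier R"
    and cx: "\<And>x. x \<in> carrier M \<Longrightarrow> x = (\<Oplus>\<^bsub>M\<^esub>s\<in>S. c x s \<odot>\<^bsub>M\<^esub> s)"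
    by metis
  define h :: "'b \<Rightarrow> 'a ftree" where "h x = FTree (map (\<lambda>s. (c x s, FTree [])) xs)" for x
  have inj: "inj_on h (carrier M)"
  proof (rule inj_onI)
    fix x y assume xy: "x \<in> carrier M" "y \<in> carrier M" "h x = h y"
    then have eq: "\<And>s. s \<in> S \<Longrightarrow> c x s = c y s"
      using xs by (auto simp: h_def)
    have "(\<Oplus>\<^bsub>M\<^esub>s\<in>S. c x s \<odot>\<^bsub>M\<^esub> s) = (\<Oplus>\<^bsub>M\<^esub>s\<in>S. c y s \<odot>\<^bsub>M\<^esub> s)"
      using c[OF xy(2)] SM eq by (intro M.finsum_cong') auto
    then show "x = y"
      using cx xy by metis
  qed
  have inv: "inv_into (carrier M) h (h x) = x" if "x \<in> carrier M" for x
    using inj that by simp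
  have ab: "abelian_group (copy_module h M)"
  proof (rule abelian_groupI)
    fix y assume "y \<in> carrier (copy_module h M)"
    then obtain x where x: "x \<in> carrier M" "y = h x"
      by (auto simp: copy_module_def Let_def)
    then show "\<exists>z \<in> carrier (copy_module h M). z \<oplus>\<^bsub>copy_module h M\<^esub> y = \<zero>\<^bsub>copy_module h M\<^esub>"
      by (intro bexI[of _ "h (\<ominus>\<^bsub>M\<^esub> x)"]) (auto simp: copy_module_def Let_def inv M.l_neg)
  qed (auto simp: copy_module_def Let_def inv M.a_ac)
  have "module R (copy_module h M)"
    using ab by (intro moduleI R.is_cring)
      (auto simp: copy_module_def Let_def inv smult_l_distr smult_r_distr smult_assoc1)
  moreover have "h \<in> mod_iso R M (copy_module h M)"
    using inj by (auto simp: mod_iso_def mod_hom_def bij_betw_def copy_module_def Let_def inv)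
  ultimately show ?thesis
    using inj by blast
qed

definition frob_ft ::
    "('a, 'k) ring_scheme \<Rightarrow> nat \<Rightarrow> ('a, 'a ftree) module \<Rightarrow> ('a, 'a ftree) module" where
  "frob_ft R p M = copy_module (frob_code R p M) (frob R p M)"

definition frob_ft_map ::
    "('a, 'k) ring_scheme \<Rightarrow> nat \<Rightarrow> ('a, 'a ftree) module \<Rightarrow> ('a, 'a ftree) module \<Rightarrow>
      ('a ftree \<Rightarrow> 'a ftree) \<Rightarrow> 'a ftree \<Rightarrow> 'a ftree" where
  "frob_ft_map R p M N h =
     frob_code R p N \<circ> frob_map R p N h \<circ> inv_into (carrier (frob R p M)) (frob_code R p M)"

primrec frob_pow ::
    "('a, 'k) ring_scheme \<Rightarrow> nat \<Rightarrow> ('a, 'a ftree) module \<Rightarrow> nat \<Rightarrow> ('a, 'a ftree) module" where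
  "frob_pow R p M 0 = M"
| "frob_pow R p M (Suc e) = frob_ft R p (frob_pow R p M e)"

primrec frob_pow_map ::
    "('a, 'k) ring_scheme \<Rightarrow> nat \<Rightarrow> ('a, 'a ftree) module \<Rightarrow> ('a, 'a ftree) module \<Rightarrow>
      ('a ftree \<Rightarrow> 'a ftree) \<Rightarrow> nat \<Rightarrow> 'a ftree \<Rightarrow> 'a ftree" where
  "frob_pow_map R p M N h 0 = h"
| "frob_pow_map R p M N h (Suc e) =
     frob_ft_map R p (frob_pow R p M e) (frob_pow R p N e) (frob_pow_map R p M N h e)"


section \<open>Sequential direct limits\<close>

text \<open>For a sequence \<open>D 0 \<rightarrow> D 1 \<rightarrow> \<dots>\<close> with transition maps \<open>t i : D i \<rightarrow> D (i + 1)\<close>,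
  \<open>seq_trans t i k\<close> is the composite \<open>D i \<rightarrow> D (i + k)\<close>. Elements of the direct limit are
  equivalence classes in the disjoint union of the \<open>D i\<close>, and \<open>dirlim_in D t i\<close> is the canonical
  map from \<open>D i\<close>.\<close>

primrec seq_trans :: "(nat \<Rightarrow> 'b \<Rightarrow> 'b) \<Rightarrow> nat \<Rightarrow> nat \<Rightarrow> 'b \<Rightarrow> 'b" where
  "seq_trans t i 0 x = x"
| "seq_trans t i (Suc k) x = t (i + k) (seq_trans t i k x)"

definition dirlim_in ::
    "(nat \<Rightarrow> ('a, 'b) module) \<Rightarrow> (nat \<Rightarrow> 'b \<Rightarrow> 'b) \<Rightarrow> nat \<Rightarrow> 'b \<Rightarrow> (nat \<times> 'b) set" where
  "dirlim_in D t i x = {(j, y). y \<in> carrier (D j) \<and>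
     (\<exists>n. i \<le> n \<and> j \<le> n \<and> seq_trans t i (n - i) x = seq_trans t j (n - j) y)}"

definition dirlim ::
    "(nat \<Rightarrow> ('a, 'b) module) \<Rightarrow> (nat \<Rightarrow> 'b \<Rightarrow> 'b) \<Rightarrow> ('a, (nat \<times> 'b) set) module" where
  "dirlim D t =
     \<lparr>carrier = {dirlim_in D t i x | i x. x \<in> carrier (D i)},
      monoid.mult = undefined, one = undefined,
      ring.zero = dirlim_in D t 0 \<zero>\<^bsub>D 0\<^esub>,
      add = (\<lambda>A B. \<Union>{dirlim_in D t i (x \<oplus>\<^bsub>D i\<^esub> y) | i x y. (i, x) \<in> A \<and> (i, y) \<in> B}),
      smult = (\<lambda>r C. \<Union>{dirlim_in D t i (r \<odot>\<^bsub>D i\<^esub> x) | i x. (i, x) \<in> C})\<rparr>"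

text \<open>The map into \<open>dirlim Y u\<close> induced by maps \<open>g i : D i \<rightarrow> Y i\<close>.\<close>

definition dirlim_map ::
    "(nat \<Rightarrow> ('a, 'c) module) \<Rightarrow> (nat \<Rightarrow> 'c \<Rightarrow> 'c) \<Rightarrow> (nat \<Rightarrow> 'b \<Rightarrow> 'c) \<Rightarrow>
      (nat \<times> 'b) set \<Rightarrow> (nat \<times> 'c) set" where
  "dirlim_map Y u g C = \<Union>{dirlim_in Y u i (g i x) | i x. (i, x) \<in> C}"


section \<open>F-modules\<close>

definition F_module ::
    "('a, 'k) ring_scheme \<Rightarrow> nat \<Rightarrow> ('a, 'b) module \<Rightarrow> ('b \<Rightarrow> (('a \<times> 'b) \<Rightarrow>\<^sub>0 int) set) \<Rightarrow> bool" where
  "F_module R p M \<theta> \<longleftrightarrow> module R M \<and> \<theta> \<in> mod_iso R M (frob R p M)"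

definition F_hom ::
    "('a, 'k) ring_scheme \<Rightarrow> nat \<Rightarrow> ('a, 'b) module \<Rightarrow> ('b \<Rightarrow> (('a \<times> 'b) \<Rightarrow>\<^sub>0 int) set) \<Rightarrow>
      ('a, 'c) module \<Rightarrow> ('c \<Rightarrow> (('a \<times> 'c) \<Rightarrow>\<^sub>0 int) set) \<Rightarrow> ('b \<Rightarrow> 'c) set" where
  "F_hom R p N \<theta>N M \<theta>M =
     {g \<in> mod_hom R N M. \<forall>x \<in> carrier N. \<theta>M (g x) = frob_map R p M g (\<theta>N x)}"

definition F_iso ::
    "('a, 'k) ring_scheme \<Rightarrow> nat \<Rightarrow> ('a, 'b) module \<Rightarrow> ('b \<Rightarrow> (('a \<times> 'b) \<Rightarrow>\<^sub>0 int) set) \<Rightarrow>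
      ('a, 'c) module \<Rightarrow> ('c \<Rightarrow> (('a \<times> 'c) \<Rightarrow>\<^sub>0 int) set) \<Rightarrow> ('b \<Rightarrow> 'c) set" where
  "F_iso R p N \<theta>N M \<theta>M = {g \<in> F_hom R p N \<theta>N M \<theta>M. bij_betw g (carrier N) (carrier M)}"

text \<open>The category \<open>\<D>\<close>: objects \<open>(M, \<beta>)\<close> and morphisms \<open>(N, \<beta>) \<rightarrow> (M, \<gamma>)\<close>.\<close>

definition D_obj ::
    "('a, 'k) ring_scheme \<Rightarrow> nat \<Rightarrow> ('a, 'b) module \<Rightarrow> ('b \<Rightarrow> (('a \<times> 'b) \<Rightarrow>\<^sub>0 int) set) \<Rightarrow> bool" where
  "D_obj R p M \<beta> \<longleftrightarrow> fin_gen_module R M \<and> \<beta> \<in> mod_hom R M (frob R p M)"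

definition D_hom ::
    "('a, 'k) ring_scheme \<Rightarrow> nat \<Rightarrow> ('a, 'b) module \<Rightarrow> ('b \<Rightarrow> (('a \<times> 'b) \<Rightarrow>\<^sub>0 int) set) \<Rightarrow>
      ('a, 'c) module \<Rightarrow> ('c \<Rightarrow> (('a \<times> 'c) \<Rightarrow>\<^sub>0 int) set) \<Rightarrow> ('b \<Rightarrow> 'c) set" where
  "D_hom R p N \<beta> M \<gamma> =
     {g \<in> mod_hom R N M. \<forall>x \<in> carrier N. \<gamma> (g x) = frob_map R p M g (\<beta> x)}"

text \<open>The transition maps \<open>F\<^sup>e(\<beta>) : F\<^sup>e(M) \<rightarrow> F\<^sup>e(F(M)) = F\<^sup>e\<^sup>+\<^sup>1(M)\<close>, the \<open>R\<close>-module
  \<open>lim F\<^sup>e(M)\<close>, and the map \<open>lim F\<^sup>e(N) \<rightarrow> lim F\<^sup>e(M)\<close> induced by the \<open>F\<^sup>e(g)\<close>.\<close>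

definition gen_trans ::
    "('a, 'k) ring_scheme \<Rightarrow> nat \<Rightarrow> ('a, 'a ftree) module \<Rightarrow>
      ('a ftree \<Rightarrow> (('a \<times> 'a ftree) \<Rightarrow>\<^sub>0 int) set) \<Rightarrow> nat \<Rightarrow> 'a ftree \<Rightarrow> 'a ftree" where
  "gen_trans R p M \<beta> = frob_pow_map R p M (frob_ft R p M) (frob_code R p M \<circ> \<beta>)"

definition gen_lim ::
    "('a, 'k) ring_scheme \<Rightarrow> nat \<Rightarrow> ('a, 'a ftree) module \<Rightarrow>
      ('a ftree \<Rightarrow> (('a \<times> 'a ftree) \<Rightarrow>\<^sub>0 int) set) \<Rightarrow> ('a, (nat \<times> 'a ftree) set) module" where
  "gen_lim R p M \<beta> = dirlim (frob_pow R p M) (gen_trans R p M \<beta>)"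

definition gen_lim_map ::
    "('a, 'k) ring_scheme \<Rightarrow> nat \<Rightarrow> ('a, 'a ftree) module \<Rightarrow> ('a, 'a ftree) module \<Rightarrow>
      ('a ftree \<Rightarrow> (('a \<times> 'a ftree) \<Rightarrow>\<^sub>0 int) set) \<Rightarrow> ('a ftree \<Rightarrow> 'a ftree) \<Rightarrow>
      (nat \<times> 'a ftree) set \<Rightarrow> (nat \<times> 'a ftree) set" where
  "gen_lim_map R p N M \<gamma> g =
     dirlim_map (frob_pow R p M) (gen_trans R p M \<gamma>) (frob_pow_map R p N M g)"

text \<open>The structure isomorphism \<open>\<M> = lim F\<^sup>e(M) \<rightarrow> F(\<M>)\<close>. Write \<open>\<iota>\<^sub>e : F\<^sup>e(M) \<rightarrow> \<M>\<close> for the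
  canonical maps. Under \<open>F(\<M>) = lim F(F\<^sup>e(M))\<close> the canonical map from \<open>F(F\<^sup>e(M))\<close> is
  \<open>F(\<iota>\<^sub>e)\<close>, so the class of \<open>x \<in> F(F\<^sup>e(M)) = F\<^sup>e\<^sup>+\<^sup>1(M)\<close> is sent to \<open>F(\<iota>\<^sub>e)(x)\<close>.\<close>

definition gen_lim_struct ::
    "('a, 'k) ring_scheme \<Rightarrow> nat \<Rightarrow> ('a, 'a ftree) module \<Rightarrow>
      ('a ftree \<Rightarrow> (('a \<times> 'a ftree) \<Rightarrow>\<^sub>0 int) set) \<Rightarrow>
      (nat \<times> 'a ftree) set \<Rightarrow> (('a \<times> (nat \<times> 'a ftree) set) \<Rightarrow>\<^sub>0 int) set" where
  "gen_lim_struct R p M \<beta> C = (THE z. \<exists>e x. x \<in> carrier (frob R p (frob_pow R p M e)) \<and>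
     (Suc e, frob_code R p (frob_pow R p M e) x) \<in> C \<and>
     z = frob_map R p (gen_lim R p M \<beta>)
           (dirlim_in (frob_pow R p M) (gen_trans R p M \<beta>) e) x)"

text \<open>\<open>\<beta>\<close> is a generating morphism of the F-module \<open>(\<M>, \<theta>)\<close>, which is identified with
  \<open>lim F\<^sup>e(M)\<close> by the isomorphism of F-modules \<open>u\<close>.\<close>

definition generating_morphism ::
    "('a, 'k) ring_scheme \<Rightarrow> nat \<Rightarrow> ('a, 'a ftree) module \<Rightarrow>
      ('a ftree \<Rightarrow> (('a \<times> 'a ftree) \<Rightarrow>\<^sub>0 int) set) \<Rightarrow>
      ('a, 'b) module \<Rightarrow> ('b \<Rightarrow> (('a \<times> 'b) \<Rightarrow>\<^sub>0 int) set) \<Rightarrow> ((nat \<times> 'a ftree) set \<Rightarrow> 'b) \<Rightarrow> bool" where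
  "generating_morphism R p M \<beta> \<M> \<theta> u \<longleftrightarrow>
     D_obj R p M \<beta> \<and> u \<in> F_iso R p (gen_lim R p M \<beta>) (gen_lim_struct R p M \<beta>) \<M> \<theta>"

definition F_finite ::
    "('a, 'k) ring_scheme \<Rightarrow> nat \<Rightarrow> ('a, 'b) module \<Rightarrow> ('b \<Rightarrow> (('a \<times> 'b) \<Rightarrow>\<^sub>0 int) set) \<Rightarrow> bool" where
  "F_finite R p \<M> \<theta> \<longleftrightarrow> F_module R p \<M> \<theta> \<and> (\<exists>M \<beta> u. generating_morphism R p M \<beta> \<M> \<theta> u)"

end

theory Submission
  imports Defs
begin

text \<open>
  Let \<open>\<N> = lim F\<^sup>e(N)\<close> and \<open>\<M> = lim F\<^sup>e(M\<^sub>0)\<close> with generating morphisms \<open>\<beta>\<close> and \<open>\<gamma>\<^sub>0\<close>. The pair \<open>(N, \<beta>)\<close>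
  is kept, and \<open>(M\<^sub>0, \<gamma>\<^sub>0)\<close> is replaced by \<open>(F\<^sup>e(M\<^sub>0), F\<^sup>e(\<gamma>\<^sub>0))\<close> for a sufficiently large \<open>e\<close>. The latter
  generates the same F-module, because its sequence of iterates is a tail of the original one
  (\<open>frob_cone_shift\<close>).

  To find \<open>e\<close>, restrict \<open>\<phi>\<close> to the image of \<open>N\<close>. As \<open>R\<close> is noetherian, \<open>N\<close> is finitely presented,
  so the resulting map from \<open>N\<close> to the direct limit \<open>\<M>\<close> factors through some \<open>h : N \<rightarrow> F\<^sup>d(M\<^sub>0)\<close>
  (\<open>limit_cone.fin_gen_hom_lift\<close>). The maps \<open>F\<^sup>d(\<gamma>\<^sub>0) \<circ> h\<close> and \<open>F(h) \<circ> \<beta>\<close> from \<open>N\<close> to \<open>F\<^sup>d\<^sup>+\<^sup>1(M\<^sub>0)\<close> need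
  not be equal, but they become equal in \<open>\<M>\<close> since \<open>\<phi>\<close> commutes with the structure maps. The module
  \<open>N\<close> being finitely generated, they become equal in \<open>F\<^sup>e\<^sup>+\<^sup>1(M\<^sub>0)\<close> for some \<open>e \<ge> d\<close>
  (\<open>limit_cone.fin_gen_eventually_eq\<close>), and the composite \<open>g : N \<rightarrow> F\<^sup>d(M\<^sub>0) \<rightarrow> F\<^sup>e(M\<^sub>0)\<close> is a morphism
  from \<open>\<beta>\<close> to \<open>F\<^sup>e(\<gamma>\<^sub>0)\<close> (\<open>F_hom_descends\<close>). By construction \<open>g\<close> induces \<open>\<phi>\<close> on the image of \<open>N\<close>, and the
  compatibility of \<open>\<phi>\<close> with the structure isomorphisms forces \<open>F\<^sup>i(g)\<close> to induce \<open>\<phi>\<close> on the image of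
  \<open>F\<^sup>i(N)\<close> for every \<open>i\<close> (\<open>F_hom_on_cones\<close>).

  The remaining work makes this meaningful for concrete quotients: functoriality of the tensor
  product \<open>F\<close>, and a description of direct limits by their canonical maps that does not mention
  equivalence classes.
\<close>

section \<open>Linear maps and finite generation\<close>

lemma mod_homI:
  assumes "\<And>x. x \<in> carrier M \<Longrightarrow> h x \<in> carrier N"
    and "\<And>x y. x \<in> carrier M \<Longrightarrow> y \<in> carrier M \<Longrightarrow> h (x \<oplus>\<^bsub>M\<^esub> y) = h x \<oplus>\<^bsub>N\<^esub> h y"
    and "\<And>r x. r \<in> carrier R \<Longrightarrow> x \<in> carrier M \<Longrightarrow> h (r \<odot>\<^bsub>M\<^esub> x) = r \<odot>\<^bsub>N\<^esub> h x"
  shows "h \<in> mod_hom R M N"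
  using assms by (auto simp: mod_hom_def)

lemma mod_homD:
  assumes "h \<in> mod_hom R M N"
  shows "x \<in> carrier M \<Longrightarrow> h x \<in> carrier N"
    and "x \<in> carrier M \<Longrightarrow> y \<in> carrier M \<Longrightarrow> h (x \<oplus>\<^bsub>M\<^esub> y) = h x \<oplus>\<^bsub>N\<^esub> h y"
    and "r \<in> carrier R \<Longrightarrow> x \<in> carrier M \<Longrightarrow> h (r \<odot>\<^bsub>M\<^esub> x) = r \<odot>\<^bsub>N\<^esub> h x"
  using assms by (auto simp: mod_hom_def)

lemma mod_hom_zero:
  assumes "module R M" "module R N" "h \<in> mod_hom R M N"
  shows "h \<zero>\<^bsub>M\<^esub> = \<zero>\<^bsub>N\<^esub>"
proof -
  interpret M: module R M by fact
  interpret N: module R N by fact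
  have "h (\<zero>\<^bsub>R\<^esub> \<odot>\<^bsub>M\<^esub> \<zero>\<^bsub>M\<^esub>) = \<zero>\<^bsub>R\<^esub> \<odot>\<^bsub>N\<^esub> h \<zero>\<^bsub>M\<^esub>"
    by (rule mod_homD(3)[OF assms(3)]) simp_all
  then show ?thesis using mod_homD(1)[OF assms(3)] by simp
qed

lemma mod_hom_comp:
  "h \<in> mod_hom R M N \<Longrightarrow> k \<in> mod_hom R N P \<Longrightarrow> (\<lambda>x. k (h x)) \<in> mod_hom R M P"
  by (rule mod_homI) (auto simp: mod_homD)

lemma mod_hom_minus:
  assumes "module R M" "module R N" "h \<in> mod_hom R M N" "x \<in> carrier M"
  shows "h (\<ominus>\<^bsub>M\<^esub> x) = \<ominus>\<^bsub>N\<^esub> h x"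
proof -
  interpret M: module R M by fact
  interpret N: module R N by fact
  have "h (\<ominus>\<^bsub>M\<^esub> x) \<oplus>\<^bsub>N\<^esub> h x = h (\<ominus>\<^bsub>M\<^esub> x \<oplus>\<^bsub>M\<^esub> x)"
    using assms by (simp add: mod_homD)
  also have "\<dots> = \<zero>\<^bsub>N\<^esub>"
    using assms by (simp add: M.l_neg mod_hom_zero)
  finally show ?thesis
    using assms by (simp add: N.minus_equality mod_homD)
qed

lemma mod_hom_diff_eq_zero:
  assumes "module R M" "module R N" "h \<in> mod_hom R M N"
    and "x \<in> carrier M" "y \<in> carrier M"
  shows "h (x \<ominus>\<^bsub>M\<^esub> y) = \<zero>\<^bsub>N\<^esub> \<longleftrightarrow> h x = h y"
proof -
  interpret M: module R M by fact
  interpret N: module R N by fact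
  have closed: "h x \<in> carrier N" "h y \<in> carrier N"
    using assms by (simp_all add: mod_homD)
  have "h (x \<ominus>\<^bsub>M\<^esub> y) = h x \<oplus>\<^bsub>N\<^esub> \<ominus>\<^bsub>N\<^esub> h y"
    using assms by (simp add: a_minus_def mod_homD mod_hom_minus)
  moreover have "h x \<oplus>\<^bsub>N\<^esub> \<ominus>\<^bsub>N\<^esub> h y = \<zero>\<^bsub>N\<^esub> \<longleftrightarrow> h x = h y"
  proof
    assume "h x \<oplus>\<^bsub>N\<^esub> \<ominus>\<^bsub>N\<^esub> h y = \<zero>\<^bsub>N\<^esub>"
    then have "\<ominus>\<^bsub>N\<^esub> (\<ominus>\<^bsub>N\<^esub> h y) = h x"
      by (rule N.minus_equality) (use closed in simp_all)
    then show "h x = h y" using closed by simp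
  qed (use closed in \<open>simp add: N.r_neg\<close>)
  ultimately show ?thesis by simp
qed

lemma submodule_closedI:
  assumes "module R M" "H \<subseteq> carrier M" "\<zero>\<^bsub>M\<^esub> \<in> H"
    and "\<And>x y. x \<in> H \<Longrightarrow> y \<in> H \<Longrightarrow> x \<oplus>\<^bsub>M\<^esub> y \<in> H"
    and smult: "\<And>r x. r \<in> carrier R \<Longrightarrow> x \<in> H \<Longrightarrow> r \<odot>\<^bsub>M\<^esub> x \<in> H"
  shows "submodule H R M"
proof -
  interpret module R M by fact
  have "\<ominus>\<^bsub>M\<^esub> x \<in> H" if "x \<in> H" for x
    using smult[of "\<ominus>\<^bsub>R\<^esub> \<one>\<^bsub>R\<^esub>" x] that assms(2) by (auto simp: smult_l_minus)
  then show ?thesis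
    using assms by (intro submoduleI) auto
qed

text \<open>Linear combinations are needed only to pass between the definition of finite generation and
  the following form, in which a property is checked on generators once the elements having it
  are seen to form a submodule.\<close>

lemma fin_gen_module_obtain:
  assumes "fin_gen_module R M"
  obtains S where "S \<subseteq> carrier M" "finite S"
    "\<And>H. submodule H R M \<Longrightarrow> S \<subseteq> H \<Longrightarrow> carrier M \<subseteq> H"
proof -
  interpret module R M
    using assms by (simp add: fin_gen_module_def)
  obtain S where S: "S \<subseteq> carrier M" "finite S"
    and gen: "\<forall>x \<in> carrier M. \<exists>c \<in> S \<rightarrow> carrier R. x = (\<Oplus>\<^bsub>M\<^esub>s\<in>S. c s \<odot>\<^bsub>M\<^esub> s)"
    using assms by (auto simp: fin_gen_module_def)
  have "carrier M \<subseteq> H" if H: "submodule H R M" "S \<subseteq> H" for H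
  proof
    fix x assume "x \<in> carrier M"
    then obtain c where c: "c \<in> S \<rightarrow> carrier R" "x = (\<Oplus>\<^bsub>M\<^esub>s\<in>S. c s \<odot>\<^bsub>M\<^esub> s)"
      using gen by blast
    have "(\<Oplus>\<^bsub>M\<^esub>s\<in>T. c s \<odot>\<^bsub>M\<^esub> s) \<in> H" if "finite T" "T \<subseteq> S" for T
      using that
    proof (induction T)
      case empty
      then show ?case using subgroup.one_closed[OF submodule.axioms(1)[OF H(1)]] by simp
    next
      case (insert s T)
      then have s: "s \<in> carrier M" "c s \<in> carrier R" "s \<in> H"
        using S c H(2) by auto
      have "(\<lambda>s. c s \<odot>\<^bsub>M\<^esub> s) \<in> T \<rightarrow> carrier M"
        using insert S c by auto
      then show ?case
        using insert s submoduleE(4,5)[OF H(1)] by simp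
    qed
    then show "x \<in> H" using S c by auto
  qed
  with S that show ?thesis by blast
qed

lemma fin_gen_moduleI:
  assumes "module R M" and S: "S \<subseteq> carrier M" "finite S"
    and gen: "\<And>H. submodule H R M \<Longrightarrow> S \<subseteq> H \<Longrightarrow> carrier M \<subseteq> H"
  shows "fin_gen_module R M"
proof -
  interpret module R M by fact
  define H where "H = {(\<Oplus>\<^bsub>M\<^esub>s\<in>S. c s \<odot>\<^bsub>M\<^esub> s) | c. c \<in> S \<rightarrow> carrier R}"
  have fn: "(\<lambda>s. c s \<odot>\<^bsub>M\<^esub> s) \<in> S \<rightarrow> carrier M" if "c \<in> S \<rightarrow> carrier R" for c
    using that S by auto
  have "S \<subseteq> H"
  proof
      fix t assume t: "t \<in> S"
      let ?c = "\<lambda>s. if t = s then \<one>\<^bsub>R\<^esub> else \<zero>\<^bsub>R\<^esub>"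
      have "(\<Oplus>\<^bsub>M\<^esub>s\<in>S. ?c s \<odot>\<^bsub>M\<^esub> s) = (\<Oplus>\<^bsub>M\<^esub>s\<in>S. if t = s then s else \<zero>\<^bsub>M\<^esub>)"
        using S by (intro M.finsum_cong') auto
      also have "\<dots> = t"
        using S t by (intro M.finsum_singleton) auto
      finally show "t \<in> H"
        unfolding H_def by (intro CollectI exI[of _ ?c]) auto
  qed
  moreover have "submodule H R M"
  proof (rule submodule_closedI[OF assms(1)])
    show "H \<subseteq> carrier M"
      unfolding H_def using fn by auto
    show "\<zero>\<^bsub>M\<^esub> \<in> H"
    proof -
      have "(\<Oplus>\<^bsub>M\<^esub>s\<in>S. \<zero>\<^bsub>R\<^esub> \<odot>\<^bsub>M\<^esub> s) = (\<Oplus>\<^bsub>M\<^esub>s\<in>S. \<zero>\<^bsub>M\<^esub>)"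
        using S by (intro M.finsum_cong') auto
      then show ?thesis
        unfolding H_def by (intro CollectI exI[of _ "\<lambda>_. \<zero>\<^bsub>R\<^esub>"]) auto
    qed
    fix x assume "x \<in> H"
    then obtain c where c: "c \<in> S \<rightarrow> carrier R" "x = (\<Oplus>\<^bsub>M\<^esub>s\<in>S. c s \<odot>\<^bsub>M\<^esub> s)"
      unfolding H_def by blast
    {
      fix y assume "y \<in> H"
      then obtain d where d: "d \<in> S \<rightarrow> carrier R" "y = (\<Oplus>\<^bsub>M\<^esub>s\<in>S. d s \<odot>\<^bsub>M\<^esub> s)"
        unfolding H_def by blast
      have "(\<Oplus>\<^bsub>M\<^esub>s\<in>S. (c s \<oplus>\<^bsub>R\<^esub> d s) \<odot>\<^bsub>M\<^esub> s) = (\<Oplus>\<^bsub>M\<^esub>s\<in>S. c s \<odot>\<^bsub>M\<^esub> s \<oplus>\<^bsub>M\<^esub> d s \<odot>\<^bsub>M\<^esub> s)"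
      proof (rule M.finsum_cong')
        show "(\<lambda>s. c s \<odot>\<^bsub>M\<^esub> s \<oplus>\<^bsub>M\<^esub> d s \<odot>\<^bsub>M\<^esub> s) \<in> S \<rightarrow> carrier M"
          using fn[OF c(1)] fn[OF d(1)] by (auto simp: Pi_iff)
        show "(c s \<oplus>\<^bsub>R\<^esub> d s) \<odot>\<^bsub>M\<^esub> s = c s \<odot>\<^bsub>M\<^esub> s \<oplus>\<^bsub>M\<^esub> d s \<odot>\<^bsub>M\<^esub> s" if "s \<in> S" for s
          using that S c d by (auto intro!: smult_l_distr)
      qed simp
      also have "\<dots> = x \<oplus>\<^bsub>M\<^esub> y"
        using c d fn by (simp add: M.finsum_addf)
      finally show "x \<oplus>\<^bsub>M\<^esub> y \<in> H"
        unfolding H_def using c d by (intro CollectI exI[of _ "\<lambda>s. c s \<oplus>\<^bsub>R\<^esub> d s"]) auto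
    }
    fix r assume r: "r \<in> carrier R"
    have "(\<Oplus>\<^bsub>M\<^esub>s\<in>S. (r \<otimes>\<^bsub>R\<^esub> c s) \<odot>\<^bsub>M\<^esub> s) = (\<Oplus>\<^bsub>M\<^esub>s\<in>S. r \<odot>\<^bsub>M\<^esub> (c s \<odot>\<^bsub>M\<^esub> s))"
      using S c r by (intro M.finsum_cong') (auto simp: Pi_iff subset_iff smult_assoc1)
    also have "\<dots> = r \<odot>\<^bsub>M\<^esub> x"
      using c r fn S by (simp add: finsum_smult_ldistr)
    finally show "r \<odot>\<^bsub>M\<^esub> x \<in> H"
      unfolding H_def using c r by (intro CollectI exI[of _ "\<lambda>s. r \<otimes>\<^bsub>R\<^esub> c s"]) auto
  qed
  ultimately have "carrier M \<subseteq> H" using gen by blast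
  then show ?thesis
    unfolding fin_gen_module_def H_def using assms by blast
qed

lemma fin_gen_module_image:
  assumes M: "fin_gen_module R M" and N: "module R N"
    and h: "h \<in> mod_hom R M N" "carrier N \<subseteq> h ` carrier M"
  shows "fin_gen_module R N"
proof -
  have M': "module R M" using M by (simp add: fin_gen_module_def)
  interpret M: module R M by fact
  interpret N: module R N by fact
  obtain S where S: "S \<subseteq> carrier M" "finite S"
    "\<And>H. submodule H R M \<Longrightarrow> S \<subseteq> H \<Longrightarrow> carrier M \<subseteq> H"
    using fin_gen_module_obtain[OF M] by metis
  show ?thesis
  proof (rule fin_gen_moduleI[OF N])
    show "h ` S \<subseteq> carrier N" "finite (h ` S)" using S mod_homD(1)[OF h(1)] by auto
    fix H assume H: "submodule H R N" "h ` S \<subseteq> H"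
    have "carrier M \<subseteq> {x \<in> carrier M. h x \<in> H}"
      by (intro S(3) submodule_closedI[OF M'])
        (use S H N.submoduleE(4,5)[OF H(1)] subgroup.one_closed[OF submodule.axioms(1)[OF H(1)]]
          in \<open>auto simp: mod_homD[OF h(1)] mod_hom_zero[OF M' N h(1)]\<close>)
    then show "carrier N \<subseteq> H" using h(2) by auto
  qed
qed

section \<open>The Frobenius functor on elements\<close>

text \<open>Closure of the two carriers under addition and scalars keeps the defining relations of the
  tensor product inside the free abelian group; their span is then a subgroup and its cosets make
  sense.\<close>

lemma subgroup_tensor_null:
  assumes "\<And>x y. x \<in> carrier A \<Longrightarrow> y \<in> carrier A \<Longrightarrow> x \<oplus>\<^bsub>A\<^esub> y \<in> carrier A"
    and "\<And>r x. r \<in> carrier R \<Longrightarrow> x \<in> carrier A \<Longrightarrow> r \<odot>\<^bsub>A\<^esub> x \<in> carrier A"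
    and "\<And>x y. x \<in> carrier B \<Longrightarrow> y \<in> carrier B \<Longrightarrow> x \<oplus>\<^bsub>B\<^esub> y \<in> carrier B"
    and "\<And>r x. r \<in> carrier R \<Longrightarrow> x \<in> carrier B \<Longrightarrow> r \<odot>\<^bsub>B\<^esub> x \<in> carrier B"
  shows "subgroup (tensor_null R A B) (tensor_free A B)"
  unfolding tensor_null_def
proof (rule group.generate_is_subgroup)
  show "group (tensor_free A B)" by simp
qed (use assms in \<open>auto dest!: subsetD[OF keys_diff]\<close>)

lemma frob_push_simps [simp]:
  "carrier (frob_push R p) = carrier R"
  "x \<oplus>\<^bsub>frob_push R p\<^esub> y = x \<oplus>\<^bsub>R\<^esub> y"
  "r \<odot>\<^bsub>frob_push R p\<^esub> x = (r [^]\<^bsub>R\<^esub> p) \<otimes>\<^bsub>R\<^esub> x"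
  by (simp_all add: frob_push_def)

text \<open>The class in \<open>F(M)\<close> of an element of the free abelian group on \<open>R \<times> M\<close>. Writing the
  coset as a translate turns every identity in \<open>F(M)\<close> into the membership of a difference of
  representatives in the relation subgroup.\<close>

definition frob_cls ::
    "('a, 'k) ring_scheme \<Rightarrow> nat \<Rightarrow> ('a, 'b) module \<Rightarrow> (('a \<times> 'b) \<Rightarrow>\<^sub>0 int) \<Rightarrow> (('a \<times> 'b) \<Rightarrow>\<^sub>0 int) set" where
  "frob_cls R p M c = {k + c | k. k \<in> tensor_null R (frob_push R p) M}"

definition frob_tensor ::
    "('a, 'k) ring_scheme \<Rightarrow> nat \<Rightarrow> ('a, 'b) module \<Rightarrow> 'a \<Rightarrow> 'b \<Rightarrow> (('a \<times> 'b) \<Rightarrow>\<^sub>0 int) set" where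
  "frob_tensor R p M r m = frob_cls R p M (frag_of (r, m))"

locale frob_module = module R M for R :: "('a, 'k) ring_scheme" (structure) and M :: "('a, 'b) module" (structure) +
  fixes p :: nat
begin

abbreviation "K \<equiv> tensor_null R (frob_push R p) M"
abbreviation "FM \<equiv> frob R p M"
abbreviation "supp \<equiv> {c. Poly_Mapping.keys c \<subseteq> carrier R \<times> carrier M}"

lemma subgroup_K: "subgroup K (tensor_free (frob_push R p) M)"
  by (rule subgroup_tensor_null) auto

lemma K_supp: "k \<in> K \<Longrightarrow> k \<in> supp"
  using subgroup.mem_carrier[OF subgroup_K, of k] by simp

lemma K_zero: "0 \<in> K"
  using subgroup.one_closed[OF subgroup_K] by simp

lemma K_add: "k \<in> K \<Longrightarrow> l \<in> K \<Longrightarrow> k + l \<in> K"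
  using subgroup.m_closed[OF subgroup_K, of k l] by simp

lemma K_uminus: "k \<in> K \<Longrightarrow> - k \<in> K"
  using subgroup.m_inv_closed[OF subgroup_K, of k] K_supp[of k] by simp

lemma K_diff: "k \<in> K \<Longrightarrow> l \<in> K \<Longrightarrow> k - l \<in> K"
  using K_add[of k "- l"] K_uminus by simp

lemma supp_closed: "c \<in> supp \<Longrightarrow> d \<in> supp \<Longrightarrow> c + d \<in> supp"
  "c \<in> supp \<Longrightarrow> - c \<in> supp" "0 \<in> supp"
  "r \<in> carrier R \<Longrightarrow> m \<in> carrier M \<Longrightarrow> frag_of (r, m) \<in> supp"
  using keys_add[of c d] by auto

lemma frob_cls_coset: "frob_cls R p M c = K #>\<^bsub>tensor_free (frob_push R p) M\<^esub> c"
  by (auto simp: frob_cls_def r_coset_def)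

lemma frob_cls_eq_iff: "frob_cls R p M c = frob_cls R p M d \<longleftrightarrow> c - d \<in> K"
proof
  assume "frob_cls R p M c = frob_cls R p M d"
  moreover have "c \<in> frob_cls R p M c"
    unfolding frob_cls_def using K_zero by (intro CollectI exI[of _ 0]) simp
  ultimately have "c \<in> frob_cls R p M d" by simp
  then show "c - d \<in> K" by (auto simp: frob_cls_def)
next
  assume cd: "c - d \<in> K"
  have "k + c = (k + (c - d)) + d" "k + d = (k - (c - d)) + c" for k
    by simp_all
  then show "frob_cls R p M c = frob_cls R p M d"
    unfolding frob_cls_def using cd K_add K_diff by blast
qed

lemma carrier_frob: "carrier FM = frob_cls R p M ` supp"
proof -
  have "carrier (tensor_free (frob_push R p) M) = supp" by auto
  then show ?thesis
    by (simp add: frob_def Let_def tensor_group_def FactGroup_def RCOSETS_def frob_cls_coset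
        UNION_singleton_eq_range)
qed

lemma frob_cls_closed [simp]: "c \<in> supp \<Longrightarrow> frob_cls R p M c \<in> carrier FM"
  by (simp add: carrier_frob)

lemma frob_zero: "\<zero>\<^bsub>FM\<^esub> = frob_cls R p M 0"
  by (simp add: frob_def tensor_group_def FactGroup_def frob_cls_def)

lemma frob_add: "frob_cls R p M c \<oplus>\<^bsub>FM\<^esub> frob_cls R p M d = frob_cls R p M (c + d)"
proof -
  have "frob_cls R p M c \<oplus>\<^bsub>FM\<^esub> frob_cls R p M d = {(k + c) + (l + d) | k l. k \<in> K \<and> l \<in> K}"
    by (auto simp: frob_def tensor_group_def FactGroup_def set_mult_def frob_cls_def)
  also have "\<dots> = frob_cls R p M (c + d)"
  proof
    show "{(k + c) + (l + d) | k l. k \<in> K \<and> l \<in> K} \<subseteq> frob_cls R p M (c + d)"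
    proof safe
      fix k l assume "k \<in> K" "l \<in> K"
      then show "(k + c) + (l + d) \<in> frob_cls R p M (c + d)"
        unfolding frob_cls_def using K_add[of k l]
        by (intro CollectI exI[of _ "k + l"]) (simp add: ac_simps)
    qed
    show "frob_cls R p M (c + d) \<subseteq> {(k + c) + (l + d) | k l. k \<in> K \<and> l \<in> K}"
    proof
      fix z assume "z \<in> frob_cls R p M (c + d)"
      then obtain k where "k \<in> K" "z = (k + c) + (0 + d)"
        by (auto simp: frob_cls_def ac_simps)
      then show "z \<in> {(k + c) + (l + d) | k l. k \<in> K \<and> l \<in> K}"
        using K_zero by blast
    qed
  qed
  finally show ?thesis .
qed

lemma abelian_group_frob: "abelian_group FM"
proof (rule abelian_groupI)
  show "\<exists>y\<in>carrier FM. y \<oplus>\<^bsub>FM\<^esub> x = \<zero>\<^bsub>FM\<^esub>" if x: "x \<in> carrier FM" for x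
  proof -
    obtain c where "c \<in> supp" "x = frob_cls R p M c"
      using x by (auto simp: carrier_frob)
    then show ?thesis
      by (intro bexI[of _ "frob_cls R p M (- c)"]) (simp_all add: frob_add frob_zero)
  qed
next
  fix x y assume "x \<in> carrier FM" "y \<in> carrier FM"
  then obtain c d where "c \<in> supp" "d \<in> supp" "x = frob_cls R p M c" "y = frob_cls R p M d"
    by (auto simp: carrier_frob)
  then show "x \<oplus>\<^bsub>FM\<^esub> y \<in> carrier FM"
    using frob_cls_closed[OF supp_closed(1)] by (simp only: frob_add)
qed (auto simp: carrier_frob frob_add frob_zero ac_simps intro!: image_eqI[of _ _ 0])

lemma frob_tensor_closed [simp]:
  "r \<in> carrier R \<Longrightarrow> m \<in> carrier M \<Longrightarrow> frob_tensor R p M r m \<in> carrier FM"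
  unfolding frob_tensor_def by (rule frob_cls_closed) (simp add: supp_closed)

lemma frob_tensor_add_left:
  assumes "r \<in> carrier R" "s \<in> carrier R" "m \<in> carrier M"
  shows "frob_tensor R p M (r \<oplus>\<^bsub>R\<^esub> s) m = frob_tensor R p M r m \<oplus>\<^bsub>FM\<^esub> frob_tensor R p M s m"
proof -
  have "frag_of (r \<oplus>\<^bsub>R\<^esub> s, m) - frag_of (r, m) - frag_of (s, m) \<in> K"
    unfolding tensor_null_def using assms
    by (intro generate.incl UnI1 CollectI exI[of _ r] exI[of _ s] exI[of _ m]) simp
  then show ?thesis
    by (simp add: frob_tensor_def frob_add frob_cls_eq_iff diff_diff_eq)
qed

lemma frob_tensor_add_right:
  assumes "r \<in> carrier R" "m \<in> carrier M" "n \<in> carrier M"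
  shows "frob_tensor R p M r (m \<oplus>\<^bsub>M\<^esub> n) = frob_tensor R p M r m \<oplus>\<^bsub>FM\<^esub> frob_tensor R p M r n"
proof -
  have "frag_of (r, m \<oplus>\<^bsub>M\<^esub> n) - frag_of (r, m) - frag_of (r, n) \<in> K"
    unfolding tensor_null_def using assms
    by (intro generate.incl UnI1[OF UnI2] CollectI exI[of _ r] exI[of _ n] exI[of _ m]) simp
  then show ?thesis
    by (simp add: frob_tensor_def frob_add frob_cls_eq_iff diff_diff_eq)
qed

lemma frob_tensor_smult_right:
  assumes "r \<in> carrier R" "s \<in> carrier R" "m \<in> carrier M"
  shows "frob_tensor R p M r (s \<odot>\<^bsub>M\<^esub> m) = frob_tensor R p M ((s [^]\<^bsub>R\<^esub> p) \<otimes>\<^bsub>R\<^esub> r) m"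
proof -
  have "frag_of ((s [^]\<^bsub>R\<^esub> p) \<otimes>\<^bsub>R\<^esub> r, m) - frag_of (r, s \<odot>\<^bsub>M\<^esub> m) \<in> K"
    unfolding tensor_null_def using assms
    by (intro generate.incl UnI2 CollectI exI[of _ r] exI[of _ s] exI[of _ m]) simp
  then show ?thesis
    by (simp add: frob_tensor_def frob_cls_eq_iff[symmetric])
qed

lemma frob_tensor_zero_left: "m \<in> carrier M \<Longrightarrow> frob_tensor R p M \<zero>\<^bsub>R\<^esub> m = \<zero>\<^bsub>FM\<^esub>"
proof -
  interpret F: abelian_group FM by (rule abelian_group_frob)
  assume m: "m \<in> carrier M"
  have "frob_tensor R p M \<zero>\<^bsub>R\<^esub> m \<oplus>\<^bsub>FM\<^esub> frob_tensor R p M \<zero>\<^bsub>R\<^esub> m = frob_tensor R p M \<zero>\<^bsub>R\<^esub> m"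
    using frob_tensor_add_left[of "\<zero>\<^bsub>R\<^esub>" "\<zero>\<^bsub>R\<^esub>" m] m by simp
  then show ?thesis
    using m by simp
qed

lemma frob_tensor_zero_right: "r \<in> carrier R \<Longrightarrow> frob_tensor R p M r \<zero>\<^bsub>M\<^esub> = \<zero>\<^bsub>FM\<^esub>"
proof -
  interpret F: abelian_group FM by (rule abelian_group_frob)
  assume m: "r \<in> carrier R"
  have "frob_tensor R p M r \<zero>\<^bsub>M\<^esub> \<oplus>\<^bsub>FM\<^esub> frob_tensor R p M r \<zero>\<^bsub>M\<^esub> = frob_tensor R p M r \<zero>\<^bsub>M\<^esub>"
    using frob_tensor_add_right[of r "\<zero>\<^bsub>M\<^esub>" "\<zero>\<^bsub>M\<^esub>"] m by simp
  then show ?thesis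
    using m by simp
qed

text \<open>Linear maps out of \<open>F(M)\<close> are compared on pure tensors by this rule.\<close>

lemma frob_induct [consumes 1, case_names zero tensor add]:
  assumes x: "x \<in> carrier FM" and zero: "P \<zero>\<^bsub>FM\<^esub>"
    and tensor: "\<And>r m. r \<in> carrier R \<Longrightarrow> m \<in> carrier M \<Longrightarrow> P (frob_tensor R p M r m)"
    and add: "\<And>x y. x \<in> carrier FM \<Longrightarrow> y \<in> carrier FM \<Longrightarrow> P x \<Longrightarrow> P y \<Longrightarrow> P (x \<oplus>\<^bsub>FM\<^esub> y)"
  shows "P x"
proof -
  interpret F: abelian_group FM by (rule abelian_group_frob)
  obtain c where c: "c \<in> supp" "x = frob_cls R p M c"
    using x by (auto simp: carrier_frob)
  define Q where "Q c \<longleftrightarrow> frob_cls R p M c \<in> carrier FM \<and> frob_cls R p M (- c) \<in> carrier FM \<and>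
    P (frob_cls R p M c) \<and> P (frob_cls R p M (- c))" for c
  have "Poly_Mapping.keys c \<subseteq> carrier R \<times> carrier M" using c by simp
  then have "Q c"
  proof (induction rule: frag_induction)
    case zero
    then show ?case using assms(2) by (simp add: Q_def frob_zero[symmetric])
  next
    case (one z)
    then obtain r m where z: "z = (r, m)" "r \<in> carrier R" "m \<in> carrier M" by auto
    \<comment> \<open>The inverse of a pure tensor is again a pure tensor, so sums of pure tensors suffice.\<close>
    have "frob_tensor R p M (\<ominus>\<^bsub>R\<^esub> r) m \<oplus>\<^bsub>FM\<^esub> frob_tensor R p M r m = \<zero>\<^bsub>FM\<^esub>"
      using z frob_tensor_add_left[of "\<ominus>\<^bsub>R\<^esub> r" r m] frob_tensor_zero_left by (simp add: R.l_neg)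
    then have "frob_tensor R p M (\<ominus>\<^bsub>R\<^esub> r) m = frob_cls R p M (- frag_of (r, m))"
      unfolding frob_tensor_def by (simp add: frob_add frob_zero frob_cls_eq_iff)
    then show ?case
      using tensor[of r m] tensor[of "\<ominus>\<^bsub>R\<^esub> r" m] frob_tensor_closed[of r m]
        frob_tensor_closed[of "\<ominus>\<^bsub>R\<^esub> r" m] z
      by (simp add: Q_def frob_tensor_def)
  next
    case (diff a b)
    have "frob_cls R p M (a - b) = frob_cls R p M a \<oplus>\<^bsub>FM\<^esub> frob_cls R p M (- b)"
      "frob_cls R p M (- (a - b)) = frob_cls R p M (- a) \<oplus>\<^bsub>FM\<^esub> frob_cls R p M b"
      by (simp_all add: frob_add)
    with diff show ?case
      by (auto simp: Q_def intro: add)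
  qed
  then show ?thesis by (simp add: Q_def c)
qed

end

lemma frag_extend_supp:
  assumes "\<And>x. x \<in> A \<Longrightarrow> f x \<in> A'" "\<And>y. y \<in> B \<Longrightarrow> h y \<in> B'"
    and "Poly_Mapping.keys c \<subseteq> A \<times> B"
  shows "Poly_Mapping.keys (frag_extend (\<lambda>(x, y). frag_of (f x, h y)) c) \<subseteq> A' \<times> B'"
  using assms by (auto dest!: subsetD[OF keys_frag_extend])

text \<open>The map that \<open>f\<close> and \<open>h\<close> induce on free abelian groups sends each of the three kinds of
  relations to a relation of the same kind, hence preserves the relation subgroups. Therefore the
  image of a coset lies in a single coset, and \<^const>\<open>tensor_map\<close> may be computed on any
  representative. Both the scalar action on \<open>F(M)\<close> and the maps \<open>F(h)\<close> are of this form.\<close>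

lemma tensor_map_cls:
  assumes "frob_module R M" "frob_module R N"
    and f: "f \<in> mod_hom R (frob_push R p) (frob_push R p)" and h: "h \<in> mod_hom R M N"
    and c: "Poly_Mapping.keys c \<subseteq> carrier R \<times> carrier M"
  shows "tensor_map R (frob_push R p) N f h (frob_cls R p M c) =
    frob_cls R p N (frag_extend (\<lambda>(x, y). frag_of (f x, h y)) c)"
proof -
  interpret M: frob_module R M p by fact
  interpret N: frob_module R N p by fact
  let ?e = "frag_extend (\<lambda>(x, y). frag_of (f x, h y))"
  have "M.K \<subseteq> {k \<in> M.supp. ?e k \<in> N.K}"
    unfolding tensor_null_def[of R "frob_push R p" M]
  proof (rule group.generate_subgroup_incl)
    show "group (tensor_free (frob_push R p) M)" by simp
    show "subgroup {k \<in> M.supp. ?e k \<in> N.K} (tensor_free (frob_push R p) M)"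
      using N.K_zero N.K_add N.K_uminus M.supp_closed
      by (intro group.subgroupI)
        (auto simp: frag_extend_add frag_extend_minus intro!: exI[of _ 0] dest!: subsetD[OF keys_add])
  next
    have [simp]: "f x \<in> carrier R" if "x \<in> carrier R" for x
      using mod_homD(1)[OF f] that by simp
    have [simp]: "h x \<in> carrier N" if "x \<in> carrier M" for x
      using mod_homD(1)[OF h] that by simp
    let ?G = "{frag_of (x \<oplus>\<^bsub>frob_push R p\<^esub> x', y) - frag_of (x, y) - frag_of (x', y) | x x' y.
         x \<in> carrier (frob_push R p) \<and> x' \<in> carrier (frob_push R p) \<and> y \<in> carrier M} \<union>
      {frag_of (x, y \<oplus>\<^bsub>M\<^esub> y') - frag_of (x, y) - frag_of (x, y') | x y y'.
         x \<in> carrier (frob_push R p) \<and> y \<in> carrier M \<and> y' \<in> carrier M} \<union>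
      {frag_of (r \<odot>\<^bsub>frob_push R p\<^esub> x, y) - frag_of (x, r \<odot>\<^bsub>M\<^esub> y) | r x y.
         r \<in> carrier R \<and> x \<in> carrier (frob_push R p) \<and> y \<in> carrier M}"
    show "?G \<subseteq> {k \<in> M.supp. ?e k \<in> N.K}"
    proof
      fix k assume k: "k \<in> ?G"
      then have "k \<in> M.K"
        unfolding tensor_null_def by (rule generate.incl)
      then have "k \<in> M.supp" by (rule M.K_supp)
      moreover have "?e k \<in> N.K"
        using k
      proof (elim UnE CollectE exE conjE, goal_cases)
        case (1 x x' y)
        then have "?e k = frag_of (f x \<oplus>\<^bsub>R\<^esub> f x', h y) - frag_of (f x, h y) - frag_of (f x', h y)"
          using mod_homD(2)[OF f] by (simp add: frag_extend_diff)
        then show ?case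
          using 1 N.frob_tensor_add_left[of "f x" "f x'" "h y"]
          by (simp add: frob_tensor_def N.frob_add N.frob_cls_eq_iff diff_diff_eq)
      next
        case (2 x y y')
        then have "?e k = frag_of (f x, h y \<oplus>\<^bsub>N\<^esub> h y') - frag_of (f x, h y) - frag_of (f x, h y')"
          using mod_homD(2)[OF h] by (simp add: frag_extend_diff)
        then show ?case
          using 2 N.frob_tensor_add_right[of "f x" "h y" "h y'"]
          by (simp add: frob_tensor_def N.frob_add N.frob_cls_eq_iff diff_diff_eq)
      next
        case (3 r x y)
        then have "?e k = frag_of ((r [^]\<^bsub>R\<^esub> p) \<otimes>\<^bsub>R\<^esub> f x, h y) - frag_of (f x, r \<odot>\<^bsub>N\<^esub> h y)"
          using mod_homD(3)[OF h, of r y] mod_homD(3)[OF f, of r x] by (simp add: frag_extend_diff)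
        then show ?case
          using 3 N.frob_tensor_smult_right[of "f x" r "h y"]
          by (simp add: frob_tensor_def N.frob_cls_eq_iff[symmetric])
      qed
      ultimately show "k \<in> {k \<in> M.supp. ?e k \<in> N.K}" by simp
    qed
  qed
  then have K: "?e k \<in> N.K" if "k \<in> M.K" for k using that by auto
  have "tensor_map R (frob_push R p) N f h (frob_cls R p M c) = {l + ?e (k + c) | k l. k \<in> M.K \<and> l \<in> N.K}"
    by (auto simp: tensor_map_def set_mult_def frob_cls_def)
  also have "\<dots> = frob_cls R p N (?e c)"
  proof (intro subset_antisym subsetI)
    fix z assume "z \<in> {l + ?e (k + c) | k l. k \<in> M.K \<and> l \<in> N.K}"
    then obtain k l where kl: "k \<in> M.K" "l \<in> N.K" "z = (l + ?e k) + ?e c"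
      by (auto simp: frag_extend_add ac_simps)
    then show "z \<in> frob_cls R p N (?e c)"
      unfolding frob_cls_def using N.K_add K by blast
  next
    fix z assume "z \<in> frob_cls R p N (?e c)"
    then obtain l where "l \<in> N.K" "z = l + ?e (0 + c)"
      by (auto simp: frob_cls_def)
    then show "z \<in> {l + ?e (k + c) | k l. k \<in> M.K \<and> l \<in> N.K}"
      using M.K_zero by blast
  qed
  finally show ?thesis .
qed

lemma tensor_map_additive:
  assumes "frob_module R M" "frob_module R N"
    and f: "f \<in> mod_hom R (frob_push R p) (frob_push R p)" and h: "h \<in> mod_hom R M N"
  defines "F \<equiv> tensor_map R (frob_push R p) N f h"
  shows "x \<in> carrier (frob R p M) \<Longrightarrow> F x \<in> carrier (frob R p N)"
    and "x \<in> carrier (frob R p M) \<Longrightarrow> y \<in> carrier (frob R p M) \<Longrightarrow>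
      F (x \<oplus>\<^bsub>frob R p M\<^esub> y) = F x \<oplus>\<^bsub>frob R p N\<^esub> F y"
    and "F \<zero>\<^bsub>frob R p M\<^esub> = \<zero>\<^bsub>frob R p N\<^esub>"
    and "r \<in> carrier R \<Longrightarrow> m \<in> carrier M \<Longrightarrow> F (frob_tensor R p M r m) = frob_tensor R p N (f r) (h m)"
proof -
  interpret M: frob_module R M p by fact
  interpret N: frob_module R N p by fact
  note cls = tensor_map_cls[OF assms(1-4), folded F_def]
  show "F x \<in> carrier (frob R p N)" if x: "x \<in> carrier (frob R p M)" for x
  proof -
    obtain c where c: "c \<in> M.supp" "x = frob_cls R p M c"
      using x by (auto simp: M.carrier_frob)
    then have "Poly_Mapping.keys (frag_extend (\<lambda>(x, y). frag_of (f x, h y)) c) \<subseteq> carrier R \<times> carrier N"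
      using mod_homD(1)[OF f] mod_homD(1)[OF h] by (intro frag_extend_supp) auto
    then show ?thesis
      using c by (simp add: cls)
  qed
  show "F (x \<oplus>\<^bsub>frob R p M\<^esub> y) = F x \<oplus>\<^bsub>frob R p N\<^esub> F y"
    if xy: "x \<in> carrier (frob R p M)" "y \<in> carrier (frob R p M)" for x y
  proof -
    obtain c d where cd: "c \<in> M.supp" "d \<in> M.supp" "x = frob_cls R p M c" "y = frob_cls R p M d"
      using xy by (auto simp: M.carrier_frob)
    then show ?thesis
      using M.supp_closed(1)[of c d] by (simp add: M.frob_add N.frob_add cls frag_extend_add)
  qed
  show "F \<zero>\<^bsub>frob R p M\<^esub> = \<zero>\<^bsub>frob R p N\<^esub>"
    by (simp add: M.frob_zero N.frob_zero cls)
  show "r \<in> carrier R \<Longrightarrow> m \<in> carrier M \<Longrightarrow> F (frob_tensor R p M r m) = frob_tensor R p N (f r) (h m)"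
    by (simp add: frob_tensor_def cls)
qed

lemma frob_moduleI: "module R M \<Longrightarrow> frob_module R M"
  by (simp add: frob_module_def)

context frob_module
begin

lemma frob_smult_props:
  assumes "r \<in> carrier R"
  shows "x \<in> carrier FM \<Longrightarrow> r \<odot>\<^bsub>FM\<^esub> x \<in> carrier FM"
    and "x \<in> carrier FM \<Longrightarrow> y \<in> carrier FM \<Longrightarrow> r \<odot>\<^bsub>FM\<^esub> (x \<oplus>\<^bsub>FM\<^esub> y) = r \<odot>\<^bsub>FM\<^esub> x \<oplus>\<^bsub>FM\<^esub> r \<odot>\<^bsub>FM\<^esub> y"
    and "r \<odot>\<^bsub>FM\<^esub> \<zero>\<^bsub>FM\<^esub> = \<zero>\<^bsub>FM\<^esub>"
    and "s \<in> carrier R \<Longrightarrow> m \<in> carrier M \<Longrightarrow> r \<odot>\<^bsub>FM\<^esub> frob_tensor R p M s m = frob_tensor R p M (r \<otimes>\<^bsub>R\<^esub> s) m"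
proof -
  have eq: "r \<odot>\<^bsub>FM\<^esub> x = tensor_map R (frob_push R p) M (\<lambda>s. r \<otimes>\<^bsub>R\<^esub> s) (\<lambda>m. m) x" for x
    by (simp add: frob_def Let_def)
  have f: "(\<lambda>s. r \<otimes>\<^bsub>R\<^esub> s) \<in> mod_hom R (frob_push R p) (frob_push R p)"
    using assms by (intro mod_homI) (auto simp: R.r_distr R.m_lcomm)
  have h: "(\<lambda>m. m) \<in> mod_hom R M M" by (rule mod_homI) auto
  note props = tensor_map_additive[OF frob_module_axioms frob_module_axioms f h, folded eq]
  show "x \<in> carrier FM \<Longrightarrow> r \<odot>\<^bsub>FM\<^esub> x \<in> carrier FM"
    and "x \<in> carrier FM \<Longrightarrow> y \<in> carrier FM \<Longrightarrow> r \<odot>\<^bsub>FM\<^esub> (x \<oplus>\<^bsub>FM\<^esub> y) = r \<odot>\<^bsub>FM\<^esub> x \<oplus>\<^bsub>FM\<^esub> r \<odot>\<^bsub>FM\<^esub> y"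
    and "r \<odot>\<^bsub>FM\<^esub> \<zero>\<^bsub>FM\<^esub> = \<zero>\<^bsub>FM\<^esub>"
    and "s \<in> carrier R \<Longrightarrow> m \<in> carrier M \<Longrightarrow> r \<odot>\<^bsub>FM\<^esub> frob_tensor R p M s m = frob_tensor R p M (r \<otimes>\<^bsub>R\<^esub> s) m"
    by (fact props)+
qed

lemma module_frob: "module R FM"
proof (rule moduleI[OF R.is_cring abelian_group_frob])
  interpret F: abelian_group FM by (rule abelian_group_frob)
  note [simp] = frob_smult_props
  fix a b x assume ab: "a \<in> carrier R" "b \<in> carrier R" and x: "x \<in> carrier FM"
  show "(a \<oplus>\<^bsub>R\<^esub> b) \<odot>\<^bsub>FM\<^esub> x = a \<odot>\<^bsub>FM\<^esub> x \<oplus>\<^bsub>FM\<^esub> b \<odot>\<^bsub>FM\<^esub> x"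
    using x by (induction rule: frob_induct)
      (use ab in \<open>simp_all add: R.l_distr frob_tensor_add_left F.a_ac\<close>)
  show "(a \<otimes>\<^bsub>R\<^esub> b) \<odot>\<^bsub>FM\<^esub> x = a \<odot>\<^bsub>FM\<^esub> (b \<odot>\<^bsub>FM\<^esub> x)"
    using x by (induction rule: frob_induct) (use ab in \<open>simp_all add: R.m_assoc\<close>)
next
  fix x assume "x \<in> carrier FM"
  then show "\<one>\<^bsub>R\<^esub> \<odot>\<^bsub>FM\<^esub> x = x"
    by (induction rule: frob_induct) (simp_all add: frob_smult_props)
qed (simp_all add: frob_smult_props)

end

lemma frob_map_additive:
  assumes "module R M" "module R N" "h \<in> mod_hom R M N"
  shows "x \<in> carrier (frob R p M) \<Longrightarrow> frob_map R p N h x \<in> carrier (frob R p N)"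
    and "x \<in> carrier (frob R p M) \<Longrightarrow> y \<in> carrier (frob R p M) \<Longrightarrow>
      frob_map R p N h (x \<oplus>\<^bsub>frob R p M\<^esub> y) = frob_map R p N h x \<oplus>\<^bsub>frob R p N\<^esub> frob_map R p N h y"
    and "frob_map R p N h \<zero>\<^bsub>frob R p M\<^esub> = \<zero>\<^bsub>frob R p N\<^esub>"
    and "r \<in> carrier R \<Longrightarrow> m \<in> carrier M \<Longrightarrow>
      frob_map R p N h (frob_tensor R p M r m) = frob_tensor R p N r (h m)"
proof -
  have "(\<lambda>s. s) \<in> mod_hom R (frob_push R p) (frob_push R p)" by (rule mod_homI) auto
  note props = tensor_map_additive[OF frob_moduleI frob_moduleI this, OF assms, folded frob_map_def]
  show "x \<in> carrier (frob R p M) \<Longrightarrow> frob_map R p N h x \<in> carrier (frob R p N)"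
    and "x \<in> carrier (frob R p M) \<Longrightarrow> y \<in> carrier (frob R p M) \<Longrightarrow>
      frob_map R p N h (x \<oplus>\<^bsub>frob R p M\<^esub> y) = frob_map R p N h x \<oplus>\<^bsub>frob R p N\<^esub> frob_map R p N h y"
    and "frob_map R p N h \<zero>\<^bsub>frob R p M\<^esub> = \<zero>\<^bsub>frob R p N\<^esub>"
    and "r \<in> carrier R \<Longrightarrow> m \<in> carrier M \<Longrightarrow>
      frob_map R p N h (frob_tensor R p M r m) = frob_tensor R p N r (h m)"
    by (fact props)+
qed

lemma frob_map_hom:
  assumes "module R M" "module R N" "h \<in> mod_hom R M N"
  shows "frob_map R p N h \<in> mod_hom R (frob R p M) (frob R p N)"
proof (rule mod_homI)
  interpret M: frob_module R M p by (rule frob_moduleI) fact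
  interpret N: frob_module R N p by (rule frob_moduleI) fact
  note [simp] = frob_map_additive[OF assms] mod_homD(1)[OF assms(3)]
    M.frob_smult_props N.frob_smult_props
  fix r x assume "r \<in> carrier R" "x \<in> carrier (frob R p M)"
  from this(2,1) show "frob_map R p N h (r \<odot>\<^bsub>frob R p M\<^esub> x) = r \<odot>\<^bsub>frob R p N\<^esub> frob_map R p N h x"
    by (induction rule: M.frob_induct) simp_all
qed (simp_all add: frob_map_additive[OF assms])

lemma frob_map_cong:
  assumes "module R M" "module R N" "h \<in> mod_hom R M N" "k \<in> mod_hom R M N"
    and "\<And>x. x \<in> carrier M \<Longrightarrow> h x = k x" and "x \<in> carrier (frob R p M)"
  shows "frob_map R p N h x = frob_map R p N k x"
proof -
  interpret M: frob_module R M p by (rule frob_moduleI) fact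
  show ?thesis
    using assms(6) by (induction rule: M.frob_induct)
      (simp_all add: frob_map_additive[OF assms(1,2,3)] frob_map_additive[OF assms(1,2,4)] assms(5))
qed

lemma frob_map_comp:
  assumes "module R M" "module R N" "module R P" "h \<in> mod_hom R M N" "k \<in> mod_hom R N P"
    and "x \<in> carrier (frob R p M)"
  shows "frob_map R p P k (frob_map R p N h x) = frob_map R p P (\<lambda>x. k (h x)) x"
proof -
  interpret M: frob_module R M p by (rule frob_moduleI) fact
  show ?thesis
    using assms(6) by (induction rule: M.frob_induct)
      (simp_all add: frob_map_additive[OF assms(1,2,4)] frob_map_additive[OF assms(2,3,5)]
         frob_map_additive[OF assms(1,3) mod_hom_comp[OF assms(4,5)]] mod_homD(1)[OF assms(4)])
qed

text \<open>If \<open>S\<close> generates \<open>M\<close> then the tensors \<open>1 \<otimes> s\<close> generate \<open>F(M)\<close>. For a submodule \<open>H\<close> of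
  \<open>F(M)\<close> containing them, the elements \<open>m\<close> with \<open>r \<otimes> m \<in> H\<close> for every \<open>r\<close> form a submodule of \<open>M\<close>,
  because \<open>r \<otimes> a m = a\<^sup>p r \<otimes> m\<close>; it contains \<open>S\<close>, so it is all of \<open>M\<close>.\<close>

lemma frob_fin_gen:
  assumes M: "fin_gen_module R M"
  shows "fin_gen_module R (frob R p M)"
proof -
  have M': "module R M" using M by (simp add: fin_gen_module_def)
  interpret frob_module R M p by (rule frob_moduleI) fact
  obtain S where S: "S \<subseteq> carrier M" "finite S"
    "\<And>H. submodule H R M \<Longrightarrow> S \<subseteq> H \<Longrightarrow> carrier M \<subseteq> H"
    using fin_gen_module_obtain[OF M] by metis
  show ?thesis
  proof (rule fin_gen_moduleI[OF module_frob])
    show "frob_tensor R p M \<one>\<^bsub>R\<^esub> ` S \<subseteq> carrier FM" "finite (frob_tensor R p M \<one>\<^bsub>R\<^esub> ` S)"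
      using S by auto
    fix H assume H: "submodule H R FM" "frob_tensor R p M \<one>\<^bsub>R\<^esub> ` S \<subseteq> H"
    interpret F: module R FM by (rule module_frob)
    note HE = F.submoduleE(4,5)[OF H(1)]
    have H0: "\<zero>\<^bsub>FM\<^esub> \<in> H"
      using subgroup.one_closed[OF submodule.axioms(1)[OF H(1)]] by simp
    let ?H = "{m \<in> carrier M. \<forall>r \<in> carrier R. frob_tensor R p M r m \<in> H}"
    have "carrier M \<subseteq> ?H"
    proof (rule S(3))
      show "S \<subseteq> ?H"
      proof safe
        fix s r assume s: "s \<in> S" and "r \<in> carrier R"
        moreover have "frob_tensor R p M r s = r \<odot>\<^bsub>FM\<^esub> frob_tensor R p M \<one>\<^bsub>R\<^esub> s"
          using s S(1) \<open>r \<in> carrier R\<close> by (auto simp: frob_smult_props)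
        ultimately show "frob_tensor R p M r s \<in> H"
          using H(2) HE(1) by auto
      qed (use S in auto)
      show "submodule ?H R M"
        by (rule submodule_closedI[OF M'])
          (use H0 HE in \<open>auto simp: frob_tensor_zero_right frob_tensor_add_right frob_tensor_smult_right\<close>)
    qed
    then have tensors: "frob_tensor R p M r m \<in> H" if "r \<in> carrier R" "m \<in> carrier M" for r m
      using that by blast
    have "x \<in> H" if "x \<in> carrier FM" for x
      using that by (induction rule: frob_induct) (use H0 HE tensors in auto)
    then show "carrier FM \<subseteq> H" by blast
  qed
qed

section \<open>Iterated Frobenius functors\<close>

lemma copy_module_transport:
  assumes M: "module R M" and inj: "inj_on h (carrier M)"
  shows "module R (copy_module h M)" and "h \<in> mod_hom R M (copy_module h M)"
proof -
  interpret module R M by fact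
  have inv [simp]: "inv_into (carrier M) h (h x) = x" if "x \<in> carrier M" for x
    using inj that by simp
  have ab: "abelian_group (copy_module h M)"
  proof (rule abelian_groupI)
    fix y assume "y \<in> carrier (copy_module h M)"
    then obtain x where x: "x \<in> carrier M" "y = h x"
      by (auto simp: copy_module_def Let_def)
    then show "\<exists>z \<in> carrier (copy_module h M). z \<oplus>\<^bsub>copy_module h M\<^esub> y = \<zero>\<^bsub>copy_module h M\<^esub>"
      by (intro bexI[of _ "h (\<ominus>\<^bsub>M\<^esub> x)"]) (auto simp: copy_module_def Let_def M.l_neg)
  qed (auto simp: copy_module_def Let_def M.a_ac)
  then show "module R (copy_module h M)"
    by (intro moduleI R.is_cring)
      (auto simp: copy_module_def Let_def smult_l_distr smult_r_distr smult_assoc1)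
  show "h \<in> mod_hom R M (copy_module h M)"
    by (auto simp: mod_hom_def copy_module_def Let_def)
qed

lemma frob_ft_module: "module R M \<Longrightarrow> module R (frob_ft R p M)"
  unfolding frob_ft_def
  by (intro copy_module_transport(1) frob_module.module_frob frob_moduleI inj_frob_code)

lemma frob_code_hom: "module R M \<Longrightarrow> frob_code R p M \<in> mod_hom R (frob R p M) (frob_ft R p M)"
  unfolding frob_ft_def
  by (intro copy_module_transport(2) frob_module.module_frob frob_moduleI inj_frob_code)

lemma carrier_frob_ft: "carrier (frob_ft R p M) = frob_code R p M ` carrier (frob R p M)"
  by (simp add: frob_ft_def copy_module_def Let_def)

lemma frob_decode_code:
  "x \<in> carrier (frob R p M) \<Longrightarrow> inv_into (carrier (frob R p M)) (frob_code R p M) (frob_code R p M x) = x"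
  by (rule inv_into_f_f[OF inj_frob_code])

lemma frob_decode_hom:
  assumes "module R M"
  shows "inv_into (carrier (frob R p M)) (frob_code R p M) \<in> mod_hom R (frob_ft R p M) (frob R p M)"
proof (rule mod_homI)
  interpret F: module R "frob R p M"
    using assms by (intro frob_module.module_frob frob_moduleI)
  note h = mod_homD(2,3)[OF frob_code_hom[OF assms, of p], symmetric]
  fix x assume "x \<in> carrier (frob_ft R p M)"
  then obtain x' where x: "x' \<in> carrier (frob R p M)" "x = frob_code R p M x'"
    by (auto simp: carrier_frob_ft)
  let ?d = "inv_into (carrier (frob R p M)) (frob_code R p M)"
  show "?d x \<in> carrier (frob R p M)"
    using x by (simp add: frob_decode_code)
  show "?d (r \<odot>\<^bsub>frob_ft R p M\<^esub> x) = r \<odot>\<^bsub>frob R p M\<^esub> ?d x" if "r \<in> carrier R" for r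
    using x that by (simp add: frob_decode_code h)
  fix y assume "y \<in> carrier (frob_ft R p M)"
  then obtain y' where "y' \<in> carrier (frob R p M)" "y = frob_code R p M y'"
    by (auto simp: carrier_frob_ft)
  then show "?d (x \<oplus>\<^bsub>frob_ft R p M\<^esub> y) = ?d x \<oplus>\<^bsub>frob R p M\<^esub> ?d y"
    using x by (simp add: frob_decode_code h)
qed

lemma frob_ft_fin_gen: "fin_gen_module R M \<Longrightarrow> fin_gen_module R (frob_ft R p M)"
  by (rule fin_gen_module_image[OF frob_fin_gen _ frob_code_hom])
    (auto simp: fin_gen_module_def frob_ft_module carrier_frob_ft)

lemma frob_ft_map_code:
  "x \<in> carrier (frob R p M) \<Longrightarrow>
    frob_ft_map R p M N h (frob_code R p M x) = frob_code R p N (frob_map R p N h x)"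
  by (simp add: frob_ft_map_def frob_decode_code)

lemma frob_ft_map_hom:
  assumes "module R M" "module R N" "h \<in> mod_hom R M N"
  shows "frob_ft_map R p M N h \<in> mod_hom R (frob_ft R p M) (frob_ft R p N)"
  using mod_hom_comp[OF mod_hom_comp[OF frob_decode_hom[OF assms(1)] frob_map_hom[OF assms]]
      frob_code_hom[OF assms(2)]]
  by (simp add: frob_ft_map_def comp_def)

lemma frob_pow_module: "module R M \<Longrightarrow> module R (frob_pow R p M e)"
  by (induction e) (simp_all add: frob_ft_module)

lemma frob_pow_fin_gen: "fin_gen_module R M \<Longrightarrow> fin_gen_module R (frob_pow R p M e)"
  by (induction e) (simp_all add: frob_ft_fin_gen)

lemma frob_pow_map_hom:
  assumes "module R M" "module R N" "h \<in> mod_hom R M N"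
  shows "frob_pow_map R p M N h e \<in> mod_hom R (frob_pow R p M e) (frob_pow R p N e)"
  by (induction e) (simp_all add: assms frob_ft_map_hom frob_pow_module)

text \<open>The iterates of \<open>F\<close> started at \<open>F\<^sup>e(M)\<close> are not merely isomorphic but equal to the later
  iterates started at \<open>M\<close>. This is what makes the diagram generated by \<open>F\<^sup>e(\<beta>)\<close> literally a tail of
  the diagram generated by \<open>\<beta>\<close>.\<close>

lemma frob_pow_add: "frob_pow R p (frob_pow R p M e) i = frob_pow R p M (e + i)"
  by (induction i) simp_all

lemma frob_pow_frob_ft: "frob_pow R p (frob_ft R p M) e = frob_ft R p (frob_pow R p M e)"
  using frob_pow_add[of R p M 1 e] by simp

lemma gen_trans_Suc:
  "gen_trans R p M \<beta> (Suc e) = frob_ft_map R p (frob_pow R p M e) (frob_pow R p M (Suc e)) (gen_trans R p M \<beta> e)"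
  by (simp add: gen_trans_def frob_pow_frob_ft)

lemma gen_trans_hom:
  assumes "module R M" "\<beta> \<in> mod_hom R M (frob R p M)"
  shows "gen_trans R p M \<beta> e \<in> mod_hom R (frob_pow R p M e) (frob_pow R p M (Suc e))"
proof (induction e)
  case 0
  then show ?case
    using mod_hom_comp[OF assms(2) frob_code_hom[OF assms(1)]] by (simp add: gen_trans_def comp_def)
next
  case (Suc e)
  have "module R (frob_pow R p M (Suc e))" by (rule frob_pow_module) fact
  with Suc show ?case
    unfolding gen_trans_Suc frob_pow.simps(2)[of R p M "Suc e"]
    by (subst (2) frob_pow.simps(2)) (intro frob_ft_map_hom frob_pow_module assms)
qed

text \<open>The map \<open>F\<^sup>e(\<beta>)\<close>, with values in \<open>F(F\<^sup>e(M))\<close> itself and not in its encoded copy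
  \<open>F\<^sup>e\<^sup>+\<^sup>1(M)\<close>. For \<open>e > 0\<close> it is the map \<open>F(F\<^sup>e\<^sup>-\<^sup>1(\<beta>))\<close> after decoding; with this choice composing it with
  \<^const>\<open>frob_code\<close> yields the transition map as a function on the whole type, also outside the
  carrier, so that the shifted transition maps agree by plain rewriting.\<close>

definition frob_pow_struct ::
    "('a, 'k) ring_scheme \<Rightarrow> nat \<Rightarrow> ('a, 'a ftree) module \<Rightarrow>
      ('a ftree \<Rightarrow> (('a \<times> 'a ftree) \<Rightarrow>\<^sub>0 int) set) \<Rightarrow> nat \<Rightarrow> 'a ftree \<Rightarrow> (('a \<times> 'a ftree) \<Rightarrow>\<^sub>0 int) set" where
  "frob_pow_struct R p M \<beta> e = (case e of 0 \<Rightarrow> \<beta> | Suc d \<Rightarrow>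
     frob_map R p (frob_pow R p M e) (gen_trans R p M \<beta> d) \<circ>
       inv_into (carrier (frob R p (frob_pow R p M d))) (frob_code R p (frob_pow R p M d)))"

lemma code_frob_pow_struct:
  "frob_code R p (frob_pow R p M e) \<circ> frob_pow_struct R p M \<beta> e = gen_trans R p M \<beta> e"
proof (cases e)
  case 0
  then show ?thesis by (simp add: frob_pow_struct_def gen_trans_def)
next
  case (Suc d)
  then show ?thesis
    unfolding Suc gen_trans_Suc frob_ft_map_def frob_pow_struct_def by (simp add: comp_assoc)
qed

lemma gen_trans_shift:
  "gen_trans R p (frob_pow R p M e) (frob_pow_struct R p M \<beta> e) i = gen_trans R p M \<beta> (e + i)"
proof (induction i)
  case 0
  then show ?case
    using code_frob_pow_struct[of R p M e \<beta>] by (simp add: gen_trans_def)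
next
  case (Suc i)
  then show ?case
    by (simp add: gen_trans_Suc frob_pow_add del: frob_pow.simps)
qed

lemma frob_pow_struct_hom:
  assumes "module R M" "\<beta> \<in> mod_hom R M (frob R p M)"
  shows "frob_pow_struct R p M \<beta> e \<in> mod_hom R (frob_pow R p M e) (frob R p (frob_pow R p M e))"
proof (cases e)
  case 0
  then show ?thesis using assms by (simp add: frob_pow_struct_def)
next
  case (Suc d)
  have "module R (frob_pow R p M d)" "module R (frob_pow R p M (Suc d))"
    by (rule frob_pow_module, fact)+
  from mod_hom_comp[OF frob_decode_hom[OF this(1), of p] frob_map_hom[OF this gen_trans_hom[OF assms]]]
  show ?thesis by (simp add: Suc frob_pow_struct_def comp_def)
qed

section \<open>Sequential direct limits\<close>

locale module_sequence =
  fixes R :: "('a, 'k) ring_scheme" and D :: "nat \<Rightarrow> ('a, 'b) module" and t :: "nat \<Rightarrow> 'b \<Rightarrow> 'b"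
  assumes D_module: "module R (D i)"
    and t_hom: "t i \<in> mod_hom R (D i) (D (Suc i))"
begin

lemma seq_trans_hom: "seq_trans t i k \<in> mod_hom R (D i) (D (i + k))"
proof (induction k)
  case 0
  show ?case by (rule mod_homI) auto
next
  case (Suc k)
  have "seq_trans t i (Suc k) = (\<lambda>x. t (i + k) (seq_trans t i k x))"
    by (rule ext) simp
  with mod_hom_comp[OF Suc t_hom] show ?case by simp
qed

lemma seq_trans_add: "seq_trans t i (k + l) x = seq_trans t (i + k) l (seq_trans t i k x)"
  by (induction l) (simp_all add: add.assoc)

lemma seq_trans_Suc_left: "seq_trans t i (Suc k) x = seq_trans t (Suc i) k (t i x)"
  using seq_trans_add[of i 1 k x] by simp

lemma seq_trans_to_hom: "i \<le> n \<Longrightarrow> seq_trans t i (n - i) \<in> mod_hom R (D i) (D n)"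
  using seq_trans_hom[of i "n - i"] by simp

lemma seq_trans_to:
  assumes "i \<le> n" "n \<le> m"
  shows "seq_trans t n (m - n) (seq_trans t i (n - i) x) = seq_trans t i (m - i) x"
  using seq_trans_add[of i "n - i" "m - n" x] assms by simp

lemma eventually_seq_trans_eq_iff:
  "(\<forall>\<^sub>F n in sequentially. seq_trans t i (n - i) x = seq_trans t j (n - j) y) \<longleftrightarrow>
    (\<exists>n. i \<le> n \<and> j \<le> n \<and> seq_trans t i (n - i) x = seq_trans t j (n - j) y)"
proof
  assume "\<forall>\<^sub>F n in sequentially. seq_trans t i (n - i) x = seq_trans t j (n - j) y"
  then obtain n0 where "\<And>n. n0 \<le> n \<Longrightarrow> seq_trans t i (n - i) x = seq_trans t j (n - j) y"
    by (auto simp: eventually_sequentially)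
  then show "\<exists>n. i \<le> n \<and> j \<le> n \<and> seq_trans t i (n - i) x = seq_trans t j (n - j) y"
    by (intro exI[of _ "max n0 (max i j)"]) auto
next
  assume "\<exists>n. i \<le> n \<and> j \<le> n \<and> seq_trans t i (n - i) x = seq_trans t j (n - j) y"
  then obtain n where n: "i \<le> n" "j \<le> n" "seq_trans t i (n - i) x = seq_trans t j (n - j) y"
    by blast
  have "seq_trans t i (m - i) x = seq_trans t j (m - j) y" if "n \<le> m" for m
    using seq_trans_to[OF n(1) that, of x] seq_trans_to[OF n(2) that, of y] n(3) by simp
  then show "\<forall>\<^sub>F n in sequentially. seq_trans t i (n - i) x = seq_trans t j (n - j) y"
    unfolding eventually_sequentially by blast
qed

text \<open>Two elements are identified in the limit as soon as they agree at one later level, and then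
  they agree at all subsequent levels. The eventual form of this condition is visibly transitive and
  compatible with sums and scalars.\<close>

lemma dirlim_in_altdef:
  "dirlim_in D t i x = {(j, y). y \<in> carrier (D j) \<and>
     (\<forall>\<^sub>F n in sequentially. seq_trans t i (n - i) x = seq_trans t j (n - j) y)}"
  by (simp add: dirlim_in_def eventually_seq_trans_eq_iff)

lemma dirlim_in_eq_iff:
  assumes "x \<in> carrier (D i)"
  shows "dirlim_in D t i x = dirlim_in D t j y \<longleftrightarrow>
    (\<forall>\<^sub>F n in sequentially. seq_trans t i (n - i) x = seq_trans t j (n - j) y)"
proof
  assume "dirlim_in D t i x = dirlim_in D t j y"
  moreover have "(i, x) \<in> dirlim_in D t i x"
    using assms by (simp add: dirlim_in_altdef)
  ultimately have "(i, x) \<in> dirlim_in D t j y" by simp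
  then show "\<forall>\<^sub>F n in sequentially. seq_trans t i (n - i) x = seq_trans t j (n - j) y"
    by (auto simp: dirlim_in_altdef elim: eventually_mono)
next
  assume eq: "\<forall>\<^sub>F n in sequentially. seq_trans t i (n - i) x = seq_trans t j (n - j) y"
  have "(\<forall>\<^sub>F n in sequentially. seq_trans t i (n - i) x = seq_trans t k (n - k) z) \<longleftrightarrow>
    (\<forall>\<^sub>F n in sequentially. seq_trans t j (n - j) y = seq_trans t k (n - k) z)" for k z
  proof
    assume "\<forall>\<^sub>F n in sequentially. seq_trans t i (n - i) x = seq_trans t k (n - k) z"
    with eq show "\<forall>\<^sub>F n in sequentially. seq_trans t j (n - j) y = seq_trans t k (n - k) z"
      by eventually_elim simp
  next
    assume "\<forall>\<^sub>F n in sequentially. seq_trans t j (n - j) y = seq_trans t k (n - k) z"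
    with eq show "\<forall>\<^sub>F n in sequentially. seq_trans t i (n - i) x = seq_trans t k (n - k) z"
      by eventually_elim simp
  qed
  then show "dirlim_in D t i x = dirlim_in D t j y"
    by (simp add: dirlim_in_altdef)
qed

lemma mem_dirlim_in:
  "(j, y) \<in> dirlim_in D t i x \<longleftrightarrow> y \<in> carrier (D j) \<and> dirlim_in D t j y = dirlim_in D t i x"
proof (cases "y \<in> carrier (D j)")
  case True
  have "(j, y) \<in> dirlim_in D t i x \<longleftrightarrow>
    (\<forall>\<^sub>F n in sequentially. seq_trans t i (n - i) x = seq_trans t j (n - j) y)"
    using True by (simp add: dirlim_in_altdef)
  also have "\<dots> \<longleftrightarrow> (\<forall>\<^sub>F n in sequentially. seq_trans t j (n - j) y = seq_trans t i (n - i) x)"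
    by (subst eq_commute) (rule refl)
  finally show ?thesis
    using True by (simp add: dirlim_in_eq_iff)
qed (simp add: dirlim_in_altdef)

lemma dirlim_in_seq_trans:
  assumes "x \<in> carrier (D i)"
  shows "dirlim_in D t (i + k) (seq_trans t i k x) = dirlim_in D t i x"
proof -
  have x: "seq_trans t i k x \<in> carrier (D (i + k))"
    using assms mod_homD(1)[OF seq_trans_hom] by blast
  show ?thesis
    unfolding dirlim_in_eq_iff[OF x] eventually_seq_trans_eq_iff
    by (intro exI[of _ "i + k"]) simp
qed

lemma carrier_dirlim: "carrier (dirlim D t) = {dirlim_in D t i x | i x. x \<in> carrier (D i)}"
  by (simp add: dirlim_def)

lemma dirlim_in_closed [simp]: "x \<in> carrier (D i) \<Longrightarrow> dirlim_in D t i x \<in> carrier (dirlim D t)"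
  by (auto simp: carrier_dirlim)

lemma dirlim_add:
  assumes "x \<in> carrier (D i)" "y \<in> carrier (D i)"
  shows "dirlim_in D t i x \<oplus>\<^bsub>dirlim D t\<^esub> dirlim_in D t i y = dirlim_in D t i (x \<oplus>\<^bsub>D i\<^esub> y)"
proof -
  have eq: "dirlim_in D t j (x' \<oplus>\<^bsub>D j\<^esub> y') = dirlim_in D t i (x \<oplus>\<^bsub>D i\<^esub> y)"
    if "x' \<in> carrier (D j)" "y' \<in> carrier (D j)" "dirlim_in D t j x' = dirlim_in D t i x"
      "dirlim_in D t j y' = dirlim_in D t i y" for j x' y'
  proof -
    interpret module R "D j" by (rule D_module)
    have "\<forall>\<^sub>F n in sequentially. seq_trans t j (n - j) x' = seq_trans t i (n - i) x"
      "\<forall>\<^sub>F n in sequentially. seq_trans t j (n - j) y' = seq_trans t i (n - i) y"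
      using that by (simp_all add: dirlim_in_eq_iff)
    moreover have "\<forall>\<^sub>F n in sequentially. j \<le> n" "\<forall>\<^sub>F n in sequentially. i \<le> n"
      by (rule eventually_ge_at_top)+
    ultimately have "\<forall>\<^sub>F n in sequentially. seq_trans t j (n - j) (x' \<oplus>\<^bsub>D j\<^esub> y') =
        seq_trans t i (n - i) (x \<oplus>\<^bsub>D i\<^esub> y)"
      by eventually_elim (use assms that in \<open>simp add: mod_homD(2)[OF seq_trans_to_hom]\<close>)
    then show ?thesis
      using that by (simp add: dirlim_in_eq_iff)
  qed
  have "{dirlim_in D t j (x' \<oplus>\<^bsub>D j\<^esub> y') | j x' y'.
      (j, x') \<in> dirlim_in D t i x \<and> (j, y') \<in> dirlim_in D t i y} = {dirlim_in D t i (x \<oplus>\<^bsub>D i\<^esub> y)}"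
    unfolding mem_dirlim_in using assms eq by blast
  then show ?thesis by (simp add: dirlim_def)
qed

lemma dirlim_smult:
  assumes "r \<in> carrier R" "x \<in> carrier (D i)"
  shows "r \<odot>\<^bsub>dirlim D t\<^esub> dirlim_in D t i x = dirlim_in D t i (r \<odot>\<^bsub>D i\<^esub> x)"
proof -
  have eq: "dirlim_in D t j (r \<odot>\<^bsub>D j\<^esub> x') = dirlim_in D t i (r \<odot>\<^bsub>D i\<^esub> x)"
    if "x' \<in> carrier (D j)" "dirlim_in D t j x' = dirlim_in D t i x" for j x'
  proof -
    interpret module R "D j" by (rule D_module)
    have "\<forall>\<^sub>F n in sequentially. seq_trans t j (n - j) x' = seq_trans t i (n - i) x"
      using that by (simp add: dirlim_in_eq_iff)
    moreover have "\<forall>\<^sub>F n in sequentially. j \<le> n" "\<forall>\<^sub>F n in sequentially. i \<le> n"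
      by (rule eventually_ge_at_top)+
    ultimately have "\<forall>\<^sub>F n in sequentially. seq_trans t j (n - j) (r \<odot>\<^bsub>D j\<^esub> x') =
        seq_trans t i (n - i) (r \<odot>\<^bsub>D i\<^esub> x)"
      by eventually_elim (use assms that in \<open>simp add: mod_homD(3)[OF seq_trans_to_hom]\<close>)
    then show ?thesis
      using that assms by (simp add: dirlim_in_eq_iff)
  qed
  have "{dirlim_in D t j (r \<odot>\<^bsub>D j\<^esub> x') | j x'. (j, x') \<in> dirlim_in D t i x} =
      {dirlim_in D t i (r \<odot>\<^bsub>D i\<^esub> x)}"
    unfolding mem_dirlim_in using assms eq by blast
  then show ?thesis by (simp add: dirlim_def)
qed

lemma dirlim_in_zero: "dirlim_in D t i \<zero>\<^bsub>D i\<^esub> = \<zero>\<^bsub>dirlim D t\<^esub>"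
proof -
  interpret module R "D 0" by (rule D_module)
  have "seq_trans t 0 i \<zero>\<^bsub>D 0\<^esub> = \<zero>\<^bsub>D i\<^esub>"
    using mod_hom_zero[OF D_module D_module seq_trans_hom[of 0 i]] by simp
  then show ?thesis
    using dirlim_in_seq_trans[of "\<zero>\<^bsub>D 0\<^esub>" 0 i] by (simp add: dirlim_def)
qed

text \<open>Finitely many elements of the limit come from a single level, so the module axioms for the
  limit are instances of those for one of the \<open>D n\<close>.\<close>

lemma dirlim_common_level:
  assumes "finite \<A>" "\<A> \<subseteq> carrier (dirlim D t)"
  shows "\<exists>n. \<A> \<subseteq> dirlim_in D t n ` carrier (D n)"
  using assms
proof (induction rule: finite_induct)
  case (insert A \<A>)
  have step: "dirlim_in D t n ` carrier (D n) \<subseteq> dirlim_in D t (n + k) ` carrier (D (n + k))" for n k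
  proof safe
    fix x assume x: "x \<in> carrier (D n)"
    show "dirlim_in D t n x \<in> dirlim_in D t (n + k) ` carrier (D (n + k))"
      using dirlim_in_seq_trans[OF x, of k, symmetric] mod_homD(1)[OF seq_trans_hom x, of k]
      by (rule image_eqI)
  qed
  obtain n where n: "\<A> \<subseteq> dirlim_in D t n ` carrier (D n)"
    using insert by auto
  obtain i x where "x \<in> carrier (D i)" "A = dirlim_in D t i x"
    using insert by (auto simp: carrier_dirlim)
  with n step[of n i] step[of i n] have "insert A \<A> \<subseteq> dirlim_in D t (n + i) ` carrier (D (n + i))"
    by (auto simp: add.commute)
  then show ?case by blast
qed simp

lemma dirlim_in_add_closed:
  assumes "x \<in> carrier (D i)" "y \<in> carrier (D i)"
  shows "x \<oplus>\<^bsub>D i\<^esub> y \<in> carrier (D i)"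
proof -
  interpret module R "D i" by (rule D_module)
  show ?thesis using assms by simp
qed

lemma module_dirlim: "module R (dirlim D t)"
proof (rule moduleI)
  show "cring R" using D_module by (simp add: module_def)
  show "abelian_group (dirlim D t)"
  proof (rule abelian_groupI)
    fix A B C assume "A \<in> carrier (dirlim D t)" "B \<in> carrier (dirlim D t)" "C \<in> carrier (dirlim D t)"
    then obtain n where "{A, B, C} \<subseteq> dirlim_in D t n ` carrier (D n)"
      using dirlim_common_level[of "{A, B, C}"] by auto
    then obtain x y z where [simp]: "x \<in> carrier (D n)" "y \<in> carrier (D n)" "z \<in> carrier (D n)"
      and eq: "A = dirlim_in D t n x" "B = dirlim_in D t n y" "C = dirlim_in D t n z"
      by auto
    interpret module R "D n" by (rule D_module)
    show "A \<oplus>\<^bsub>dirlim D t\<^esub> B \<oplus>\<^bsub>dirlim D t\<^esub> C = A \<oplus>\<^bsub>dirlim D t\<^esub> (B \<oplus>\<^bsub>dirlim D t\<^esub> C)"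
      by (simp add: eq dirlim_add M.a_assoc)
  next
    fix A B assume "A \<in> carrier (dirlim D t)" "B \<in> carrier (dirlim D t)"
    then obtain n where "{A, B} \<subseteq> dirlim_in D t n ` carrier (D n)"
      using dirlim_common_level[of "{A, B}"] by auto
    then obtain x y where [simp]: "x \<in> carrier (D n)" "y \<in> carrier (D n)"
      and eq: "A = dirlim_in D t n x" "B = dirlim_in D t n y"
      by auto
    interpret module R "D n" by (rule D_module)
    show "A \<oplus>\<^bsub>dirlim D t\<^esub> B \<in> carrier (dirlim D t)"
      by (simp add: eq dirlim_add)
    show "A \<oplus>\<^bsub>dirlim D t\<^esub> B = B \<oplus>\<^bsub>dirlim D t\<^esub> A"
      by (simp add: eq dirlim_add M.a_comm)
  next
    fix A assume "A \<in> carrier (dirlim D t)"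
    then obtain n x where [simp]: "x \<in> carrier (D n)" and eq: "A = dirlim_in D t n x"
      by (auto simp: carrier_dirlim)
    interpret module R "D n" by (rule D_module)
    show "\<zero>\<^bsub>dirlim D t\<^esub> \<oplus>\<^bsub>dirlim D t\<^esub> A = A"
      by (simp add: eq dirlim_add dirlim_in_zero[of n, symmetric])
    show "\<exists>B\<in>carrier (dirlim D t). B \<oplus>\<^bsub>dirlim D t\<^esub> A = \<zero>\<^bsub>dirlim D t\<^esub>"
      by (intro bexI[of _ "dirlim_in D t n (\<ominus>\<^bsub>D n\<^esub> x)"])
        (simp_all add: eq dirlim_add dirlim_in_zero M.l_neg)
  next
    interpret module R "D 0" by (rule D_module)
    show "\<zero>\<^bsub>dirlim D t\<^esub> \<in> carrier (dirlim D t)"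
      by (simp add: dirlim_in_zero[of 0, symmetric])
  qed
next
  fix a b A B assume "a \<in> carrier R" "b \<in> carrier R"
    and "A \<in> carrier (dirlim D t)" "B \<in> carrier (dirlim D t)"
  then obtain n where "{A, B} \<subseteq> dirlim_in D t n ` carrier (D n)"
    using dirlim_common_level[of "{A, B}"] by auto
  then obtain x y where [simp]: "x \<in> carrier (D n)" "y \<in> carrier (D n)"
    and eq: "A = dirlim_in D t n x" "B = dirlim_in D t n y"
    by auto
  interpret module R "D n" by (rule D_module)
  show "a \<odot>\<^bsub>dirlim D t\<^esub> (A \<oplus>\<^bsub>dirlim D t\<^esub> B) = a \<odot>\<^bsub>dirlim D t\<^esub> A \<oplus>\<^bsub>dirlim D t\<^esub> a \<odot>\<^bsub>dirlim D t\<^esub> B"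
    using \<open>a \<in> carrier R\<close> by (simp add: eq dirlim_add dirlim_smult smult_r_distr)
next
  fix a b A assume [simp]: "a \<in> carrier R" "b \<in> carrier R" and "A \<in> carrier (dirlim D t)"
  then obtain n x where [simp]: "x \<in> carrier (D n)" and eq: "A = dirlim_in D t n x"
    by (auto simp: carrier_dirlim)
  interpret module R "D n" by (rule D_module)
  show "a \<odot>\<^bsub>dirlim D t\<^esub> A \<in> carrier (dirlim D t)"
    by (simp add: eq dirlim_smult)
  show "(a \<oplus>\<^bsub>R\<^esub> b) \<odot>\<^bsub>dirlim D t\<^esub> A = a \<odot>\<^bsub>dirlim D t\<^esub> A \<oplus>\<^bsub>dirlim D t\<^esub> b \<odot>\<^bsub>dirlim D t\<^esub> A"
    by (simp add: eq dirlim_add dirlim_smult smult_l_distr)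
  show "(a \<otimes>\<^bsub>R\<^esub> b) \<odot>\<^bsub>dirlim D t\<^esub> A = a \<odot>\<^bsub>dirlim D t\<^esub> (b \<odot>\<^bsub>dirlim D t\<^esub> A)"
    by (simp add: eq dirlim_smult smult_assoc1)
next
  fix A assume "A \<in> carrier (dirlim D t)"
  then obtain n x where [simp]: "x \<in> carrier (D n)" and eq: "A = dirlim_in D t n x"
    by (auto simp: carrier_dirlim)
  interpret module R "D n" by (rule D_module)
  show "\<one>\<^bsub>R\<^esub> \<odot>\<^bsub>dirlim D t\<^esub> A = A"
    by (simp add: eq dirlim_smult)
qed

lemma dirlim_in_hom: "dirlim_in D t i \<in> mod_hom R (D i) (dirlim D t)"
  by (rule mod_homI) (simp_all add: dirlim_add dirlim_smult)

end

text \<open>A cone under the sequence with these two conditions on images and kernels is a direct limit.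
  Arguing with the maps \<open>leg i\<close> instead of equivalence classes makes it immaterial which model of the
  limit is used.\<close>

locale limit_cone = module_sequence R D t
  for R :: "('a, 'k) ring_scheme" and D :: "nat \<Rightarrow> ('a, 'b) module" and t :: "nat \<Rightarrow> 'b \<Rightarrow> 'b" +
  fixes Lim :: "('a, 'c) module" and leg :: "nat \<Rightarrow> 'b \<Rightarrow> 'c"
  assumes Lim_module: "module R Lim"
    and leg_hom: "leg i \<in> mod_hom R (D i) Lim"
    and leg_step: "x \<in> carrier (D i) \<Longrightarrow> leg (Suc i) (t i x) = leg i x"
    and exhaust: "z \<in> carrier Lim \<Longrightarrow> \<exists>i. \<exists>x \<in> carrier (D i). z = leg i x"
    and leg_kernel: "x \<in> carrier (D i) \<Longrightarrow> leg i x = \<zero>\<^bsub>Lim\<^esub> \<Longrightarrow> \<exists>k. seq_trans t i k x = \<zero>\<^bsub>D (i + k)\<^esub>"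
begin

lemma leg_seq_trans:
  assumes "x \<in> carrier (D i)"
  shows "leg (i + k) (seq_trans t i k x) = leg i x"
proof (induction k)
  case (Suc k)
  then show ?case
    using leg_step[OF mod_homD(1)[OF seq_trans_hom assms]] by simp
qed simp

lemma leg_eq_imp:
  assumes x: "x \<in> carrier (D i)" and y: "y \<in> carrier (D i)" and eq: "leg i x = leg i y"
  shows "\<exists>k. seq_trans t i k x = seq_trans t i k y"
proof -
  interpret module R "D i" by (rule D_module)
  have "leg i (x \<ominus>\<^bsub>D i\<^esub> y) = \<zero>\<^bsub>Lim\<^esub>"
    using mod_hom_diff_eq_zero[OF D_module Lim_module leg_hom x y] eq by blast
  then obtain k where "seq_trans t i k (x \<ominus>\<^bsub>D i\<^esub> y) = \<zero>\<^bsub>D (i + k)\<^esub>"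
    using leg_kernel[of "x \<ominus>\<^bsub>D i\<^esub> y" i] x y by auto
  then show ?thesis
    using mod_hom_diff_eq_zero[OF D_module D_module seq_trans_hom x y] by blast
qed

lemma leg_eq_iff:
  assumes x: "x \<in> carrier (D i)" and y: "y \<in> carrier (D j)"
  shows "leg i x = leg j y \<longleftrightarrow> dirlim_in D t i x = dirlim_in D t j y"
proof -
  let ?x = "seq_trans t i j x" and ?y = "seq_trans t j i y"
  have x': "?x \<in> carrier (D (i + j))" "?y \<in> carrier (D (i + j))"
    using mod_homD(1)[OF seq_trans_hom x, of j] mod_homD(1)[OF seq_trans_hom y, of i]
    by (simp_all add: add.commute)
  have legs: "leg (i + j) ?x = leg i x" "leg (i + j) ?y = leg j y"
    using leg_seq_trans[OF x, of j] leg_seq_trans[OF y, of i] by (simp_all add: add.commute)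
  have ins: "dirlim_in D t (i + j) ?x = dirlim_in D t i x" "dirlim_in D t (i + j) ?y = dirlim_in D t j y"
    using dirlim_in_seq_trans[OF x, of j] dirlim_in_seq_trans[OF y, of i] by (simp_all add: add.commute)
  have "leg (i + j) ?x = leg (i + j) ?y \<longleftrightarrow> dirlim_in D t (i + j) ?x = dirlim_in D t (i + j) ?y"
  proof
    assume "leg (i + j) ?x = leg (i + j) ?y"
    then obtain k where "seq_trans t (i + j) k ?x = seq_trans t (i + j) k ?y"
      using leg_eq_imp x' by blast
    then show "dirlim_in D t (i + j) ?x = dirlim_in D t (i + j) ?y"
      using dirlim_in_seq_trans[OF x'(1), of k] dirlim_in_seq_trans[OF x'(2), of k] by simp
  next
    assume "dirlim_in D t (i + j) ?x = dirlim_in D t (i + j) ?y"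
    then obtain n where "i + j \<le> n"
      "seq_trans t (i + j) (n - (i + j)) ?x = seq_trans t (i + j) (n - (i + j)) ?y"
      using x' by (auto simp: dirlim_in_eq_iff eventually_seq_trans_eq_iff)
    then show "leg (i + j) ?x = leg (i + j) ?y"
      using leg_seq_trans[OF x'(1), of "n - (i + j)"] leg_seq_trans[OF x'(2), of "n - (i + j)"] by simp
  qed
  then show ?thesis by (simp add: legs ins)
qed

text \<open>The canonical model \<^const>\<open>dirlim\<close> maps isomorphically to any such cone: the kernel condition
  gives injectivity, exhaustion gives surjectivity.\<close>

lemma comparison_iso:
  obtains u where "u \<in> mod_iso R (dirlim D t) Lim"
    and "\<And>i x. x \<in> carrier (D i) \<Longrightarrow> u (dirlim_in D t i x) = leg i x"
proof -
  define u where "u A = (THE z. \<exists>i x. x \<in> carrier (D i) \<and> A = dirlim_in D t i x \<and> z = leg i x)" for A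
  have u: "u (dirlim_in D t i x) = leg i x" if "x \<in> carrier (D i)" for i x
    unfolding u_def using that leg_eq_iff by (intro the_equality) auto
  have "u \<in> mod_hom R (dirlim D t) Lim"
  proof (rule mod_homI)
    fix A assume A: "A \<in> carrier (dirlim D t)"
    then obtain i x where x: "x \<in> carrier (D i)" "A = dirlim_in D t i x"
      by (auto simp: carrier_dirlim)
    interpret module R "D i" by (rule D_module)
    show "u A \<in> carrier Lim"
      using x by (simp add: u mod_homD(1)[OF leg_hom])
    show "u (r \<odot>\<^bsub>dirlim D t\<^esub> A) = r \<odot>\<^bsub>Lim\<^esub> u A" if "r \<in> carrier R" for r
      using x that by (simp add: u dirlim_smult mod_homD(3)[OF leg_hom])
    fix B assume "B \<in> carrier (dirlim D t)"
    then obtain n where "{A, B} \<subseteq> dirlim_in D t n ` carrier (D n)"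
      using dirlim_common_level[of "{A, B}"] A by auto
    then show "u (A \<oplus>\<^bsub>dirlim D t\<^esub> B) = u A \<oplus>\<^bsub>Lim\<^esub> u B"
      by (auto simp: u dirlim_add dirlim_in_add_closed mod_homD(2)[OF leg_hom])
  qed
  moreover have "bij_betw u (carrier (dirlim D t)) (carrier Lim)"
  proof (rule bij_betwI')
    fix A B assume "A \<in> carrier (dirlim D t)" "B \<in> carrier (dirlim D t)"
    then show "(u A = u B) = (A = B)"
      by (auto simp: carrier_dirlim u leg_eq_iff)
  next
    fix z assume "z \<in> carrier Lim"
    then show "\<exists>A\<in>carrier (dirlim D t). z = u A"
      using exhaust[of z] u by (metis dirlim_in_closed)
  next
    fix A assume "A \<in> carrier (dirlim D t)"
    then show "u A \<in> carrier Lim"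
      using mod_homD(1)[OF \<open>u \<in> mod_hom R (dirlim D t) Lim\<close>] by blast
  qed
  ultimately have "u \<in> mod_iso R (dirlim D t) Lim"
    by (simp add: mod_iso_def)
  with u that show ?thesis by blast
qed

text \<open>An element of the limit represented at some level \<open>i\<close> is also represented at level \<open>e + i\<close>, so
  the tail still exhausts the limit.\<close>

lemma limit_cone_shift: "limit_cone R (\<lambda>i. D (e + i)) (\<lambda>i. t (e + i)) Lim (\<lambda>i. leg (e + i))"
proof -
  have trans: "seq_trans (\<lambda>i. t (e + i)) i k x = seq_trans t (e + i) k x" for i k x
    by (induction k) (simp_all add: add.assoc)
  show ?thesis
  proof (intro limit_cone.intro module_sequence.intro limit_cone_axioms.intro)
    fix z assume "z \<in> carrier Lim"
    then obtain i x where x: "x \<in> carrier (D i)" "z = leg i x"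
      using exhaust by blast
    then show "\<exists>i. \<exists>x \<in> carrier (D (e + i)). z = leg (e + i) x"
      using leg_seq_trans[OF x(1), of e] mod_homD(1)[OF seq_trans_hom x(1), of e]
      by (intro exI[of _ i] bexI[of _ "seq_trans t i e x"]) (simp_all add: add.commute)
  next
    fix x i assume "x \<in> carrier (D (e + i))" "leg (e + i) x = \<zero>\<^bsub>Lim\<^esub>"
    then show "\<exists>k. seq_trans (\<lambda>i. t (e + i)) i k x = \<zero>\<^bsub>D (e + (i + k))\<^esub>"
      using leg_kernel[of x "e + i"] by (simp add: trans add.assoc)
  qed (use D_module t_hom Lim_module leg_hom leg_step in auto)
qed

end

lemma (in module_sequence) dirlim_limit_cone: "limit_cone R D t (dirlim D t) (dirlim_in D t)"
proof (intro limit_cone.intro limit_cone_axioms.intro)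
  show "module_sequence R D t" by (rule module_sequence_axioms)
  show "module R (dirlim D t)" by (rule module_dirlim)
  show "dirlim_in D t i \<in> mod_hom R (D i) (dirlim D t)" for i by (rule dirlim_in_hom)
  show "dirlim_in D t (Suc i) (t i x) = dirlim_in D t i x" if "x \<in> carrier (D i)" for i x
    using dirlim_in_seq_trans[OF that, of 1] by simp
  show "\<exists>i. \<exists>x\<in>carrier (D i). z = dirlim_in D t i x" if "z \<in> carrier (dirlim D t)" for z
    using that by (auto simp: carrier_dirlim)
  fix i x assume x: "x \<in> carrier (D i)" "dirlim_in D t i x = \<zero>\<^bsub>dirlim D t\<^esub>"
  then have "dirlim_in D t i x = dirlim_in D t i \<zero>\<^bsub>D i\<^esub>"
    by (simp add: dirlim_in_zero)
  then obtain n where "i \<le> n" "seq_trans t i (n - i) x = seq_trans t i (n - i) \<zero>\<^bsub>D i\<^esub>"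
    using x by (auto simp: dirlim_in_eq_iff eventually_seq_trans_eq_iff)
  then show "\<exists>k. seq_trans t i k x = \<zero>\<^bsub>D (i + k)\<^esub>"
    using mod_hom_zero[OF D_module D_module seq_trans_hom] by metis
qed

section \<open>Finite presentation over a noetherian ring\<close>

lemma ideal_closedI:
  assumes "cring R" "I \<subseteq> carrier R" "\<zero>\<^bsub>R\<^esub> \<in> I"
    and "\<And>a b. a \<in> I \<Longrightarrow> b \<in> I \<Longrightarrow> a \<oplus>\<^bsub>R\<^esub> b \<in> I"
    and mult: "\<And>a b. a \<in> carrier R \<Longrightarrow> b \<in> I \<Longrightarrow> a \<otimes>\<^bsub>R\<^esub> b \<in> I"
  shows "ideal I R"
proof -
  interpret cring R by fact
  have inv: "\<ominus>\<^bsub>R\<^esub> a \<in> I" if "a \<in> I" for a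
    using mult[of "\<ominus>\<^bsub>R\<^esub> \<one>\<^bsub>R\<^esub>" a] that assms(2) by (auto simp: l_minus)
  have "subgroup I (add_monoid R)"
    using assms inv by (intro add.subgroupI) (auto simp: a_inv_def)
  moreover have "b \<otimes>\<^bsub>R\<^esub> a \<in> I" if "a \<in> carrier R" "b \<in> I" for a b
    using mult[OF that] that assms(2) by (metis m_comm subsetD)
  ultimately show ?thesis
    using mult ring_axioms by (intro idealI) auto
qed

context limit_cone
begin

text \<open>Each generator needs a finite level for the two maps to agree on it; the largest of these
  levels serves for all generators, hence for all of \<open>N\<close>.\<close>

lemma fin_gen_eventually_eq:
  assumes N: "fin_gen_module R N"
    and a: "a \<in> mod_hom R N (D i)" and b: "b \<in> mod_hom R N (D i)"
    and eq: "\<And>x. x \<in> carrier N \<Longrightarrow> leg i (a x) = leg i (b x)"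
  shows "\<exists>k. \<forall>x \<in> carrier N. seq_trans t i k (a x) = seq_trans t i k (b x)"
proof -
  have N': "module R N" using N by (simp add: fin_gen_module_def)
  interpret N: module R N by fact
  obtain S where S: "S \<subseteq> carrier N" "finite S"
    "\<And>H. submodule H R N \<Longrightarrow> S \<subseteq> H \<Longrightarrow> carrier N \<subseteq> H"
    using fin_gen_module_obtain[OF N] by metis
  have "\<forall>s \<in> S. \<forall>\<^sub>F k in sequentially. seq_trans t i k (a s) = seq_trans t i k (b s)"
  proof
    fix s assume "s \<in> S"
    then have s: "s \<in> carrier N" using S by auto
    obtain k where k: "seq_trans t i k (a s) = seq_trans t i k (b s)"
      using leg_eq_imp[OF mod_homD(1)[OF a s] mod_homD(1)[OF b s] eq[OF s]] by blast
    have "seq_trans t i (k + l) (a s) = seq_trans t i (k + l) (b s)" for l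
      by (simp add: seq_trans_add k)
    then show "\<forall>\<^sub>F k in sequentially. seq_trans t i k (a s) = seq_trans t i k (b s)"
      unfolding eventually_sequentially by (metis le_Suc_ex)
  qed
  then have "\<forall>\<^sub>F k in sequentially. \<forall>s \<in> S. seq_trans t i k (a s) = seq_trans t i k (b s)"
    using S(2) by (simp add: eventually_ball_finite)
  then obtain k where k: "\<forall>s \<in> S. seq_trans t i k (a s) = seq_trans t i k (b s)"
    by (auto simp: eventually_sequentially)
  let ?H = "{x \<in> carrier N. seq_trans t i k (a x) = seq_trans t i k (b x)}"
  have ha: "(\<lambda>x. seq_trans t i k (a x)) \<in> mod_hom R N (D (i + k))"
    and hb: "(\<lambda>x. seq_trans t i k (b x)) \<in> mod_hom R N (D (i + k))"
    using mod_hom_comp[OF a seq_trans_hom] mod_hom_comp[OF b seq_trans_hom] by blast+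
  have "submodule ?H R N"
    by (rule submodule_closedI[OF N'])
      (auto simp: mod_hom_zero[OF N' D_module ha] mod_hom_zero[OF N' D_module hb]
        mod_homD(2,3)[OF ha] mod_homD(2,3)[OF hb])
  then have "carrier N \<subseteq> ?H" using S k by blast
  then show ?thesis by blast
qed

text \<open>The graph of a linear map from a submodule of \<open>N\<close> to \<open>D e\<close> that lifts \<open>\<psi>\<close>. For a graph
  closed under addition and scalars, single-valuedness is the last clause. Graphs avoid choosing
  coefficients of elements of \<open>N\<close> with respect to generators.\<close>

definition partial_lift :: "('a, 'd) module \<Rightarrow> ('d \<Rightarrow> 'c) \<Rightarrow> nat \<Rightarrow> ('d \<times> 'b) set \<Rightarrow> bool" where
  "partial_lift N \<psi> e G \<longleftrightarrow> G \<subseteq> carrier N \<times> carrier (D e) \<and> (\<zero>\<^bsub>N\<^esub>, \<zero>\<^bsub>D e\<^esub>) \<in> G \<and>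
     (\<forall>n m n' m'. (n, m) \<in> G \<longrightarrow> (n', m') \<in> G \<longrightarrow> (n \<oplus>\<^bsub>N\<^esub> n', m \<oplus>\<^bsub>D e\<^esub> m') \<in> G) \<and>
     (\<forall>r n m. r \<in> carrier R \<longrightarrow> (n, m) \<in> G \<longrightarrow> (r \<odot>\<^bsub>N\<^esub> n, r \<odot>\<^bsub>D e\<^esub> m) \<in> G) \<and>
     (\<forall>n m. (n, m) \<in> G \<longrightarrow> leg e m = \<psi> n) \<and>
     (\<forall>m. (\<zero>\<^bsub>N\<^esub>, m) \<in> G \<longrightarrow> m = \<zero>\<^bsub>D e\<^esub>)"

lemma partial_liftD:
  assumes "partial_lift N \<psi> e G"
  shows "(n, m) \<in> G \<Longrightarrow> n \<in> carrier N" and "(n, m) \<in> G \<Longrightarrow> m \<in> carrier (D e)"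
    and "(\<zero>\<^bsub>N\<^esub>, \<zero>\<^bsub>D e\<^esub>) \<in> G"
    and "(n, m) \<in> G \<Longrightarrow> (n', m') \<in> G \<Longrightarrow> (n \<oplus>\<^bsub>N\<^esub> n', m \<oplus>\<^bsub>D e\<^esub> m') \<in> G"
    and "r \<in> carrier R \<Longrightarrow> (n, m) \<in> G \<Longrightarrow> (r \<odot>\<^bsub>N\<^esub> n, r \<odot>\<^bsub>D e\<^esub> m) \<in> G"
    and "(n, m) \<in> G \<Longrightarrow> leg e m = \<psi> n"
    and "(\<zero>\<^bsub>N\<^esub>, m) \<in> G \<Longrightarrow> m = \<zero>\<^bsub>D e\<^esub>"
  using assms unfolding partial_lift_def by blast+

lemma partial_lift_raise:
  assumes G: "partial_lift N \<psi> e G"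
  shows "partial_lift N \<psi> (e + k) (map_prod id (seq_trans t e k) ` G)"
proof -
  note GD = partial_liftD[OF G] and mem = partial_liftD(1,2)[OF G]
  have hom: "seq_trans t e k \<in> mod_hom R (D e) (D (e + k))" by (rule seq_trans_hom)
  note zero = mod_hom_zero[OF D_module D_module hom]
  show ?thesis
    unfolding partial_lift_def
  proof (intro conjI allI impI)
    show "map_prod id (seq_trans t e k) ` G \<subseteq> carrier N \<times> carrier (D (e + k))"
      using mem mod_homD(1)[OF hom] by auto
    show "(\<zero>\<^bsub>N\<^esub>, \<zero>\<^bsub>D (e + k)\<^esub>) \<in> map_prod id (seq_trans t e k) ` G"
      using GD(3) zero by (intro image_eqI[of _ _ "(\<zero>\<^bsub>N\<^esub>, \<zero>\<^bsub>D e\<^esub>)"]) auto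
  next
    fix n m n' m'
    assume "(n, m) \<in> map_prod id (seq_trans t e k) ` G" "(n', m') \<in> map_prod id (seq_trans t e k) ` G"
    then obtain l l' where "(n, l) \<in> G" "(n', l') \<in> G" "m = seq_trans t e k l" "m' = seq_trans t e k l'"
      by auto
    then show "(n \<oplus>\<^bsub>N\<^esub> n', m \<oplus>\<^bsub>D (e + k)\<^esub> m') \<in> map_prod id (seq_trans t e k) ` G"
      using GD(4) mem by (intro image_eqI[of _ _ "(n \<oplus>\<^bsub>N\<^esub> n', l \<oplus>\<^bsub>D e\<^esub> l')"])
        (auto simp: mod_homD(2)[OF hom])
  next
    fix r n m
    assume r: "r \<in> carrier R" and "(n, m) \<in> map_prod id (seq_trans t e k) ` G"
    then obtain l where "(n, l) \<in> G" "m = seq_trans t e k l"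
      by auto
    then show "(r \<odot>\<^bsub>N\<^esub> n, r \<odot>\<^bsub>D (e + k)\<^esub> m) \<in> map_prod id (seq_trans t e k) ` G"
      using GD(5) mem r by (intro image_eqI[of _ _ "(r \<odot>\<^bsub>N\<^esub> n, r \<odot>\<^bsub>D e\<^esub> l)"])
        (auto simp: mod_homD(3)[OF hom])
  next
    fix n m assume "(n, m) \<in> map_prod id (seq_trans t e k) ` G"
    then show "leg (e + k) m = \<psi> n"
      using GD(6) mem by (auto simp: leg_seq_trans)
  next
    fix m assume "(\<zero>\<^bsub>N\<^esub>, m) \<in> map_prod id (seq_trans t e k) ` G"
    then show "m = \<zero>\<^bsub>D (e + k)\<^esub>"
      using GD(7) zero by auto
  qed
qed

text \<open>One more generator \<open>s\<close> can be added to the domain. Choose a preimage \<open>y\<close> of \<open>\<psi> s\<close>. The only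
  obstruction to sending \<open>s\<close> to \<open>y\<close> lies in the scalars \<open>r\<close> for which \<open>r s\<close> is already in the domain:
  there \<open>r y\<close> has to be the prescribed value. These scalars form an ideal, finitely generated since
  \<open>R\<close> is noetherian. On each generator of the ideal the prescribed value and \<open>r y\<close> have the same image
  in the limit, so they become equal at a later level; at a common later level they agree on the
  whole ideal.\<close>

lemma partial_lift_extend:
  assumes noeth: "noetherian_ring R" and N: "module R N" and \<psi>: "\<psi> \<in> mod_hom R N Lim"
    and G: "partial_lift N \<psi> e G" and s: "s \<in> carrier N"
  shows "\<exists>e' G'. partial_lift N \<psi> e' G' \<and> insert s (fst ` G) \<subseteq> fst ` G'"
proof -
  interpret N: module R N by fact
  interpret Lim: module R Lim by (rule Lim_module)
  \<comment> \<open>Raise the level so that \<open>\<psi> s\<close> has a preimage there.\<close>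
  obtain i y0 where y0: "y0 \<in> carrier (D i)" "\<psi> s = leg i y0"
    using exhaust[of "\<psi> s"] mod_homD(1)[OF \<psi> s] by blast
  define d where "d = e + i"
  define y where "y = seq_trans t i e y0"
  have y: "y \<in> carrier (D d)" "leg d y = \<psi> s"
    using mod_homD(1)[OF seq_trans_hom y0(1), of e] leg_seq_trans[OF y0(1), of e] y0(2)
    by (simp_all add: d_def y_def add.commute)
  define H where "H = map_prod id (seq_trans t e i) ` G"
  have H: "partial_lift N \<psi> d H"
    unfolding H_def d_def by (rule partial_lift_raise) fact
  note HD = partial_liftD[OF H] and H_mem = partial_liftD(1,2)[OF H]
  interpret Dd: module R "D d" by (rule D_module)
  define I where "I = {r \<in> carrier R. \<exists>m. (r \<odot>\<^bsub>N\<^esub> s, m) \<in> H}"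
  have "ideal I R"
  proof (rule ideal_closedI[OF N.R.is_cring])
    show "\<zero>\<^bsub>R\<^esub> \<in> I" using HD(3) s by (auto simp: I_def)
  next
    fix a b assume "a \<in> I" "b \<in> I"
    then show "a \<oplus>\<^bsub>R\<^esub> b \<in> I" using HD(4) s by (fastforce simp: I_def N.smult_l_distr)
  next
    fix a b assume "a \<in> carrier R" "b \<in> I"
    then show "a \<otimes>\<^bsub>R\<^esub> b \<in> I" using HD(5) s by (fastforce simp: I_def N.smult_assoc1)
  qed (auto simp: I_def)
  then obtain A where A: "A \<subseteq> carrier R" "finite A" "I = Idl\<^bsub>R\<^esub> A"
    using noetherian_ring.finetely_gen[OF noeth] by blast
  have "\<forall>a \<in> A. \<forall>\<^sub>F k in sequentially. \<exists>m. (a \<odot>\<^bsub>N\<^esub> s, m) \<in> H \<and>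
      seq_trans t d k m = seq_trans t d k (a \<odot>\<^bsub>D d\<^esub> y)"
  proof
    fix a assume "a \<in> A"
    then have "a \<in> I" using A N.R.genideal_self by blast
    then obtain m where a: "a \<in> carrier R" and m: "(a \<odot>\<^bsub>N\<^esub> s, m) \<in> H"
      by (auto simp: I_def)
    have "leg d m = leg d (a \<odot>\<^bsub>D d\<^esub> y)"
      using HD(6)[OF m] a s y by (simp add: mod_homD(3)[OF \<psi>] mod_homD(3)[OF leg_hom])
    then obtain k where k: "seq_trans t d k m = seq_trans t d k (a \<odot>\<^bsub>D d\<^esub> y)"
      using leg_eq_imp[of m d "a \<odot>\<^bsub>D d\<^esub> y"] H_mem m a y by auto
    have "seq_trans t d (k + l) m = seq_trans t d (k + l) (a \<odot>\<^bsub>D d\<^esub> y)" for l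
      by (simp add: seq_trans_add k)
    with m show "\<forall>\<^sub>F k in sequentially. \<exists>m. (a \<odot>\<^bsub>N\<^esub> s, m) \<in> H \<and>
        seq_trans t d k m = seq_trans t d k (a \<odot>\<^bsub>D d\<^esub> y)"
      unfolding eventually_sequentially by (metis le_Suc_ex)
  qed
  then have "\<forall>\<^sub>F k in sequentially. \<forall>a \<in> A. \<exists>m. (a \<odot>\<^bsub>N\<^esub> s, m) \<in> H \<and>
      seq_trans t d k m = seq_trans t d k (a \<odot>\<^bsub>D d\<^esub> y)"
    using A(2) by (simp add: eventually_ball_finite)
  then obtain k where k: "\<forall>a \<in> A. \<exists>m. (a \<odot>\<^bsub>N\<^esub> s, m) \<in> H \<and>
      seq_trans t d k m = seq_trans t d k (a \<odot>\<^bsub>D d\<^esub> y)"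
    by (auto simp: eventually_sequentially)
  define z where "z = seq_trans t d k y"
  define L where "L = map_prod id (seq_trans t d k) ` H"
  have z: "z \<in> carrier (D (d + k))" "leg (d + k) z = \<psi> s"
    using mod_homD(1)[OF seq_trans_hom y(1)] leg_seq_trans[OF y(1)] y(2) by (simp_all add: z_def)
  have L: "partial_lift N \<psi> (d + k) L"
    unfolding L_def by (rule partial_lift_raise) fact
  note LD = partial_liftD[OF L] and L_mem = partial_liftD(1,2)[OF L]
  interpret Dz: module R "D (d + k)" by (rule D_module)
  \<comment> \<open>The scalars \<open>r\<close> for which the graph raised to level \<open>d + k\<close> already sends \<open>r s\<close> to \<open>r z\<close>.\<close>
  define J where "J = {r \<in> carrier R. (r \<odot>\<^bsub>N\<^esub> s, r \<odot>\<^bsub>D (d + k)\<^esub> z) \<in> L}"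
  have "ideal J R"
  proof (rule ideal_closedI[OF N.R.is_cring])
    show "\<zero>\<^bsub>R\<^esub> \<in> J" using LD(3) s z by (simp add: J_def)
  next
    fix a b assume "a \<in> J" "b \<in> J"
    then show "a \<oplus>\<^bsub>R\<^esub> b \<in> J" using LD(4) s z by (auto simp: J_def N.smult_l_distr Dz.smult_l_distr)
  next
    fix a b assume "a \<in> carrier R" "b \<in> J"
    then show "a \<otimes>\<^bsub>R\<^esub> b \<in> J" using LD(5) s z by (auto simp: J_def N.smult_assoc1 Dz.smult_assoc1)
  qed (auto simp: J_def)
  moreover have "A \<subseteq> J"
  proof
    fix a assume "a \<in> A"
    then have a: "a \<in> carrier R" using A by auto
    obtain m where m: "(a \<odot>\<^bsub>N\<^esub> s, m) \<in> H" "seq_trans t d k m = seq_trans t d k (a \<odot>\<^bsub>D d\<^esub> y)"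
      using k \<open>a \<in> A\<close> by blast
    have "seq_trans t d k m = a \<odot>\<^bsub>D (d + k)\<^esub> z"
      using m(2) a y by (simp add: z_def mod_homD(3)[OF seq_trans_hom])
    with m(1) have "(a \<odot>\<^bsub>N\<^esub> s, a \<odot>\<^bsub>D (d + k)\<^esub> z) \<in> L"
      unfolding L_def by (intro image_eqI[of _ _ "(a \<odot>\<^bsub>N\<^esub> s, m)"]) auto
    with a show "a \<in> J" by (simp add: J_def)
  qed
  ultimately have "I \<subseteq> J"
    unfolding A(3) by (rule N.R.genideal_minimal)
  have overlap: "(r \<odot>\<^bsub>N\<^esub> s, r \<odot>\<^bsub>D (d + k)\<^esub> z) \<in> L"
    if "r \<in> carrier R" "(r \<odot>\<^bsub>N\<^esub> s, m) \<in> L" for r m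
  proof -
    have "r \<in> I" using that by (auto simp: I_def L_def)
    with \<open>I \<subseteq> J\<close> show ?thesis by (auto simp: J_def)
  qed
  \<comment> \<open>The sum of the old graph and the graph of \<open>r s \<mapsto> r z\<close>; it is single-valued because the two
    agree on the overlap of their domains.\<close>
  define G' where "G' = {(n \<oplus>\<^bsub>N\<^esub> r \<odot>\<^bsub>N\<^esub> s, m \<oplus>\<^bsub>D (d + k)\<^esub> r \<odot>\<^bsub>D (d + k)\<^esub> z) | n m r.
    (n, m) \<in> L \<and> r \<in> carrier R}"
  have G'I: "(n', m') \<in> G'" if "(n, m) \<in> L" "r \<in> carrier R" "n' = n \<oplus>\<^bsub>N\<^esub> r \<odot>\<^bsub>N\<^esub> s"
    "m' = m \<oplus>\<^bsub>D (d + k)\<^esub> r \<odot>\<^bsub>D (d + k)\<^esub> z" for n m r n' m'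
    unfolding G'_def using that by blast
  have zero: "(\<zero>\<^bsub>N\<^esub>, \<zero>\<^bsub>D (d + k)\<^esub>) \<in> L" by (rule LD(3))
  have "partial_lift N \<psi> (d + k) G'"
    unfolding partial_lift_def
  proof (intro conjI allI impI)
    show "G' \<subseteq> carrier N \<times> carrier (D (d + k))"
      using L_mem s z by (auto simp: G'_def)
    show "(\<zero>\<^bsub>N\<^esub>, \<zero>\<^bsub>D (d + k)\<^esub>) \<in> G'"
      using s z by (intro G'I[OF zero N.R.zero_closed]) simp_all
  next
    fix n m n' m' assume "(n, m) \<in> G'" "(n', m') \<in> G'"
    then obtain a b r a' b' r' where ab: "(a, b) \<in> L" "(a', b') \<in> L" "r \<in> carrier R" "r' \<in> carrier R"
      and eq: "n = a \<oplus>\<^bsub>N\<^esub> r \<odot>\<^bsub>N\<^esub> s" "m = b \<oplus>\<^bsub>D (d + k)\<^esub> r \<odot>\<^bsub>D (d + k)\<^esub> z"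
      "n' = a' \<oplus>\<^bsub>N\<^esub> r' \<odot>\<^bsub>N\<^esub> s" "m' = b' \<oplus>\<^bsub>D (d + k)\<^esub> r' \<odot>\<^bsub>D (d + k)\<^esub> z"
      unfolding G'_def by blast
    have "(a \<oplus>\<^bsub>N\<^esub> a', b \<oplus>\<^bsub>D (d + k)\<^esub> b') \<in> L" using LD(4) ab by blast
    then show "(n \<oplus>\<^bsub>N\<^esub> n', m \<oplus>\<^bsub>D (d + k)\<^esub> m') \<in> G'"
      by (rule G'I[of _ _ "r \<oplus>\<^bsub>R\<^esub> r'"]) (use ab L_mem[OF ab(1)] L_mem[OF ab(2)] s z in
          \<open>simp_all add: eq N.smult_l_distr Dz.smult_l_distr N.M.a_ac Dz.M.a_ac\<close>)
  next
    fix q n m assume q: "q \<in> carrier R" and "(n, m) \<in> G'"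
    then obtain a b r where ab: "(a, b) \<in> L" "r \<in> carrier R"
      and eq: "n = a \<oplus>\<^bsub>N\<^esub> r \<odot>\<^bsub>N\<^esub> s" "m = b \<oplus>\<^bsub>D (d + k)\<^esub> r \<odot>\<^bsub>D (d + k)\<^esub> z"
      unfolding G'_def by blast
    have "(q \<odot>\<^bsub>N\<^esub> a, q \<odot>\<^bsub>D (d + k)\<^esub> b) \<in> L" using LD(5) ab q by blast
    then show "(q \<odot>\<^bsub>N\<^esub> n, q \<odot>\<^bsub>D (d + k)\<^esub> m) \<in> G'"
      by (rule G'I[of _ _ "q \<otimes>\<^bsub>R\<^esub> r"]) (use ab L_mem[OF ab(1)] s z q in
          \<open>simp_all add: eq N.smult_r_distr Dz.smult_r_distr N.smult_assoc1 Dz.smult_assoc1\<close>)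
  next
    fix n m assume "(n, m) \<in> G'"
    then obtain a b r where ab: "(a, b) \<in> L" "r \<in> carrier R"
      and eq: "n = a \<oplus>\<^bsub>N\<^esub> r \<odot>\<^bsub>N\<^esub> s" "m = b \<oplus>\<^bsub>D (d + k)\<^esub> r \<odot>\<^bsub>D (d + k)\<^esub> z"
      unfolding G'_def by blast
    have "leg (d + k) b = \<psi> a" using LD(6) ab by blast
    then show "leg (d + k) m = \<psi> n"
      using ab L_mem[OF ab(1)] s z
      by (simp add: eq mod_homD(2,3)[OF \<psi>] mod_homD(2,3)[OF leg_hom])
  next
    fix m assume "(\<zero>\<^bsub>N\<^esub>, m) \<in> G'"
    then obtain a b r where ab: "(a, b) \<in> L" "r \<in> carrier R"
      and eq: "\<zero>\<^bsub>N\<^esub> = a \<oplus>\<^bsub>N\<^esub> r \<odot>\<^bsub>N\<^esub> s" "m = b \<oplus>\<^bsub>D (d + k)\<^esub> r \<odot>\<^bsub>D (d + k)\<^esub> z"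
      unfolding G'_def by blast
    note mem = L_mem[OF ab(1)]
    have "r \<odot>\<^bsub>N\<^esub> s = \<ominus>\<^bsub>N\<^esub> a"
      using eq(1) mem s ab by (metis N.M.a_comm N.M.minus_equality N.smult_closed)
    also have "\<dots> = (\<ominus>\<^bsub>R\<^esub> \<one>\<^bsub>R\<^esub>) \<odot>\<^bsub>N\<^esub> a"
      using mem by (simp add: N.smult_l_minus)
    finally have "(r \<odot>\<^bsub>N\<^esub> s, (\<ominus>\<^bsub>R\<^esub> \<one>\<^bsub>R\<^esub>) \<odot>\<^bsub>D (d + k)\<^esub> b) \<in> L"
      using LD(5)[OF _ ab(1), of "\<ominus>\<^bsub>R\<^esub> \<one>\<^bsub>R\<^esub>"] by simp
    then have "(r \<odot>\<^bsub>N\<^esub> s, r \<odot>\<^bsub>D (d + k)\<^esub> z) \<in> L"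
      by (rule overlap[OF ab(2)])
    then have "(\<zero>\<^bsub>N\<^esub>, m) \<in> L"
      unfolding eq using LD(4) ab by blast
    then show "m = \<zero>\<^bsub>D (d + k)\<^esub>" by (rule LD(7))
  qed
  moreover have "fst ` G \<subseteq> fst ` G'"
  proof
    fix n assume "n \<in> fst ` G"
    then obtain m where nm: "(n, m) \<in> L" by (force simp: L_def H_def)
    have "(n, m) \<in> G'"
      using L_mem[OF nm] s z by (intro G'I[OF nm N.R.zero_closed]) simp_all
    then show "n \<in> fst ` G'" by force
  qed
  moreover have "(s, z) \<in> G'"
    using s z by (intro G'I[OF zero N.R.one_closed]) simp_all
  then have "s \<in> fst ` G'" by force
  ultimately show ?thesis by blast
qed

text \<open>A finitely generated module over a noetherian ring is finitely presented, so a map to a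
  direct limit factors through some level. Starting from the zero submodule, the lift is extended
  along a finite set of generators.\<close>

lemma fin_gen_hom_lift:
  assumes noeth: "noetherian_ring R" and N: "fin_gen_module R N" and \<psi>: "\<psi> \<in> mod_hom R N Lim"
  shows "\<exists>e g. g \<in> mod_hom R N (D e) \<and> (\<forall>x \<in> carrier N. leg e (g x) = \<psi> x)"
proof -
  have N': "module R N" using N by (simp add: fin_gen_module_def)
  interpret N: module R N by fact
  obtain S where S: "S \<subseteq> carrier N" "finite S"
    "\<And>H. submodule H R N \<Longrightarrow> S \<subseteq> H \<Longrightarrow> carrier N \<subseteq> H"
    using fin_gen_module_obtain[OF N] by metis
  have "\<exists>e G. partial_lift N \<psi> e G \<and> T \<subseteq> fst ` G" if "finite T" "T \<subseteq> S" for T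
    using that
  proof (induction T)
    case empty
    interpret D0: module R "D 0" by (rule D_module)
    have "partial_lift N \<psi> 0 {(\<zero>\<^bsub>N\<^esub>, \<zero>\<^bsub>D 0\<^esub>)}"
      by (simp add: partial_lift_def mod_hom_zero[OF N' Lim_module \<psi>]
          mod_hom_zero[OF D_module Lim_module leg_hom])
    then show ?case by blast
  next
    case (insert s T)
    then obtain e G where "partial_lift N \<psi> e G" "T \<subseteq> fst ` G" by auto
    with partial_lift_extend[OF noeth N' \<psi> this(1), of s] insert S(1) show ?case
      by (meson insert_subset order_trans subsetD)
  qed
  then obtain e G where G: "partial_lift N \<psi> e G" and SG: "S \<subseteq> fst ` G"
    using S(2) by blast
  note GD = partial_liftD[OF G] and G_mem = partial_liftD(1,2)[OF G]
  interpret De: module R "D e" by (rule D_module)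
  have "submodule (fst ` G) R N"
  proof (rule submodule_closedI[OF N'])
    show "fst ` G \<subseteq> carrier N" using G_mem by auto
    show "\<zero>\<^bsub>N\<^esub> \<in> fst ` G" using GD(3) by force
  next
    fix x y assume "x \<in> fst ` G" "y \<in> fst ` G"
    then obtain m n where "(x, m) \<in> G" "(y, n) \<in> G" by force
    then have "(x \<oplus>\<^bsub>N\<^esub> y, m \<oplus>\<^bsub>D e\<^esub> n) \<in> G" using GD(4) by blast
    then show "x \<oplus>\<^bsub>N\<^esub> y \<in> fst ` G" by force
  next
    fix r x assume r: "r \<in> carrier R" and "x \<in> fst ` G"
    then obtain m where "(x, m) \<in> G" by force
    then have "(r \<odot>\<^bsub>N\<^esub> x, r \<odot>\<^bsub>D e\<^esub> m) \<in> G" using GD(5) r by blast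
    then show "r \<odot>\<^bsub>N\<^esub> x \<in> fst ` G" by force
  qed
  then have total: "\<exists>m. (n, m) \<in> G" if "n \<in> carrier N" for n
    using S(3) SG that by fastforce
  have unique: "m = m'" if nm: "(n, m) \<in> G" "(n, m') \<in> G" for n m m'
  proof -
    have "((\<ominus>\<^bsub>R\<^esub> \<one>\<^bsub>R\<^esub>) \<odot>\<^bsub>N\<^esub> n, (\<ominus>\<^bsub>R\<^esub> \<one>\<^bsub>R\<^esub>) \<odot>\<^bsub>D e\<^esub> m') \<in> G"
      using GD(5) nm by simp
    then have "(\<ominus>\<^bsub>N\<^esub> n, \<ominus>\<^bsub>D e\<^esub> m') \<in> G"
      using G_mem nm by (simp add: N.smult_l_minus De.smult_l_minus)
    then have "(n \<oplus>\<^bsub>N\<^esub> \<ominus>\<^bsub>N\<^esub> n, m \<oplus>\<^bsub>D e\<^esub> \<ominus>\<^bsub>D e\<^esub> m') \<in> G"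
      using GD(4) nm by blast
    then have "(\<zero>\<^bsub>N\<^esub>, m \<oplus>\<^bsub>D e\<^esub> \<ominus>\<^bsub>D e\<^esub> m') \<in> G"
      using G_mem nm by (simp add: N.M.r_neg)
    then have "m \<oplus>\<^bsub>D e\<^esub> \<ominus>\<^bsub>D e\<^esub> m' = \<zero>\<^bsub>D e\<^esub>"
      by (rule GD(7))
    then have "\<ominus>\<^bsub>D e\<^esub> (\<ominus>\<^bsub>D e\<^esub> m') = m"
      by (rule De.M.minus_equality) (use G_mem nm in auto)
    then show ?thesis using G_mem nm by simp
  qed
  define g where "g n = (SOME m. (n, m) \<in> G)" for n
  have g: "(n, g n) \<in> G" if "n \<in> carrier N" for n
    unfolding g_def using total[OF that] by (rule someI_ex)
  have "g \<in> mod_hom R N (D e)"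
  proof (rule mod_homI)
    fix x assume x: "x \<in> carrier N"
    then show "g x \<in> carrier (D e)" using g G_mem by blast
    show "g (x \<oplus>\<^bsub>N\<^esub> y) = g x \<oplus>\<^bsub>D e\<^esub> g y" if "y \<in> carrier N" for y
    proof (rule unique)
      show "(x \<oplus>\<^bsub>N\<^esub> y, g (x \<oplus>\<^bsub>N\<^esub> y)) \<in> G" using x that by (intro g) simp
      show "(x \<oplus>\<^bsub>N\<^esub> y, g x \<oplus>\<^bsub>D e\<^esub> g y) \<in> G" using g[OF x] g[OF that] by (rule GD(4))
    qed
    show "g (r \<odot>\<^bsub>N\<^esub> x) = r \<odot>\<^bsub>D e\<^esub> g x" if "r \<in> carrier R" for r
    proof (rule unique)
      show "(r \<odot>\<^bsub>N\<^esub> x, g (r \<odot>\<^bsub>N\<^esub> x)) \<in> G" using x that by (intro g) simp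
      show "(r \<odot>\<^bsub>N\<^esub> x, r \<odot>\<^bsub>D e\<^esub> g x) \<in> G" using that g[OF x] by (rule GD(5))
    qed
  qed
  moreover have "leg e (g x) = \<psi> x" if "x \<in> carrier N" for x
    using g[OF that] by (rule GD(6))
  ultimately show ?thesis by blast
qed

end

section \<open>Generating morphisms as cones\<close>

lemma frob_map_id:
  assumes "module R M" "x \<in> carrier (frob R p M)"
  shows "frob_map R p M (\<lambda>x. x) x = x"
proof -
  interpret M: frob_module R M p by (rule frob_moduleI) fact
  have "(\<lambda>x. x) \<in> mod_hom R M M" by (rule mod_homI) auto
  note F = frob_map_additive[OF assms(1,1) this]
  show ?thesis
    using assms(2) by (induction rule: M.frob_induct) (simp_all add: F)
qed

lemma gen_trans_code:
  assumes "x \<in> carrier (frob R p (frob_pow R p M e))"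
  shows "gen_trans R p M \<beta> (Suc e) (frob_code R p (frob_pow R p M e) x) =
    frob_code R p (frob_pow R p M (Suc e)) (frob_map R p (frob_pow R p M (Suc e)) (gen_trans R p M \<beta> e) x)"
  unfolding gen_trans_Suc by (rule frob_ft_map_code) fact

lemma frob_code_closed:
  assumes "x \<in> carrier (frob R p (frob_pow R p M e))"
  shows "frob_code R p (frob_pow R p M e) x \<in> carrier (frob_pow R p M (Suc e))"
  using assms by (simp add: carrier_frob_ft)

lemma frob_code_cases:
  assumes "y \<in> carrier (frob_pow R p M (Suc e))"
  obtains x where "x \<in> carrier (frob R p (frob_pow R p M e))" "y = frob_code R p (frob_pow R p M e) x"
  using assms by (auto simp: carrier_frob_ft)

lemma gen_module_sequence:
  assumes "module R M" "\<beta> \<in> mod_hom R M (frob R p M)"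
  shows "module_sequence R (frob_pow R p M) (gen_trans R p M \<beta>)"
  by (intro module_sequence.intro frob_pow_module gen_trans_hom assms)

text \<open>Each transition map from level \<open>e + 1\<close> on is \<open>F\<close> of the preceding one, hence by functoriality
  the same holds for their composites. This reduces questions about positive levels to applying \<open>F\<close>
  one level below.\<close>

lemma seq_trans_code:
  assumes M: "module R M" "\<beta> \<in> mod_hom R M (frob R p M)"
    and x: "x \<in> carrier (frob R p (frob_pow R p M e))"
  shows "seq_trans (gen_trans R p M \<beta>) (Suc e) k (frob_code R p (frob_pow R p M e) x) =
    frob_code R p (frob_pow R p M (e + k))
      (frob_map R p (frob_pow R p M (e + k)) (seq_trans (gen_trans R p M \<beta>) e k) x)"
proof (induction k)
  case 0
  have "seq_trans (gen_trans R p M \<beta>) e 0 = (\<lambda>x. x)" by (rule ext) simp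
  then show ?case
    using frob_map_id[OF frob_pow_module[OF M(1)] x] by simp
next
  case (Suc k)
  interpret module_sequence R "frob_pow R p M" "gen_trans R p M \<beta>"
    using M by (rule gen_module_sequence)
  let ?y = "frob_map R p (frob_pow R p M (e + k)) (seq_trans (gen_trans R p M \<beta>) e k) x"
  have y: "?y \<in> carrier (frob R p (frob_pow R p M (e + k)))"
    by (rule mod_homD(1)[OF frob_map_hom[OF D_module D_module seq_trans_hom] x])
  have step: "seq_trans (gen_trans R p M \<beta>) e (Suc k) = (\<lambda>x. gen_trans R p M \<beta> (e + k) (seq_trans (gen_trans R p M \<beta>) e k x))"
    by (rule ext) simp
  have "frob_map R p (frob_pow R p M (Suc (e + k))) (gen_trans R p M \<beta> (e + k)) ?y =
      frob_map R p (frob_pow R p M (e + Suc k)) (seq_trans (gen_trans R p M \<beta>) e (Suc k)) x"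
    using frob_map_comp[OF D_module D_module D_module seq_trans_hom t_hom x] by (simp add: step)
  then show ?case
    using Suc gen_trans_code[OF y, of \<beta>] by (simp add: step)
qed

text \<open>The F-module \<open>(\<M>, \<theta>)\<close> is a limit of \<open>M \<rightarrow> F(M) \<rightarrow> F\<^sup>2(M) \<rightarrow> \<dots>\<close> through the maps
  \<open>leg e : F\<^sup>e(M) \<rightarrow> \<M>\<close>, and \<open>\<theta>\<close> is determined by the rule that it carries \<open>leg (e + 1)\<close> to
  \<open>F(leg e)\<close>. For finitely generated \<open>M\<close> and up to the choice of the identification \<open>u\<close> this
  is the same as \<open>\<beta>\<close> being a generating morphism; unlike that notion it passes to a tail of the sequence at once.\<close>

definition frob_cone ::
    "('a, 'k) ring_scheme \<Rightarrow> nat \<Rightarrow> ('a, 'a ftree) module \<Rightarrow>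
      ('a ftree \<Rightarrow> (('a \<times> 'a ftree) \<Rightarrow>\<^sub>0 int) set) \<Rightarrow>
      ('a, 'b) module \<Rightarrow> ('b \<Rightarrow> (('a \<times> 'b) \<Rightarrow>\<^sub>0 int) set) \<Rightarrow> (nat \<Rightarrow> 'a ftree \<Rightarrow> 'b) \<Rightarrow> bool" where
  "frob_cone R p M \<beta> \<M> \<theta> leg \<longleftrightarrow>
     limit_cone R (frob_pow R p M) (gen_trans R p M \<beta>) \<M> leg \<and>
     (\<forall>e. \<forall>x \<in> carrier (frob R p (frob_pow R p M e)).
        \<theta> (leg (Suc e) (frob_code R p (frob_pow R p M e) x)) = frob_map R p \<M> (leg e) x)"

text \<open>The description by \<open>THE\<close> of the structure map is unambiguous: two representatives of a class
  in positive levels become equal at some level \<open>m + 1\<close>, where the injectivity of the code shows that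
  their decodings have the same image in \<open>F(F\<^sup>m(M))\<close>, and \<open>F\<close> of the legs factors through this
  module.\<close>

lemma gen_lim_frob_cone:
  assumes M: "module R M" "\<beta> \<in> mod_hom R M (frob R p M)"
  shows "frob_cone R p M \<beta> (gen_lim R p M \<beta>) (gen_lim_struct R p M \<beta>)
    (dirlim_in (frob_pow R p M) (gen_trans R p M \<beta>))"
proof -
  let ?M = "frob_pow R p M" and ?L = "gen_lim R p M \<beta>"
  interpret module_sequence R ?M "gen_trans R p M \<beta>"
    using M by (rule gen_module_sequence)
  let ?i = "dirlim_in ?M (gen_trans R p M \<beta>)" and ?s = "seq_trans (gen_trans R p M \<beta>)"
  have lim: "limit_cone R ?M (gen_trans R p M \<beta>) ?L ?i"
    unfolding gen_lim_def by (rule dirlim_limit_cone)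
  interpret lim: limit_cone R ?M "gen_trans R p M \<beta>" ?L ?i by (rule lim)
  have raise: "frob_map R p ?L (?i e) x = frob_map R p ?L (?i (e + k)) (frob_map R p (?M (e + k)) (?s e k) x)"
    if x: "x \<in> carrier (frob R p (?M e))" for e k x
  proof -
    have "frob_map R p ?L (?i (e + k)) (frob_map R p (?M (e + k)) (?s e k) x) =
        frob_map R p ?L (\<lambda>x. ?i (e + k) (?s e k x)) x"
      by (rule frob_map_comp[OF D_module D_module lim.Lim_module seq_trans_hom lim.leg_hom x])
    also have "\<dots> = frob_map R p ?L (?i e) x"
      by (rule frob_map_cong[OF D_module lim.Lim_module mod_hom_comp[OF seq_trans_hom lim.leg_hom]
            lim.leg_hom lim.leg_seq_trans x])
    finally show ?thesis ..
  qed
  have "gen_lim_struct R p M \<beta> (?i (Suc e) (frob_code R p (?M e) x)) = frob_map R p ?L (?i e) x"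
    if x: "x \<in> carrier (frob R p (?M e))" for e x
    unfolding gen_lim_struct_def
  proof (rule the_equality)
    show "\<exists>d y. y \<in> carrier (frob R p (?M d)) \<and>
        (Suc d, frob_code R p (?M d) y) \<in> ?i (Suc e) (frob_code R p (?M e) x) \<and>
        frob_map R p ?L (?i e) x = frob_map R p ?L (?i d) y"
      using x frob_code_closed[OF x] unfolding mem_dirlim_in by blast
  next
    fix z assume "\<exists>d y. y \<in> carrier (frob R p (?M d)) \<and>
        (Suc d, frob_code R p (?M d) y) \<in> ?i (Suc e) (frob_code R p (?M e) x) \<and>
        z = frob_map R p ?L (?i d) y"
    then obtain d y where y: "y \<in> carrier (frob R p (?M d))" and z: "z = frob_map R p ?L (?i d) y"
      and eq: "?i (Suc d) (frob_code R p (?M d) y) = ?i (Suc e) (frob_code R p (?M e) x)"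
      unfolding mem_dirlim_in by blast
    obtain n where n: "Suc d \<le> n" "Suc e \<le> n"
      "?s (Suc d) (n - Suc d) (frob_code R p (?M d) y) = ?s (Suc e) (n - Suc e) (frob_code R p (?M e) x)"
      using eq unfolding dirlim_in_eq_iff[OF frob_code_closed[OF y]] eventually_seq_trans_eq_iff by blast
    \<comment> \<open>Level \<open>n > 0\<close> of the sequence is the encoded copy of \<open>F\<close> applied to level \<open>n - 1\<close>.\<close>
    define m where "m = n - 1"
    have m: "n - Suc d = m - d" "n - Suc e = m - e" "d + (m - d) = m" "e + (m - e) = m"
      using n by (auto simp: m_def)
    let ?y = "frob_map R p (?M m) (?s d (m - d)) y" and ?x = "frob_map R p (?M m) (?s e (m - e)) x"
    have "frob_code R p (?M m) ?y = frob_code R p (?M m) ?x"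
      using n(3) seq_trans_code[OF M y, of "m - d"] seq_trans_code[OF M x, of "m - e"]
      by (simp add: m)
    moreover have "?y \<in> carrier (frob R p (?M m))" "?x \<in> carrier (frob R p (?M m))"
      using mod_homD(1)[OF frob_map_hom[OF D_module D_module seq_trans_hom] y, of "m - d"]
        mod_homD(1)[OF frob_map_hom[OF D_module D_module seq_trans_hom] x, of "m - e"]
      by (simp_all add: m)
    ultimately have "?y = ?x"
      by (rule inj_onD[OF inj_frob_code])
    then show "z = frob_map R p ?L (?i e) x"
      using raise[OF y, of "m - d"] raise[OF x, of "m - e"] by (simp add: z m)
  qed
  with lim show ?thesis
    unfolding frob_cone_def by blast
qed

lemma generating_morphism_frob_cone:
  assumes gen: "generating_morphism R p M \<beta> \<M> \<theta> u" and \<M>: "module R \<M>"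
  shows "frob_cone R p M \<beta> \<M> \<theta> (\<lambda>i x. u (dirlim_in (frob_pow R p M) (gen_trans R p M \<beta>) i x))"
proof -
  let ?M = "frob_pow R p M" and ?L = "gen_lim R p M \<beta>"
  let ?i = "dirlim_in ?M (gen_trans R p M \<beta>)"
  have M: "module R M" "\<beta> \<in> mod_hom R M (frob R p M)"
    using gen by (auto simp: generating_morphism_def D_obj_def fin_gen_module_def)
  have u: "u \<in> mod_hom R ?L \<M>" "bij_betw u (carrier ?L) (carrier \<M>)"
    and u_struct: "\<And>A. A \<in> carrier ?L \<Longrightarrow> \<theta> (u A) = frob_map R p \<M> u (gen_lim_struct R p M \<beta> A)"
    using gen by (auto simp: generating_morphism_def F_iso_def F_hom_def)
  interpret L: limit_cone R ?M "gen_trans R p M \<beta>" ?L ?i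
    using gen_lim_frob_cone[OF M] by (simp add: frob_cone_def)
  have i_closed: "?i i x \<in> carrier ?L" if "x \<in> carrier (?M i)" for i x
    by (rule mod_homD(1)[OF L.leg_hom that])
  have inj: "A = B" if "u A = u B" "A \<in> carrier ?L" "B \<in> carrier ?L" for A B
    using u(2) that by (auto simp: bij_betw_def dest: inj_onD)
  have "limit_cone R ?M (gen_trans R p M \<beta>) \<M> (\<lambda>i x. u (?i i x))"
  proof (intro limit_cone.intro limit_cone_axioms.intro)
    show "module_sequence R ?M (gen_trans R p M \<beta>)" by (rule L.module_sequence_axioms)
    show "module R \<M>" by fact
    show "(\<lambda>x. u (?i i x)) \<in> mod_hom R (?M i) \<M>" for i
      by (rule mod_hom_comp[OF L.leg_hom u(1)])
    show "u (?i (Suc i) (gen_trans R p M \<beta> i x)) = u (?i i x)" if "x \<in> carrier (?M i)" for i x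
      using L.leg_step[OF that] by simp
    show "\<exists>i. \<exists>x\<in>carrier (?M i). z = u (?i i x)" if z: "z \<in> carrier \<M>" for z
    proof -
      obtain A where "A \<in> carrier ?L" "z = u A"
        using u(2) z by (auto simp: bij_betw_def)
      then show ?thesis using L.exhaust[of A] by blast
    qed
    show "\<exists>k. seq_trans (gen_trans R p M \<beta>) i k x = \<zero>\<^bsub>?M (i + k)\<^esub>"
      if x: "x \<in> carrier (?M i)" "u (?i i x) = \<zero>\<^bsub>\<M>\<^esub>" for i x
    proof (rule L.leg_kernel[OF x(1)])
      interpret LM: module R ?L by (rule L.Lim_module)
      show "?i i x = \<zero>\<^bsub>?L\<^esub>"
        using x by (intro inj i_closed) (simp_all add: mod_hom_zero[OF L.Lim_module \<M> u(1)])
    qed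
  qed
  moreover have "\<theta> (u (?i (Suc e) (frob_code R p (?M e) x))) = frob_map R p \<M> (\<lambda>x. u (?i e x)) x"
    if x: "x \<in> carrier (frob R p (?M e))" for e x
  proof -
    have "\<theta> (u (?i (Suc e) (frob_code R p (?M e) x))) =
        frob_map R p \<M> u (gen_lim_struct R p M \<beta> (?i (Suc e) (frob_code R p (?M e) x)))"
      by (rule u_struct[OF i_closed[OF frob_code_closed[OF x]]])
    also have "\<dots> = frob_map R p \<M> u (frob_map R p ?L (?i e) x)"
      using gen_lim_frob_cone[OF M] x by (simp add: frob_cone_def)
    also have "\<dots> = frob_map R p \<M> (\<lambda>x. u (?i e x)) x"
      by (rule frob_map_comp[OF L.D_module L.Lim_module \<M> L.leg_hom u(1) x])
    finally show ?thesis .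
  qed
  ultimately show ?thesis
    unfolding frob_cone_def by blast
qed

lemma frob_cone_generating_morphism:
  assumes D: "D_obj R p M \<beta>" and cone: "frob_cone R p M \<beta> \<M> \<theta> leg"
  obtains u where "generating_morphism R p M \<beta> \<M> \<theta> u"
    and "\<And>i x. x \<in> carrier (frob_pow R p M i) \<Longrightarrow>
      u (dirlim_in (frob_pow R p M) (gen_trans R p M \<beta>) i x) = leg i x"
proof -
  let ?M = "frob_pow R p M" and ?L = "gen_lim R p M \<beta>"
  let ?i = "dirlim_in ?M (gen_trans R p M \<beta>)"
  have M: "module R M" "\<beta> \<in> mod_hom R M (frob R p M)"
    using D by (auto simp: D_obj_def fin_gen_module_def)
  interpret L: limit_cone R ?M "gen_trans R p M \<beta>" ?L ?i
    using gen_lim_frob_cone[OF M] by (simp add: frob_cone_def)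
  interpret C: limit_cone R ?M "gen_trans R p M \<beta>" \<M> leg
    using cone by (simp add: frob_cone_def)
  obtain u where u: "u \<in> mod_iso R ?L \<M>"
    and u_in: "\<And>i x. x \<in> carrier (?M i) \<Longrightarrow> u (?i i x) = leg i x"
    using C.comparison_iso unfolding gen_lim_def by blast
  have u_hom: "u \<in> mod_hom R ?L \<M>" using u by (simp add: mod_iso_def)
  have "\<theta> (u A) = frob_map R p \<M> u (gen_lim_struct R p M \<beta> A)" if A: "A \<in> carrier ?L" for A
  proof -
    obtain i y where y: "y \<in> carrier (?M i)" "A = ?i i y"
      using L.exhaust[OF A] by blast
    \<comment> \<open>Every class has a representative at a positive level, where it comes from \<open>F(F\<^sup>i(M))\<close>.\<close>
    have "A = ?i (Suc i) (gen_trans R p M \<beta> i y)"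
      using L.leg_step[OF y(1)] y(2) by simp
    moreover have "gen_trans R p M \<beta> i y \<in> carrier (?M (Suc i))"
      by (rule mod_homD(1)[OF L.t_hom y(1)])
    ultimately obtain x where x: "x \<in> carrier (frob R p (?M i))" "A = ?i (Suc i) (frob_code R p (?M i) x)"
      by (metis frob_code_cases)
    have "frob_map R p \<M> u (gen_lim_struct R p M \<beta> A) = frob_map R p \<M> u (frob_map R p ?L (?i i) x)"
      using gen_lim_frob_cone[OF M] x by (simp add: frob_cone_def)
    also have "\<dots> = frob_map R p \<M> (\<lambda>x. u (?i i x)) x"
      by (rule frob_map_comp[OF L.D_module L.Lim_module C.Lim_module L.leg_hom u_hom x(1)])
    also have "\<dots> = frob_map R p \<M> (leg i) x"
      by (rule frob_map_cong[OF L.D_module C.Lim_module mod_hom_comp[OF L.leg_hom u_hom] C.leg_hom u_in x(1)])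
    also have "\<dots> = \<theta> (leg (Suc i) (frob_code R p (?M i) x))"
      using cone x(1) by (simp add: frob_cone_def)
    also have "\<dots> = \<theta> (u A)"
      using u_in[OF frob_code_closed[OF x(1)]] x(2) by simp
    finally show ?thesis ..
  qed
  then have "generating_morphism R p M \<beta> \<M> \<theta> u"
    using D u by (simp add: generating_morphism_def F_iso_def F_hom_def mod_iso_def)
  with u_in that show ?thesis by blast
qed

lemma frob_cone_shift:
  assumes "frob_cone R p M \<beta> \<M> \<theta> leg"
  shows "frob_cone R p (frob_pow R p M e) (frob_pow_struct R p M \<beta> e) \<M> \<theta> (\<lambda>i. leg (e + i))"
proof -
  have "frob_pow R p (frob_pow R p M e) = (\<lambda>i. frob_pow R p M (e + i))"
    "gen_trans R p (frob_pow R p M e) (frob_pow_struct R p M \<beta> e) = (\<lambda>i. gen_trans R p M \<beta> (e + i))"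
    by (simp_all add: fun_eq_iff frob_pow_add gen_trans_shift)
  with assms show ?thesis
    unfolding frob_cone_def by (auto intro: limit_cone.limit_cone_shift)
qed

section \<open>Morphisms of F-finite modules\<close>

text \<open>A morphism of F-modules is determined by its effect on the image of \<open>N\<close>: if \<open>g\<close> induces \<open>\<phi>\<close>
  at level \<open>i\<close>, applying \<open>F\<close> and comparing the structure maps shows that \<open>F(F\<^sup>i(g))\<close> induces \<open>\<phi>\<close> at
  level \<open>i + 1\<close>, as \<open>\<theta>M\<close> is injective.\<close>

lemma F_hom_on_cones:
  assumes N: "frob_cone R p N \<beta> \<N> \<theta>N legN" and M: "frob_cone R p M \<gamma> \<M> \<theta>M legM"
    and \<theta>M: "inj_on \<theta>M (carrier \<M>)" and \<phi>: "\<phi> \<in> F_hom R p \<N> \<theta>N \<M> \<theta>M"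
    and g: "g \<in> mod_hom R N M" and base: "\<And>x. x \<in> carrier N \<Longrightarrow> legM 0 (g x) = \<phi> (legN 0 x)"
    and x: "x \<in> carrier (frob_pow R p N i)"
  shows "legM i (frob_pow_map R p N M g i x) = \<phi> (legN i x)"
  using x
proof (induction i arbitrary: x)
  case 0
  then show ?case using base by simp
next
  case (Suc i)
  let ?N = "frob_pow R p N" and ?M = "frob_pow R p M" and ?g = "frob_pow_map R p N M g"
  interpret N: limit_cone R ?N "gen_trans R p N \<beta>" \<N> legN using N by (simp add: frob_cone_def)
  interpret M: limit_cone R ?M "gen_trans R p M \<gamma>" \<M> legM using M by (simp add: frob_cone_def)
  have \<phi>_hom: "\<phi> \<in> mod_hom R \<N> \<M>"
    and \<phi>_struct: "\<And>x. x \<in> carrier \<N> \<Longrightarrow> \<theta>M (\<phi> x) = frob_map R p \<M> \<phi> (\<theta>N x)"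
    using \<phi> by (auto simp: F_hom_def)
  have g_hom: "?g j \<in> mod_hom R (?N j) (?M j)" for j
    using frob_pow_map_hom[OF N.D_module[of 0, simplified] M.D_module[of 0, simplified] g] .
  obtain y where y: "y \<in> carrier (frob R p (?N i))" "x = frob_code R p (?N i) y"
    using Suc.prems by (rule frob_code_cases)
  have gy: "frob_map R p (?M i) (?g i) y \<in> carrier (frob R p (?M i))"
    by (rule mod_homD(1)[OF frob_map_hom[OF N.D_module M.D_module g_hom] y(1)])
  have "\<theta>M (legM (Suc i) (?g (Suc i) x)) =
      \<theta>M (legM (Suc i) (frob_code R p (?M i) (frob_map R p (?M i) (?g i) y)))"
    using frob_ft_map_code[OF y(1)] by (simp add: y(2))
  also have "\<dots> = frob_map R p \<M> (legM i) (frob_map R p (?M i) (?g i) y)"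
    using M gy by (simp add: frob_cone_def)
  also have "\<dots> = frob_map R p \<M> (\<lambda>x. legM i (?g i x)) y"
    by (rule frob_map_comp[OF N.D_module M.D_module M.Lim_module g_hom M.leg_hom y(1)])
  also have "\<dots> = frob_map R p \<M> (\<lambda>x. \<phi> (legN i x)) y"
    by (rule frob_map_cong[OF N.D_module M.Lim_module mod_hom_comp[OF g_hom M.leg_hom]
          mod_hom_comp[OF N.leg_hom \<phi>_hom] Suc.IH y(1)])
  also have "\<dots> = frob_map R p \<M> \<phi> (frob_map R p \<N> (legN i) y)"
    by (rule frob_map_comp[OF N.D_module N.Lim_module M.Lim_module N.leg_hom \<phi>_hom y(1), symmetric])
  also have "\<dots> = frob_map R p \<M> \<phi> (\<theta>N (legN (Suc i) x))"
    using N y by (simp add: frob_cone_def)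
  also have "\<dots> = \<theta>M (\<phi> (legN (Suc i) x))"
    by (rule \<phi>_struct[OF mod_homD(1)[OF N.leg_hom Suc.prems], symmetric])
  finally show ?case
    by (rule inj_onD[OF \<theta>M])
      (rule mod_homD(1)[OF M.leg_hom] mod_homD(1)[OF g_hom] mod_homD(1)[OF \<phi>_hom]
        mod_homD(1)[OF N.leg_hom] Suc.prems)+
qed

text \<open>The restriction of \<open>\<phi>\<close> to \<open>N\<close> lifts to some \<open>h : N \<rightarrow> F\<^sup>d(M)\<close>. The square for a morphism from
  \<open>\<beta>\<close> to \<open>F\<^sup>d(\<gamma>)\<close> commutes only after passing to \<open>\<M>\<close>, where both ways around give the restriction
  of \<open>\<phi>\<close>, because \<open>\<phi>\<close> respects the structure maps. As \<open>N\<close> is finitely generated, the square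
  commutes already after \<open>k\<close> further transitions. Composing \<open>h\<close> with those transitions repairs it,
  since \<open>F\<close> turns the transition from \<open>d\<close> to \<open>d + k\<close> into the one from \<open>d + 1\<close> to \<open>d + k + 1\<close>.\<close>

lemma F_hom_descends:
  assumes noeth: "noetherian_ring R"
    and N_fg: "fin_gen_module R N" and \<beta>: "\<beta> \<in> mod_hom R N (frob R p N)"
    and M_mod: "module R M" and \<gamma>: "\<gamma> \<in> mod_hom R M (frob R p M)"
    and N: "frob_cone R p N \<beta> \<N> \<theta>N legN" and M: "frob_cone R p M \<gamma> \<M> \<theta>M legM"
    and \<theta>M: "inj_on \<theta>M (carrier \<M>)" and \<phi>: "\<phi> \<in> F_hom R p \<N> \<theta>N \<M> \<theta>M"
  obtains e g where "g \<in> D_hom R p N \<beta> (frob_pow R p M e) (frob_pow_struct R p M \<gamma> e)"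
    and "\<And>x. x \<in> carrier N \<Longrightarrow> legM e (g x) = \<phi> (legN 0 x)"
proof -
  let ?M = "frob_pow R p M" and ?t = "gen_trans R p M \<gamma>"
  interpret N: limit_cone R "frob_pow R p N" "gen_trans R p N \<beta>" \<N> legN
    using N by (simp add: frob_cone_def)
  interpret M: limit_cone R ?M ?t \<M> legM using M by (simp add: frob_cone_def)
  have \<phi>_hom: "\<phi> \<in> mod_hom R \<N> \<M>"
    and \<phi>_struct: "\<And>x. x \<in> carrier \<N> \<Longrightarrow> \<theta>M (\<phi> x) = frob_map R p \<M> \<phi> (\<theta>N x)"
    using \<phi> by (auto simp: F_hom_def)
  have N_mod: "module R N" and N0: "frob_pow R p N 0 = N"
    using N_fg by (simp_all add: fin_gen_module_def)
  have legN: "legN 0 \<in> mod_hom R N \<N>" using N.leg_hom[of 0] by simp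
  obtain d h where h: "h \<in> mod_hom R N (?M d)"
    and h_leg: "\<And>x. x \<in> carrier N \<Longrightarrow> legM d (h x) = \<phi> (legN 0 x)"
    using M.fin_gen_hom_lift[OF noeth N_fg mod_hom_comp[OF legN \<phi>_hom]] by blast
  \<comment> \<open>The two composites \<open>N \<rightarrow> F\<^sup>d\<^sup>+\<^sup>1(M)\<close> that have to agree.\<close>
  define a where "a x = ?t d (h x)" for x
  define b where "b x = frob_code R p (?M d) (frob_map R p (?M d) h (\<beta> x))" for x
  have a_hom: "a \<in> mod_hom R N (?M (Suc d))"
    unfolding a_def by (rule mod_hom_comp[OF h M.t_hom])
  have hF: "frob_map R p (?M d) h \<in> mod_hom R (frob R p N) (frob R p (?M d))"
    by (rule frob_map_hom[OF N_mod M.D_module h])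
  have b_hom: "b \<in> mod_hom R N (?M (Suc d))"
    unfolding b_def frob_pow.simps
    by (rule mod_hom_comp[OF mod_hom_comp[OF \<beta> hF] frob_code_hom[OF M.D_module]])
  have "legM (Suc d) (a x) = legM (Suc d) (b x)" if x: "x \<in> carrier N" for x
  proof (rule inj_onD[OF \<theta>M])
    have \<beta>x: "\<beta> x \<in> carrier (frob R p N)" by (rule mod_homD(1)[OF \<beta> x])
    have "gen_trans R p N \<beta> 0 x = frob_code R p N (\<beta> x)"
      by (simp add: gen_trans_def)
    then have legN_\<beta>: "legN 0 x = legN (Suc 0) (frob_code R p N (\<beta> x))"
      using N.leg_step[of x 0] x by simp
    have "\<theta>M (legM (Suc d) (a x)) = \<theta>M (\<phi> (legN 0 x))"
      using M.leg_step[OF mod_homD(1)[OF h x]] h_leg[OF x] by (simp add: a_def)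
    also have "\<dots> = frob_map R p \<M> \<phi> (\<theta>N (legN 0 x))"
      by (rule \<phi>_struct[OF mod_homD(1)[OF legN x]])
    also have "\<theta>N (legN 0 x) = frob_map R p \<N> (legN 0) (\<beta> x)"
      unfolding legN_\<beta> using N \<beta>x unfolding frob_cone_def by (metis N0)
    also have "frob_map R p \<M> \<phi> (frob_map R p \<N> (legN 0) (\<beta> x)) = frob_map R p \<M> (\<lambda>x. \<phi> (legN 0 x)) (\<beta> x)"
      by (rule frob_map_comp[OF N_mod N.Lim_module M.Lim_module legN \<phi>_hom \<beta>x])
    also have "\<dots> = frob_map R p \<M> (\<lambda>x. legM d (h x)) (\<beta> x)"
      by (rule frob_map_cong[OF N_mod M.Lim_module mod_hom_comp[OF legN \<phi>_hom]
            mod_hom_comp[OF h M.leg_hom] h_leg[symmetric] \<beta>x])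
    also have "\<dots> = frob_map R p \<M> (legM d) (frob_map R p (?M d) h (\<beta> x))"
      by (rule frob_map_comp[OF N_mod M.D_module M.Lim_module h M.leg_hom \<beta>x, symmetric])
    also have "\<dots> = \<theta>M (legM (Suc d) (b x))"
      using M mod_homD(1)[OF hF \<beta>x] by (simp add: frob_cone_def b_def)
    finally show "\<theta>M (legM (Suc d) (a x)) = \<theta>M (legM (Suc d) (b x))" .
  qed (rule mod_homD(1)[OF M.leg_hom] mod_homD(1)[OF a_hom] mod_homD(1)[OF b_hom] x)+
  then obtain k where k: "\<And>x. x \<in> carrier N \<Longrightarrow> seq_trans ?t (Suc d) k (a x) = seq_trans ?t (Suc d) k (b x)"
    using M.fin_gen_eventually_eq[OF N_fg a_hom b_hom] by blast
  define e where "e = d + k"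
  define g where "g x = seq_trans ?t d k (h x)" for x
  have g: "g \<in> mod_hom R N (?M e)"
    unfolding g_def e_def by (rule mod_hom_comp[OF h M.seq_trans_hom])
  have "frob_pow_struct R p M \<gamma> e (g x) = frob_map R p (?M e) g (\<beta> x)" if x: "x \<in> carrier N" for x
  proof (rule inj_onD[OF inj_frob_code])
    have \<beta>x: "\<beta> x \<in> carrier (frob R p N)" by (rule mod_homD(1)[OF \<beta> x])
    have "frob_code R p (?M e) (frob_pow_struct R p M \<gamma> e (g x)) = ?t e (g x)"
      using code_frob_pow_struct[of R p M e \<gamma>] by (simp add: fun_eq_iff)
    also have "\<dots> = seq_trans ?t (Suc d) k (a x)"
      using M.seq_trans_Suc_left[of d k "h x"] by (simp add: g_def a_def e_def)
    also have "\<dots> = seq_trans ?t (Suc d) k (b x)" by (rule k[OF x])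
    also have "\<dots> = frob_code R p (?M e) (frob_map R p (?M e) (seq_trans ?t d k) (frob_map R p (?M d) h (\<beta> x)))"
      unfolding b_def e_def by (rule seq_trans_code[OF M_mod \<gamma> mod_homD(1)[OF hF \<beta>x]])
    also have "frob_map R p (?M e) (seq_trans ?t d k) (frob_map R p (?M d) h (\<beta> x)) = frob_map R p (?M e) g (\<beta> x)"
      unfolding g_def e_def by (rule frob_map_comp[OF N_mod M.D_module M.D_module h M.seq_trans_hom \<beta>x])
    finally show "frob_code R p (?M e) (frob_pow_struct R p M \<gamma> e (g x)) =
        frob_code R p (?M e) (frob_map R p (?M e) g (\<beta> x))" .
    show "frob_pow_struct R p M \<gamma> e (g x) \<in> carrier (frob R p (?M e))"
      by (rule mod_homD(1)[OF frob_pow_struct_hom[OF M_mod \<gamma>] mod_homD(1)[OF g x]])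
    show "frob_map R p (?M e) g (\<beta> x) \<in> carrier (frob R p (?M e))"
      by (rule mod_homD(1)[OF frob_map_hom[OF N_mod M.D_module g] \<beta>x])
  qed
  then have "g \<in> D_hom R p N \<beta> (?M e) (frob_pow_struct R p M \<gamma> e)"
    using g by (simp add: D_hom_def)
  moreover have "legM e (g x) = \<phi> (legN 0 x)" if "x \<in> carrier N" for x
    using M.leg_seq_trans[OF mod_homD(1)[OF h that]] h_leg[OF that] by (simp add: e_def g_def)
  ultimately show ?thesis by (rule that)
qed

theorem theorem3p4:
  fixes R :: "('a, 'k) ring_scheme" and \<mm> :: "'a set" and p :: nat
    and \<N> :: "('a, 'b) module" and \<M> :: "('a, 'c) module"
  assumes "complete_regular_local_ring_char R \<mm> p"
    and "F_finite R p \<N> \<theta>N"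
    and "F_finite R p \<M> \<theta>M"
    and "\<phi> \<in> F_hom R p \<N> \<theta>N \<M> \<theta>M"
  shows "\<exists>M \<gamma> v N \<beta> u g.
    generating_morphism R p M \<gamma> \<M> \<theta>M v \<and>
    generating_morphism R p N \<beta> \<N> \<theta>N u \<and>
    g \<in> D_hom R p N \<beta> M \<gamma> \<and>
    (\<forall>\<xi> \<in> carrier (gen_lim R p N \<beta>). \<phi> (u \<xi>) = v (gen_lim_map R p N M \<gamma> g \<xi>))"
proof -
  have noeth: "noetherian_ring R"
    using assms(1) by (simp add: complete_regular_local_ring_char_def regular_local_ring_def
        noetherian_local_ring_def)
  have \<N>: "module R \<N>" and \<M>: "module R \<M>" and \<theta>M: "inj_on \<theta>M (carrier \<M>)"
    using assms(2,3) by (auto simp: F_finite_def F_module_def mod_iso_def bij_betw_def)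
  obtain N \<beta> u where N_gen: "generating_morphism R p N \<beta> \<N> \<theta>N u"
    using assms(2) by (auto simp: F_finite_def)
  obtain M0 \<gamma>0 v0 where M0_gen: "generating_morphism R p M0 \<gamma>0 \<M> \<theta>M v0"
    using assms(3) by (auto simp: F_finite_def)
  define legN where "legN i x = u (dirlim_in (frob_pow R p N) (gen_trans R p N \<beta>) i x)" for i x
  define leg0 where "leg0 i x = v0 (dirlim_in (frob_pow R p M0) (gen_trans R p M0 \<gamma>0) i x)" for i x
  have N_cone: "frob_cone R p N \<beta> \<N> \<theta>N legN"
    unfolding legN_def by (rule generating_morphism_frob_cone[OF N_gen \<N>])
  have M0_cone: "frob_cone R p M0 \<gamma>0 \<M> \<theta>M leg0"
    unfolding leg0_def by (rule generating_morphism_frob_cone[OF M0_gen \<M>])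
  have N: "fin_gen_module R N" "\<beta> \<in> mod_hom R N (frob R p N)"
    and M0: "fin_gen_module R M0" "module R M0" "\<gamma>0 \<in> mod_hom R M0 (frob R p M0)"
    using N_gen M0_gen by (auto simp: generating_morphism_def D_obj_def fin_gen_module_def)
  obtain e g where g: "g \<in> D_hom R p N \<beta> (frob_pow R p M0 e) (frob_pow_struct R p M0 \<gamma>0 e)"
    and g_leg: "\<And>x. x \<in> carrier N \<Longrightarrow> leg0 e (g x) = \<phi> (legN 0 x)"
    using F_hom_descends[OF noeth N M0(2,3) N_cone M0_cone \<theta>M assms(4)] by blast
  \<comment> \<open>Only the generating morphism of the target is replaced, by its \<open>e\<close>-th Frobenius iterate.\<close>
  define M where "M = frob_pow R p M0 e"
  define \<gamma> where "\<gamma> = frob_pow_struct R p M0 \<gamma>0 e"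
  define legM where "legM i = leg0 (e + i)" for i
  have M_cone: "frob_cone R p M \<gamma> \<M> \<theta>M legM"
    unfolding M_def \<gamma>_def legM_def by (rule frob_cone_shift[OF M0_cone])
  have "D_obj R p M \<gamma>"
    unfolding M_def \<gamma>_def D_obj_def
    using frob_pow_fin_gen[OF M0(1)] frob_pow_struct_hom[OF M0(2,3)] by blast
  then obtain v where v: "generating_morphism R p M \<gamma> \<M> \<theta>M v"
    and v_leg: "\<And>i x. x \<in> carrier (frob_pow R p M i) \<Longrightarrow>
      v (dirlim_in (frob_pow R p M) (gen_trans R p M \<gamma>) i x) = legM i x"
    using frob_cone_generating_morphism[OF _ M_cone] by blast
  let ?iN = "dirlim_in (frob_pow R p N) (gen_trans R p N \<beta>)"
  let ?iM = "dirlim_in (frob_pow R p M) (gen_trans R p M \<gamma>)"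
  let ?g = "frob_pow_map R p N M g"
  interpret N: limit_cone R "frob_pow R p N" "gen_trans R p N \<beta>" \<N> legN
    using N_cone by (simp add: frob_cone_def)
  interpret M: limit_cone R "frob_pow R p M" "gen_trans R p M \<gamma>" \<M> legM
    using M_cone by (simp add: frob_cone_def)
  have g_hom: "g \<in> mod_hom R N M" using g by (simp add: D_hom_def M_def)
  have N_mod: "module R N" using N by (simp add: fin_gen_module_def)
  have M_mod: "module R M" using M.D_module[of 0] by simp
  have g_closed: "?g i x \<in> carrier (frob_pow R p M i)" if "x \<in> carrier (frob_pow R p N i)" for i x
    by (rule mod_homD(1)[OF frob_pow_map_hom[OF N_mod M_mod g_hom] that])
  have v_g: "v (?iM i (?g i x)) = \<phi> (legN i x)" if "x \<in> carrier (frob_pow R p N i)" for i x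
    using F_hom_on_cones[OF N_cone M_cone \<theta>M assms(4) g_hom _ that] g_leg v_leg[OF g_closed[OF that]]
    by (simp add: legM_def)
  have v_inj: "inj_on v (carrier (gen_lim R p M \<gamma>))"
    using v by (auto simp: generating_morphism_def F_iso_def bij_betw_def)
  have "\<phi> (u \<xi>) = v (gen_lim_map R p N M \<gamma> g \<xi>)" if \<xi>: "\<xi> \<in> carrier (gen_lim R p N \<beta>)" for \<xi>
  proof -
    obtain i x where x: "x \<in> carrier (frob_pow R p N i)" "\<xi> = ?iN i x"
      using \<xi> by (auto simp: gen_lim_def N.carrier_dirlim)
    \<comment> \<open>The value does not depend on the representative: the injective map \<open>v\<close> sends it to \<open>\<phi> (u \<xi>)\<close>.\<close>
    have "?iM j (?g j y) = ?iM i (?g i x)" if y: "(j, y) \<in> \<xi>" for j y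
    proof (rule inj_onD[OF v_inj])
      have y': "y \<in> carrier (frob_pow R p N j)" "?iN j y = ?iN i x"
        using y unfolding x(2) N.mem_dirlim_in by blast+
      then show "v (?iM j (?g j y)) = v (?iM i (?g i x))"
        using v_g[OF y'(1)] v_g[OF x(1)] by (simp add: legN_def)
      show "?iM j (?g j y) \<in> carrier (gen_lim R p M \<gamma>)" "?iM i (?g i x) \<in> carrier (gen_lim R p M \<gamma>)"
        unfolding gen_lim_def by (intro M.dirlim_in_closed g_closed y' x)+
    qed
    moreover have "(i, x) \<in> \<xi>"
      unfolding x(2) N.mem_dirlim_in using x(1) by blast
    ultimately have "{?iM j (?g j y) | j y. (j, y) \<in> \<xi>} = {?iM i (?g i x)}" by blast
    then have "gen_lim_map R p N M \<gamma> g \<xi> = ?iM i (?g i x)"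
      by (simp add: gen_lim_map_def dirlim_map_def)
    then show ?thesis
      using v_g[OF x(1)] by (simp add: x(2) legN_def)
  qed
  with v N_gen g show ?thesis
    unfolding M_def \<gamma>_def by blast
qed

end
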